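(* Let $n>0$ be an integer, let $K$ be a field of characteristic $0$, and let $S=K[x_1,\ldots,x_{2n}]$ be the standard graded polynomial ring. There exists a finitely generated graded $S$-module $M$, generated by elements of degree $0$, such that $\operatorname{reg}(M)=1$ and the graded Betti numbers of $M$ are $$\beta_{i,j}(M)=\begin{cases}\binom{2n}{i+1}-\binom{2n}{i-1} & \text{if } j=i \text{ and } 0\le i\le n,\\[2pt] \binom{2n}{i}-\binom{2n}{i+2} & \text{if } j=i+1 \text{ and } n\le i\le 2n,\\[2pt] 0 & \text{otherwise.}\end{cases}$$ In particular, if $N=\mathrm{Syz}_n(M)$, then $$\beta_i^{\mathrm{lin}}(N)=\binom{2n}{n+i}-\binom{2n}{n+i+2}\qquad\text{for all } i\ge 0,$$ so that $N$ is a graded $n$th syzygy module over $S$ whose linear strand has length $n$, and for every $i$ with $0\le i\le n-2$ $$\beta_i^{\mathrm{lin}}(N)<\binom{n+n}{i+n};$$ that is, $N$ violates, for $0\le i\le n-2$, the inequality of Herzog's Conjecture (with $k=p=n$).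
   Context: Convention: $\binom{m}{k}=0$ if $k<0$ or $k>m$. For a finitely generated graded $S$-module $M$, the graded Betti numbers are $\beta_{i,j}(M)=\dim_K \operatorname{Tor}_i^S(M,K)_j$, and $\operatorname{reg}(M)=\sup\{j-i : \operatorname{Tor}_i^S(M,K)_j\ne 0\}$ is the Castelnuovo-Mumford regularity. $\mathrm{Syz}_k(M)$ denotes the $k$th syzygy module of $M$, i.e. the image of $F_k\to F_{k-1}$ (for $k\geq 1$) in the minimal graded free resolution $F_\bullet$ of $M$, with $F_0\to M$ the minimal free cover. A graded $k$th syzygy module over $S$ is a graded module $N$ fitting in an exact sequence of graded modules $0\to N\to G_{k-1}\to\cdots\to G_0$ with all $G_i$ finitely generated graded free. If $d$ denotes the minimal degree of a generator of a finitely generated graded module $N$, the Betti numbers in the linear strand of $N$ are $\beta_i^{\mathrm{lin}}(N)=\beta_{i,d+i}(N)$, and the length of the linear strand of $N$ is $\max\{i : \beta_i^{\mathrm{lin}}(N)\neq 0\}$. Herzog's Conjecture: if $N$ is a graded $k$th syzygy module over $S$ with linear strand of length $p$, then $\beta_i^{\mathrm{lin}}(N)\ge\binom{p+k}{i+k}$. *)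

theory Defs
  imports
    "HOL-Algebra.Module"
    "HOL-Library.Poly_Mapping"
    "HOL-Library.Function_Algebras"
    "HOL-Library.Extended_Real"
begin

text \<open>
  The polynomial ring over \<open>'k\<close> whose variables are the elements of \<open>'v\<close>: a monomial is an exponent
  vector of type \<open>'v \<Rightarrow>\<^sub>0 nat\<close>, and a polynomial is a finitely supported function from
  monomials to coefficients.
\<close>

type_synonym ('v, 'k) mpoly = "('v \<Rightarrow>\<^sub>0 nat) \<Rightarrow>\<^sub>0 'k"

definition poly_ring :: "('v, 'k::field) mpoly ring" where
  "poly_ring = \<lparr>carrier = UNIV, mult = (*), one = 1, zero = 0, add = (+)\<rparr>"

definition homog :: "int \<Rightarrow> ('v::finite, 'k::field) mpoly set" where
  "homog d = {p. \<forall>m \<in> Poly_Mapping.keys p. int (\<Sum>v\<in>UNIV. Poly_Mapping.lookup m v) = d}"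

subsection \<open>Graded modules\<close>

record ('a, 'm) gmodule = "('a, 'm) module" +
  grade :: "int \<Rightarrow> 'm set"

text \<open>The third condition says that the module is the internal direct sum of its graded pieces.\<close>

definition graded_module :: "(('v::finite, 'k::field) mpoly, 'm) gmodule \<Rightarrow> bool" where
  "graded_module M \<longleftrightarrow>
     Module.module poly_ring M \<and>
     (\<forall>j. subgroup (grade M j) (add_monoid M)) \<and>
     (\<forall>x \<in> carrier M. \<exists>!f. (\<forall>j. f j \<in> grade M j) \<and> finite {j. f j \<noteq> \<zero>\<^bsub>M\<^esub>} \<and>
        x = (\<Oplus>\<^bsub>M\<^esub>j\<in>{j. f j \<noteq> \<zero>\<^bsub>M\<^esub>}. f j)) \<and>
     (\<forall>d j. \<forall>p \<in> homog d. \<forall>x \<in> grade M j. p \<odot>\<^bsub>M\<^esub> x \<in> grade M (d + j))"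

definition generates :: "(('v::finite, 'k::field) mpoly, 'm) gmodule \<Rightarrow> 'm set \<Rightarrow> bool" where
  "generates M X \<longleftrightarrow>
     X \<subseteq> carrier M \<and> (\<forall>H. submodule H poly_ring M \<and> X \<subseteq> H \<longrightarrow> H = carrier M)"

definition minimal_generators ::
    "(('v::finite, 'k::field) mpoly, 'm) gmodule \<Rightarrow> 'm set \<Rightarrow> bool" where
  "minimal_generators M X \<longleftrightarrow>
     X \<subseteq> (\<Union>j. grade M j) \<and> generates M X \<and> (\<forall>Y. Y \<subset> X \<longrightarrow> \<not> generates M Y)"

text \<open>Graded homomorphisms are homogeneous of degree 0.\<close>

definition graded_hom ::
    "(('v::finite, 'k::field) mpoly, 'm) gmodule \<Rightarrow> (('v, 'k) mpoly, 'n) gmodule \<Rightarrow>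
     ('m \<Rightarrow> 'n) \<Rightarrow> bool" where
  "graded_hom M N f \<longleftrightarrow>
     (\<forall>x \<in> carrier M. f x \<in> carrier N) \<and>
     (\<forall>x \<in> carrier M. \<forall>y \<in> carrier M. f (x \<oplus>\<^bsub>M\<^esub> y) = f x \<oplus>\<^bsub>N\<^esub> f y) \<and>
     (\<forall>p. \<forall>x \<in> carrier M. f (p \<odot>\<^bsub>M\<^esub> x) = p \<odot>\<^bsub>N\<^esub> f x) \<and>
     (\<forall>j. \<forall>x \<in> grade M j. f x \<in> grade N j)"

definition hom_kernel ::
    "(('v::finite, 'k::field) mpoly, 'm) gmodule \<Rightarrow> (('v, 'k) mpoly, 'n) gmodule \<Rightarrow>
     ('m \<Rightarrow> 'n) \<Rightarrow> 'm set" where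
  "hom_kernel M N f = {x \<in> carrier M. f x = \<zero>\<^bsub>N\<^esub>}"

subsection \<open>Graded free modules and resolutions\<close>

text \<open>
  The graded free module with one basis element of degree \<open>ds ! k\<close> for each \<open>k < length ds\<close>; up to
  isomorphism these are all the finitely generated graded free modules. A vector of
  coordinates is a function on \<open>nat\<close> that vanishes from \<open>length ds\<close> on. The multiplicative
  fields of the record play no role for modules.
\<close>

definition gfree :: "int list \<Rightarrow> (('v::finite, 'k::field) mpoly, nat \<Rightarrow> ('v, 'k) mpoly) gmodule" where
  "gfree ds =
     \<lparr>carrier = {f. \<forall>k \<ge> length ds. f k = 0},
      mult = undefined, one = undefined,
      zero = (\<lambda>k. 0), add = (\<lambda>f g k. f k + g k),
      smult = (\<lambda>p f k. p * f k),
      grade = (\<lambda>j. {f. (\<forall>k \<ge> length ds. f k = 0) \<and> (\<forall>k < length ds. f k \<in> homog (j - ds ! k))})\<rparr>"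

text \<open>
  Data of a resolution \<open>\<dots> \<rightarrow> F\<^sub>1 \<rightarrow> F\<^sub>0 \<rightarrow> M \<rightarrow> 0\<close>: the degrees of the basis
  elements of each \<open>F\<^sub>i\<close>, the differentials \<open>diff F i\<close> from position \<open>i + 1\<close> to position \<open>i\<close>, and the
  augmentation.
\<close>

record ('f, 'm) free_complex_data =
  shifts :: "nat \<Rightarrow> int list"
  diff :: "nat \<Rightarrow> 'f \<Rightarrow> 'f"
  aug :: "'f \<Rightarrow> 'm"

type_synonym ('v, 'k, 'm) free_complex = "(nat \<Rightarrow> ('v, 'k) mpoly, 'm) free_complex_data"

definition term_at ::
    "('v::finite, 'k::field, 'm) free_complex \<Rightarrow> nat \<Rightarrow>
     (('v, 'k) mpoly, nat \<Rightarrow> ('v, 'k) mpoly) gmodule" where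
  "term_at F i = gfree (shifts F i)"

definition graded_free_resolution ::
    "(('v::finite, 'k::field) mpoly, 'm) gmodule \<Rightarrow> ('v, 'k, 'm) free_complex \<Rightarrow> bool" where
  "graded_free_resolution M F \<longleftrightarrow>
     graded_hom (term_at F 0) M (aug F) \<and>
     (\<forall>i. graded_hom (term_at F (Suc i)) (term_at F i) (diff F i)) \<and>
     aug F ` carrier (term_at F 0) = carrier M \<and>
     diff F 0 ` carrier (term_at F 1) = hom_kernel (term_at F 0) M (aug F) \<and>
     (\<forall>i. diff F (Suc i) ` carrier (term_at F (Suc (Suc i))) =
            hom_kernel (term_at F (Suc i)) (term_at F i) (diff F i))"

text \<open>
  Minimality: the image of each differential lies in the homogeneous maximal ideal times the target,
  i.e. all coordinates have constant coefficient 0.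
\<close>

definition minimal_resolution ::
    "(('v::finite, 'k::field) mpoly, 'm) gmodule \<Rightarrow> ('v, 'k, 'm) free_complex \<Rightarrow> bool" where
  "minimal_resolution M F \<longleftrightarrow>
     graded_free_resolution M F \<and>
     (\<forall>i. \<forall>x \<in> carrier (term_at F (Suc i)). \<forall>k. Poly_Mapping.lookup (diff F i x k) 0 = 0)"

subsection \<open>Tor, graded Betti numbers, regularity\<close>

text \<open>
  Tensoring \<open>gfree ds\<close> with the residue field \<open>K\<close> gives the graded vector space with basis
  indexed by \<open>k < length ds\<close>, the basis element \<open>k\<close> having degree \<open>ds ! k\<close>; \<open>tensor_piece ds j\<close> is its
  piece of degree \<open>j\<close>. For a linear map \<open>\<phi>\<close> between free modules, \<open>tensor_map \<phi>\<close> is the map induced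
  on the tensor products with \<open>K\<close>: lift to constant coordinates, apply \<open>\<phi>\<close>, and reduce modulo the maximal
  ideal.
\<close>

definition tensor_piece :: "int list \<Rightarrow> int \<Rightarrow> (nat \<Rightarrow> 'k::field) set" where
  "tensor_piece ds j = {c. \<forall>k. c k \<noteq> 0 \<longrightarrow> k < length ds \<and> ds ! k = j}"

definition tensor_map ::
    "((nat \<Rightarrow> ('v::finite, 'k::field) mpoly) \<Rightarrow> (nat \<Rightarrow> ('v, 'k) mpoly)) \<Rightarrow>
     (nat \<Rightarrow> 'k) \<Rightarrow> (nat \<Rightarrow> 'k)" where
  "tensor_map \<phi> c = (\<lambda>k. Poly_Mapping.lookup (\<phi> (\<lambda>l. Poly_Mapping.single 0 (c l)) k) 0)"

definition tensor_cycles ::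
    "('v::finite, 'k::field, 'm) free_complex \<Rightarrow> nat \<Rightarrow> int \<Rightarrow> (nat \<Rightarrow> 'k) set" where
  "tensor_cycles F i j =
     (case i of
        0 \<Rightarrow> tensor_piece (shifts F 0) j
      | Suc i' \<Rightarrow> {c \<in> tensor_piece (shifts F i) j. tensor_map (diff F i') c = 0})"

definition tensor_boundaries ::
    "('v::finite, 'k::field, 'm) free_complex \<Rightarrow> nat \<Rightarrow> int \<Rightarrow> (nat \<Rightarrow> 'k) set" where
  "tensor_boundaries F i j = tensor_map (diff F i) ` tensor_piece (shifts F (Suc i)) j"

text \<open>
  \<open>Tor\<^sub>i(M, K)\<^sub>j\<close> is the quotient of \<open>tor_cycles M i j\<close> by its subspace \<open>tor_boundaries M i j\<close>,
  both finite-dimensional; it is computed from an arbitrarily chosen graded free resolution of \<open>M\<close>, on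
  which it does not depend up to isomorphism.
\<close>

definition some_resolution ::
    "(('v::finite, 'k::field) mpoly, 'm) gmodule \<Rightarrow> ('v, 'k, 'm) free_complex" where
  "some_resolution M = (SOME F. graded_free_resolution M F)"

definition tor_cycles ::
    "(('v::finite, 'k::field) mpoly, 'm) gmodule \<Rightarrow> nat \<Rightarrow> int \<Rightarrow> (nat \<Rightarrow> 'k) set" where
  "tor_cycles M = tensor_cycles (some_resolution M)"

definition tor_boundaries ::
    "(('v::finite, 'k::field) mpoly, 'm) gmodule \<Rightarrow> nat \<Rightarrow> int \<Rightarrow> (nat \<Rightarrow> 'k) set" where
  "tor_boundaries M = tensor_boundaries (some_resolution M)"

definition betti :: "(('v::finite, 'k::field) mpoly, 'm) gmodule \<Rightarrow> nat \<Rightarrow> int \<Rightarrow> nat" where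
  "betti M i j =
     vector_space.dim (\<lambda>(a::'k) c k. a * c k) (tor_cycles M i j) -
     vector_space.dim (\<lambda>(a::'k) c k. a * c k) (tor_boundaries M i j)"

text \<open>The regularity of the zero module is \<open>-\<infinity>\<close>.\<close>

definition regularity :: "(('v::finite, 'k::field) mpoly, 'm) gmodule \<Rightarrow> ereal" where
  "regularity M =
     Sup {ereal (real_of_int (j - int i)) | i j. tor_cycles M i j \<noteq> tor_boundaries M i j}"

subsection \<open>Syzygy modules and the linear strand\<close>

text \<open>
  The \<open>k\<close>-th syzygy module for \<open>k \<ge> 1\<close>: the image of \<open>F\<^sub>k \<rightarrow> F\<^sub>k\<^sub>-\<^sub>1\<close> in a minimal graded free
  resolution (which is unique up to isomorphism), graded as a submodule of \<open>F\<^sub>k\<^sub>-\<^sub>1\<close>.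
\<close>

definition some_minimal_resolution ::
    "(('v::finite, 'k::field) mpoly, 'm) gmodule \<Rightarrow> ('v, 'k, 'm) free_complex" where
  "some_minimal_resolution M = (SOME F. minimal_resolution M F)"

definition Syz ::
    "nat \<Rightarrow> (('v::finite, 'k::field) mpoly, 'm) gmodule \<Rightarrow>
     (('v, 'k) mpoly, nat \<Rightarrow> ('v, 'k) mpoly) gmodule" where
  "Syz k M =
     (let F = some_minimal_resolution M;
          I = diff F (k - 1) ` carrier (term_at F k)
      in (term_at F (k - 1)) \<lparr>carrier := I, grade := (\<lambda>j. I \<inter> grade (term_at F (k - 1)) j)\<rparr>)"

text \<open>
  Graded \<open>k\<close>-th syzygy modules for \<open>k \<ge> 1\<close>: exactness of \<open>0 \<rightarrow> N \<rightarrow> G\<^sub>k\<^sub>-\<^sub>1 \<rightarrow> \<dots> \<rightarrow> G\<^sub>0\<close>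
  means that the first map \<open>\<iota>\<close> is injective, that its image is the kernel of the next map (if
  \<open>k \<ge> 2\<close>), and exactness at \<open>G\<^sub>i\<close> for \<open>1 \<le> i \<le> k - 2\<close>. The map \<open>\<delta> i\<close> goes from \<open>G\<^sub>i\<^sub>+\<^sub>1\<close> to \<open>G\<^sub>i\<close>, and \<open>G\<^sub>i\<close>
  is \<open>gfree (ds i)\<close>.
\<close>

definition graded_syzygy_module ::
    "nat \<Rightarrow> (('v::finite, 'k::field) mpoly, 'm) gmodule \<Rightarrow> bool" where
  "graded_syzygy_module k N \<longleftrightarrow>
     k \<ge> 1 \<and> graded_module N \<and>
     (\<exists>(ds :: nat \<Rightarrow> int list)
        (\<delta> :: nat \<Rightarrow> (nat \<Rightarrow> ('v, 'k) mpoly) \<Rightarrow> (nat \<Rightarrow> ('v, 'k) mpoly))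
        (\<iota> :: 'm \<Rightarrow> nat \<Rightarrow> ('v, 'k) mpoly).
        graded_hom N (gfree (ds (k - 1))) \<iota> \<and>
        (\<forall>i. i + 1 < k \<longrightarrow> graded_hom (gfree (ds (i + 1))) (gfree (ds i)) (\<delta> i)) \<and>
        inj_on \<iota> (carrier N) \<and>
        (k \<ge> 2 \<longrightarrow>
           \<iota> ` carrier N = hom_kernel (gfree (ds (k - 1))) (gfree (ds (k - 2))) (\<delta> (k - 2))) \<and>
        (\<forall>i. i + 2 < k \<longrightarrow>
           \<delta> (i + 1) ` carrier (gfree (ds (i + 2))) =
           hom_kernel (gfree (ds (i + 1))) (gfree (ds i)) (\<delta> i)))"

definition initial_degree :: "(('v::finite, 'k::field) mpoly, 'm) gmodule \<Rightarrow> int" where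
  "initial_degree N = (LEAST d. \<exists>X. minimal_generators N X \<and> (\<exists>x \<in> X. x \<in> grade N d))"

definition lin_betti :: "(('v::finite, 'k::field) mpoly, 'm) gmodule \<Rightarrow> nat \<Rightarrow> nat" where
  "lin_betti N i = betti N i (initial_degree N + int i)"

definition lin_strand_length :: "(('v::finite, 'k::field) mpoly, 'm) gmodule \<Rightarrow> nat" where
  "lin_strand_length N = Max {i. lin_betti N i \<noteq> 0}"

text \<open>Binomial coefficients with the convention that they vanish for a negative lower index.\<close>

definition binom :: "nat \<Rightarrow> int \<Rightarrow> int" where
  "binom m k = (if k < 0 then 0 else int (m choose nat k))"

end

theory Submission
  imports Defs
begin

text \<open>
  Let \<open>V\<close> be a symplectic space of dimension \<open>2n\<close> with basis the variables. Contraction \<open>\<Lambda>\<close> with the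
  symplectic form lowers exterior degree by 2 and commutes with the Koszul differential \<open>\<partial>\<close> on
  \<open>S \<otimes> \<And>V\<close>; by hard Lefschetz, \<open>\<Lambda> : \<And>\<^sup>i\<^sup>+\<^sup>2V \<rightarrow> \<And>\<^sup>iV\<close> is onto for \<open>i \<le> n - 1\<close> and one-to-one for \<open>i \<ge> n - 1\<close>.
  Minimizing the mapping cone of \<open>\<Lambda>\<close> gives the complex with terms \<open>S \<otimes> ker (\<Lambda> : \<And>\<^sup>i\<^sup>+\<^sup>1V \<rightarrow> \<And>\<^sup>i\<^sup>-\<^sup>1V)\<close> for \<open>i < n\<close>
  and \<open>S \<otimes> coker (\<Lambda> : \<And>\<^sup>i\<^sup>+\<^sup>2V \<rightarrow> \<And>\<^sup>iV)\<close> for \<open>i \<ge> n\<close>, whose differentials are induced by \<open>\<partial>\<close> except for the middle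
  one, which is \<open>\<partial> \<Lambda>\<^sup>-\<^sup>1 \<partial>\<close>. A diagram chase with the exactness of the Koszul complex shows that it is exact in
  positive degrees, so it is the minimal free resolution of the cokernel \<open>M\<close> of its last map. Its ranks
  are the stated Betti numbers, and its tail resolves the \<open>n\<close>-th syzygy module.
\<close>

subsection \<open>Linear algebra in spaces of functions\<close>

text \<open>Without the cokernel, the Koszul terms of exterior degree n + i would have rank
  binom(2n, n+i) and just meet the conjectured bound. Passing to the cokernel of
  \<open>\<Lambda>\<close> removes binom(2n, n+i+2), which is positive exactly for i at most n - 2.
  The turning point n - 1 comes from sl_2: \<open>\<Lambda>\<close> and its adjoint have commutator
  n - k on exterior degree k. Inverting \<open>\<Lambda>\<close> therefore means dividing by the
  integers (r+1)(n-k+r) or (r+1)(n-k-r). They do not vanish on the respective sides of the middle,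
  and characteristic 0 keeps them nonzero in K. Two obstacles shape the rest. Tor and
  \<open>Syz\<close> are defined from arbitrarily chosen resolutions, so an explicit resolution
  determines \<open>betti\<close> only after comparison maps and homotopies are available. And the
  terms of a resolution must be coordinate modules \<open>gfree\<close>, whereas the cokernel of
  \<open>\<Lambda>\<close> is a quotient: a linear one-sided inverse of \<open>\<Lambda>\<close> is
  fixed over K, and its kernel stands for the cokernel. Kernels and cokernels then become subspaces
  of one function space, which only need coordinates.\<close>

abbreviation (input) fscale :: "'k::field \<Rightarrow> ('i \<Rightarrow> 'k) \<Rightarrow> 'i \<Rightarrow> 'k" where
  "fscale \<equiv> (\<lambda>a c k. a * c k)"

text \<open>The scalar multiplication is literally the one in the definition of
  \<open>betti\<close>, so \<open>fs.dim\<close> is the dimension meant there.\<close>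

interpretation fs: vector_space "fscale :: 'k::field \<Rightarrow> ('i \<Rightarrow> 'k) \<Rightarrow> 'i \<Rightarrow> 'k"
  by unfold_locales (auto simp: fun_eq_iff algebra_simps)

interpretation fsp: vector_space_pair "fscale :: 'k::field \<Rightarrow> ('i \<Rightarrow> 'k) \<Rightarrow> 'i \<Rightarrow> 'k"
    "fscale :: 'k::field \<Rightarrow> ('j \<Rightarrow> 'k) \<Rightarrow> 'j \<Rightarrow> 'k"
  by unfold_locales

lemmas vector_space_fscale = fs.vector_space_axioms

abbreviation flinear :: "(('i \<Rightarrow> 'k::field) \<Rightarrow> 'j \<Rightarrow> 'k) \<Rightarrow> bool" where
  "flinear \<equiv> Vector_Spaces.linear fscale fscale"

lemma flinearI:
  assumes "\<And>f g. T (f + g) = T f + T g" "\<And>a f. T (\<lambda>k. a * f k) = (\<lambda>k. a * T f k)"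
  shows "flinear T"
  unfolding Vector_Spaces.linear_iff by (intro conjI allI vector_space_fscale assms)

section \<open>Dimensions of subspaces, quotients, kernels and images\<close>

context vector_space
begin

lemma finite_basis_exists:
  assumes "finite S" "V \<subseteq> span S"
  obtains B where "finite B" "B \<subseteq> V" "independent B" "V \<subseteq> span B" "card B = dim V"
proof -
  obtain B where B: "B \<subseteq> V" "independent B" "V \<subseteq> span B" "card B = dim V"
    using basis_exists by blast
  moreover have "finite B"
    using independent_span_bound[OF assms(1) B(2)] B(1) assms(2) by auto
  ultimately show thesis using that by blast
qed

lemma independent_card_le_dim_subset:
  assumes "finite S" "V \<subseteq> span S" "independent B" "B \<subseteq> V"
  shows "finite B" "card B \<le> dim V"
proof -
  obtain C where C: "finite C" "C \<subseteq> V" "independent C" "V \<subseteq> span C" "card C = dim V"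
    using finite_basis_exists assms by blast
  have "finite B \<and> card B \<le> card C"
    using independent_span_bound[OF C(1) assms(3)] assms(4) C(4) by blast
  thus "finite B" "card B \<le> dim V" using C by auto
qed

lemma dim_subset_le:
  assumes "finite S" "V \<subseteq> span S" "U \<subseteq> V"
  shows "dim U \<le> dim V"
proof -
  obtain B where "B \<subseteq> U" "independent B" "card B = dim U" using basis_exists[of U] by metis
  thus ?thesis using independent_card_le_dim_subset(2)[OF assms(1,2), of B] assms(3) by auto
qed

lemma subspace_eq_if_dim_le:
  assumes "finite S" "V \<subseteq> span S" "U \<subseteq> V" "subspace U" "dim V \<le> dim U"
  shows "U = V"
proof (rule ccontr)
  assume "U \<noteq> V"
  then obtain v where v: "v \<in> V" "v \<notin> U" using assms(3) by blast
  obtain B where B: "finite B" "B \<subseteq> U" "independent B" "U \<subseteq> span B" "card B = dim U"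
    using finite_basis_exists[OF assms(1), of U] assms(2,3) by blast
  have "span B \<subseteq> U" using B(2) assms(4) span_minimal by blast
  hence "independent (insert v B)" using v B(3) independent_insertI by blast
  moreover have "insert v B \<subseteq> V" using v B assms by auto
  ultimately have "card (insert v B) \<le> dim V"
    using independent_card_le_dim_subset(2)[OF assms(1,2)] by blast
  moreover have "v \<notin> B" using B(2) v by blast
  hence "card (insert v B) = Suc (card B)" using B(1) by simp
  ultimately show False using B(5) assms(5) by simp
qed

end

context vector_space_pair
begin

text \<open>The map \<open>a\<close> induces an injection from Z/B to Z'/B': vectors completing a
  basis of B to one of Z stay independent modulo B'. The inequality is written additively because
  subtraction of natural numbers truncates.\<close>

lemma dim_quotient_le:
  assumes a: "Vector_Spaces.linear s1 s2 a"
    and Z: "finite S" "Z \<subseteq> vs1.span S" "vs1.subspace Z" "vs1.subspace B" "B \<subseteq> Z"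
    and Z': "finite S'" "Z' \<subseteq> vs2.span S'" "vs2.subspace B'" "B' \<subseteq> Z'"
    and maps: "a ` Z \<subseteq> Z'" "\<And>z. z \<in> Z \<Longrightarrow> a z \<in> B' \<Longrightarrow> z \<in> B"
  shows "vs1.dim Z + vs2.dim B' \<le> vs2.dim Z' + vs1.dim B"
proof -
  interpret a: Vector_Spaces.linear s1 s2 a by fact
  obtain b where b: "finite b" "b \<subseteq> B" "vs1.independent b" "B \<subseteq> vs1.span b" "card b = vs1.dim B"
    using vs1.finite_basis_exists[OF Z(1), of B] Z by blast
  obtain c where c: "b \<subseteq> c" "c \<subseteq> Z" "vs1.independent c" "Z \<subseteq> vs1.span c"
    using vs1.maximal_independent_subset_extend[of b Z] b Z by blast
  have fc: "finite c" using vs1.independent_card_le_dim_subset(1)[OF Z(1,2) c(3,2)] .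
  have cdim: "card c = vs1.dim Z" using vs1.basis_card_eq_dim[OF c(2,4,3)] .
  obtain b' where b': "finite b'" "b' \<subseteq> B'" "vs2.independent b'" "B' \<subseteq> vs2.span b'"
    "card b' = vs2.dim B'"
    using vs2.finite_basis_exists[OF Z'(1), of B'] Z' by blast
  define e where "e = c - b"
  have fe: "finite e" using fc unfolding e_def by simp
  have spanb: "vs1.span b = B" using b Z(4) vs1.span_minimal by blast
  have spanb': "vs2.span b' = B'" using b' Z'(3) vs2.span_minimal by blast
  have spane: "vs1.span e \<subseteq> Z" using c Z(3) vs1.span_minimal unfolding e_def by blast
  \<comment> \<open>Such an x lies in B as well, so its expansions along \<open>b\<close> and along
    \<open>e\<close> give a relation among the independent vectors \<open>c\<close>.\<close>
  have key: "x = 0" if "x \<in> vs1.span e" "a x \<in> B'" for x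
  proof -
    have "x \<in> vs1.span b" using that maps(2) spane spanb by blast
    then obtain u where u: "x = (\<Sum>v\<in>b. s1 (u v) v)"
      using vs1.span_finite[OF b(1)] by auto
    have "x \<in> range (\<lambda>w. \<Sum>v\<in>e. s1 (w v) v)" using that(1) by (simp only: vs1.span_finite[OF fe])
    then obtain w where w: "x = (\<Sum>v\<in>e. s1 (w v) v)" by blast
    define r where "r v = (if v \<in> b then u v else - w v)" for v
    have "(\<Sum>v\<in>c. s1 (r v) v) = (\<Sum>v\<in>b. s1 (r v) v) + (\<Sum>v\<in>e. s1 (r v) v)"
      unfolding e_def using c(1) fc by (metis (no_types, lifting) add.commute sum.subset_diff)
    also have "(\<Sum>v\<in>b. s1 (r v) v) = x" unfolding u by (rule sum.cong) (auto simp: r_def)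
    also have "(\<Sum>v\<in>e. s1 (r v) v) = - x"
      unfolding w sum_negf[symmetric] by (rule sum.cong) (auto simp: r_def e_def)
    finally have "(\<Sum>v\<in>c. s1 (r v) v) = 0" by simp
    hence "\<forall>v\<in>c. r v = 0" using c(3) fc vs1.independentD by blast
    hence "\<forall>v\<in>b. u v = 0" using c(1) r_def by (metis subsetD)
    thus "x = 0" unfolding u by simp
  qed
  have inj: "inj_on a (vs1.span e)"
  proof (rule inj_onI)
    fix x y assume "x \<in> vs1.span e" "y \<in> vs1.span e" "a x = a y"
    hence "x - y = 0" using key[of "x - y"] vs1.span_diff vs2.subspace_0[OF Z'(3)]
      by (auto simp: a.diff)
    thus "x = y" by simp
  qed
  have "vs1.independent e" using c(3) vs1.independent_mono unfolding e_def by blast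
  hence ind: "vs2.independent (a ` e)"
    using linear_independent_injective_image[OF a] inj by auto
  have cae: "card (a ` e) = card e" using inj vs1.span_superset inj_on_subset card_image by metis
  have disj: "vs2.span (a ` e) \<inter> vs2.span b' = {0}"
  proof -
    have "y = 0" if y: "y \<in> vs2.span (a ` e)" "y \<in> B'" for y
    proof -
      obtain x where "x \<in> vs1.span e" "y = a x"
        using y(1) linear_span_image[OF a] by auto
      moreover from this have "x = 0" using key y(2) by blast
      ultimately show ?thesis using a.zero by simp
    qed
    thus ?thesis using vs2.span_zero spanb' by auto
  qed
  have dj: "a ` e \<inter> b' = {}"
  proof (rule ccontr)
    assume "a ` e \<inter> b' \<noteq> {}"
    then obtain y where "y \<in> a ` e" "y \<in> b'" by blast
    hence "y = 0" using disj vs2.span_base by blast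
    thus False using \<open>y \<in> b'\<close> b'(3) vs2.dependent_zero by blast
  qed
  have "vs2.independent (a ` e \<union> b')"
  proof (rule vs2.independent_if_scalars_zero)
    show "finite (a ` e \<union> b')" using fc b' e_def by auto
    fix f x assume s: "(\<Sum>x\<in>a ` e \<union> b'. s2 (f x) x) = 0" and x: "x \<in> a ` e \<union> b'"
    have "(\<Sum>x\<in>a ` e. s2 (f x) x) + (\<Sum>x\<in>b'. s2 (f x) x) = 0"
      using s dj fc b'(1) unfolding e_def by (subst (asm) sum.union_disjoint) auto
    hence eq: "(\<Sum>x\<in>a ` e. s2 (f x) x) = - (\<Sum>x\<in>b'. s2 (f x) x)"
      using eq_neg_iff_add_eq_0 by blast
    have "(\<Sum>x\<in>a ` e. s2 (f x) x) \<in> vs2.span (a ` e)"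
      by (intro vs2.span_sum vs2.span_scale vs2.span_base)
    moreover have "(\<Sum>x\<in>b'. s2 (f x) x) \<in> vs2.span b'"
      by (intro vs2.span_sum vs2.span_scale vs2.span_base)
    hence "(\<Sum>x\<in>a ` e. s2 (f x) x) \<in> vs2.span b'" unfolding eq by (rule vs2.span_neg)
    ultimately have "(\<Sum>x\<in>a ` e. s2 (f x) x) = 0" using disj by blast
    moreover from this have "(\<Sum>x\<in>b'. s2 (f x) x) = 0" using eq by simp
    ultimately have "\<forall>x\<in>a ` e. f x = 0" "\<forall>x\<in>b'. f x = 0"
      using vs2.independentD[OF ind finite_imageI[OF fe] subset_refl]
        vs2.independentD[OF b'(3,1) subset_refl] by blast+
    thus "f x = 0" using x by blast
  qed
  moreover have "a ` e \<union> b' \<subseteq> Z'" using maps(1) c(2) b' Z' e_def by auto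
  ultimately have "card (a ` e \<union> b') \<le> vs2.dim Z'"
    using vs2.independent_card_le_dim_subset(2)[OF Z'(1,2)] by blast
  moreover note dj
  hence "card (a ` e \<union> b') = card e + card b'"
    using cae fc b'(1) by (simp add: card_Un_disjoint e_def)
  moreover have "card c = card e + card b"
    using c(1) fc b(1) unfolding e_def by (simp add: card_Diff_subset card_mono)
  ultimately show ?thesis using cdim b b' by linarith
qed

end

text \<open>Rank-nullity from \<open>dim_quotient_le\<close> used twice: T embeds U modulo its
  kernel into the image, and a linear section \<open>g\<close> of T embeds the image into that
  quotient.\<close>

lemma dim_kernel_image:
  fixes T :: "('i \<Rightarrow> 'k::field) \<Rightarrow> ('j \<Rightarrow> 'k)"
  assumes T: "flinear T" and U: "fs.subspace U" "finite S" "U \<subseteq> fs.span S"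
  shows "fs.dim {w \<in> U. T w = 0} + fs.dim (T ` U) = fs.dim U"
proof -
  note S = U(2)
  interpret T: Vector_Spaces.linear fscale fscale T by fact
  have im: "T ` U \<subseteq> fs.span (T ` S)" using U(3) fsp.linear_span_image[OF T] by blast
  define K where "K = {w \<in> U. T w = 0}"
  have K: "fs.subspace K" "K \<subseteq> U" "0 \<in> K" "\<And>w. w \<in> U \<Longrightarrow> T w = 0 \<Longrightarrow> w \<in> K"
    unfolding K_def using U(1)
    by (auto simp: fs.subspace_def T.zero T.add T.scale)
  have TU: "fs.subspace (T ` U)" "0 \<in> T ` U"
    using fsp.linear_subspace_image[OF T U(1)] fs.subspace_0 by blast+
  obtain g where g: "g ` UNIV \<subseteq> U" "flinear g" "\<forall>v\<in>T ` U. T (g v) = v"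
    using fsp.linear_exists_right_inverse_on[OF T U(1)] by blast
  have "fs.dim U + fs.dim {0::'j \<Rightarrow> 'k} \<le> fs.dim (T ` U) + fs.dim K"
  proof (rule fsp.dim_quotient_le[OF T U(2,3,1) K(1,2) _ im])
    show "z \<in> K" if "z \<in> U" "T z \<in> {0}" for z using that K(4) by blast
  qed (use S TU in \<open>auto simp: fs.subspace_single_0\<close>)
  moreover have "fs.dim (T ` U) + fs.dim K \<le> fs.dim U + fs.dim {0::'j \<Rightarrow> 'k}"
  proof (rule fsp.dim_quotient_le[OF g(2) _ im TU(1) _ _ U(2,3) K(1,2)])
    show "g ` T ` U \<subseteq> U" using g(1) by blast
    show "v \<in> {0}" if "v \<in> T ` U" "g v \<in> K" for v using that g(3) unfolding K_def by auto
  qed (use S TU in \<open>auto simp: fs.subspace_single_0\<close>)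
  moreover have "fs.dim {0::'j \<Rightarrow> 'k} = 0" using fs.dim_unique[of "{}" "{0::'j \<Rightarrow> 'k}" 0] fs.independent_empty by auto
  ultimately show ?thesis unfolding K_def by simp
qed

lemma dim_supported:
  fixes A :: "'i set"
  assumes "finite A"
  defines "V \<equiv> {c :: 'i \<Rightarrow> 'k::field. \<forall>k. c k \<noteq> 0 \<longrightarrow> k \<in> A}"
  shows "fs.subspace V" "V \<subseteq> fs.span ((\<lambda>a k. if k = a then 1 else 0) ` A)" "fs.dim V = card A"
proof -
  define \<delta> :: "'i \<Rightarrow> 'i \<Rightarrow> 'k" where "\<delta> = (\<lambda>a k. if k = a then 1 else 0)"
  have sum: "(\<Sum>a\<in>A. fscale (f a) (\<delta> a)) k = (if k \<in> A then f k else 0)" for f k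
  proof -
    have "(\<Sum>a\<in>A. fscale (f a) (\<delta> a)) k = (\<Sum>a\<in>A. fscale (f a) (\<delta> a) k)"
      by (induction A rule: infinite_finite_induct) auto
    also have "\<dots> = (\<Sum>a\<in>A. if a = k then f k else 0)" by (rule sum.cong) (auto simp: \<delta>_def)
    also have "\<dots> = (if k \<in> A then f k else 0)" using assms by simp
    finally show ?thesis .
  qed
  show sub: "fs.subspace V" 
  proof (rule fs.subspaceI)
    fix f g assume "f \<in> V" "g \<in> V"
    thus "f + g \<in> V" unfolding V_def by (auto, metis add.right_neutral)
  qed (auto simp: V_def)
  have inj: "inj_on \<delta> A" unfolding \<delta>_def by (rule inj_onI) (metis one_neq_zero)
  show sp: "V \<subseteq> fs.span ((\<lambda>a k. if k = a then 1 else 0) ` A)" unfolding \<delta>_def[symmetric]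
  proof
    fix c assume "c \<in> V"
    hence "c = (\<Sum>a\<in>A. fscale (c a) (\<delta> a))" unfolding fun_eq_iff sum V_def by auto
    moreover have "(\<Sum>a\<in>A. fscale (c a) (\<delta> a)) \<in> fs.span (\<delta> ` A)"
      by (intro fs.span_sum fs.span_scale fs.span_base) auto
    ultimately show "c \<in> fs.span (\<delta> ` A)" by simp
  qed
  have "fs.independent (\<delta> ` A)"
  proof (rule fs.independent_if_scalars_zero)
    show "finite (\<delta> ` A)" using assms by simp
    fix f x assume s: "(\<Sum>x\<in>\<delta> ` A. fscale (f x) x) = 0" and x: "x \<in> \<delta> ` A"
    obtain a where a: "a \<in> A" "x = \<delta> a" using x by blast
    have "(\<Sum>x\<in>\<delta> ` A. fscale (f x) x) = (\<Sum>a\<in>A. fscale (f (\<delta> a)) (\<delta> a))"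
      by (simp add: sum.reindex[OF inj])
    hence "(\<Sum>a\<in>A. fscale (f (\<delta> a)) (\<delta> a)) a = 0" using s by simp
    thus "f x = 0" using a unfolding sum by simp
  qed
  moreover have "\<delta> ` A \<subseteq> V" unfolding V_def \<delta>_def by (auto split: if_splits)
  ultimately show "fs.dim V = card A"
    using fs.dim_unique[of "\<delta> ` A" V "card A"] sp[folded \<delta>_def] card_image[OF inj] by blast
qed

subsection \<open>Graded free modules and their images\<close>

abbreviation coeff :: "('a \<Rightarrow>\<^sub>0 'b::zero) \<Rightarrow> 'a \<Rightarrow> 'b" where
  "coeff \<equiv> Poly_Mapping.lookup"

abbreviation monom :: "'a \<Rightarrow> 'b::zero \<Rightarrow> 'a \<Rightarrow>\<^sub>0 'b" where
  "monom \<equiv> Poly_Mapping.single"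

section \<open>Homogeneous polynomials and constant coefficients\<close>

definition mdeg :: "('v::finite \<Rightarrow>\<^sub>0 nat) \<Rightarrow> int" where
  "mdeg m = int (\<Sum>v\<in>UNIV. coeff m v)"

lemma mdeg_0 [simp]: "mdeg 0 = 0"
  by (simp add: mdeg_def)

lemma mdeg_nonneg: "mdeg m \<ge> 0"
  unfolding mdeg_def by (rule of_nat_0_le_iff)

lemma homog_iff: "p \<in> homog d \<longleftrightarrow> (\<forall>m. coeff p m \<noteq> 0 \<longrightarrow> mdeg m = d)"
  by (auto simp: homog_def mdeg_def in_keys_iff)

lemma homog_0 [simp]: "0 \<in> homog d"
  by (simp add: homog_iff)

lemma homog_add: "p \<in> homog d \<Longrightarrow> q \<in> homog d \<Longrightarrow> p + q \<in> homog d"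
  unfolding homog_iff lookup_add by (metis add.right_neutral)

lemma homog_uminus: "p \<in> homog d \<Longrightarrow> - p \<in> homog d"
  by (simp add: homog_iff)

lemma homog_diff: "p \<in> homog d \<Longrightarrow> q \<in> homog d \<Longrightarrow> p - q \<in> homog d"
  using homog_add[of p d "- q"] homog_uminus[of q d] by simp

lemma homog_sum: "(\<And>a. a \<in> A \<Longrightarrow> f a \<in> homog d) \<Longrightarrow> sum f A \<in> homog d"
  by (induction A rule: infinite_finite_induct) (auto intro: homog_add)

lemma homog_mult: "p \<in> homog d \<Longrightarrow> q \<in> homog e \<Longrightarrow> p * q \<in> homog (d + e)"
  using keys_mult[of p q] by (fastforce simp: homog_def sum.distrib lookup_add)

lemma homog_single: "monom m c \<in> homog (mdeg m)"
  by (auto simp: homog_iff lookup_single when_def)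

lemma homog_const [simp]: "monom 0 c \<in> homog 0"
  using homog_single[of 0 c] by simp

lemma homog_one [simp]: "1 \<in> homog 0"
  using homog_const[of 1] by simp

lemma homog_neg_eq_0: "p \<in> homog d \<Longrightarrow> d < 0 \<Longrightarrow> p = 0"
  unfolding homog_iff by (intro poly_mapping_eqI) (metis lookup_zero mdeg_nonneg not_less)

lemma lookup_homog_0: "p \<in> homog d \<Longrightarrow> d \<noteq> 0 \<Longrightarrow> coeff p 0 = 0"
  unfolding homog_iff using mdeg_0 by metis

lemma mult_in_homog_0: "p \<in> homog 0 \<Longrightarrow> q \<in> homog d \<Longrightarrow> p * q \<in> homog d"
  using homog_mult[of p 0 q d] by simp

lemma add_eq_0_mon: "(a :: 'v \<Rightarrow>\<^sub>0 nat) + b = 0 \<longleftrightarrow> a = 0 \<and> b = 0"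
  by (auto simp: poly_mapping_eq_iff lookup_add fun_eq_iff)

lemma mpoly_sum_monomials:
  "(p :: 'a \<Rightarrow>\<^sub>0 'b::comm_monoid_add) = (\<Sum>m\<in>Poly_Mapping.keys p. monom m (coeff p m))"
  by (rule poly_mapping_eqI)
    (simp add: lookup_sum lookup_single when_def in_keys_iff)

lemma lookup_const_mult:
  "coeff (monom 0 c * p) m = c * coeff p m"
  for p :: "('v, 'k::field) mpoly"
proof -
  have "monom 0 c * p =
      (\<Sum>t\<in>Poly_Mapping.keys p. monom t (c * coeff p t))"
    by (subst mpoly_sum_monomials[of p]) (simp add: sum_distrib_left mult_single)
  thus ?thesis by (auto simp: lookup_sum lookup_single when_def in_keys_iff)
qed

lemma lookup_monom_mult:
  "coeff (monom t 1 * p) (t + m) = coeff p m"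
  for p :: "('v, 'k::field) mpoly"
proof -
  have "monom t 1 * p =
      (\<Sum>s\<in>Poly_Mapping.keys p. monom (t + s) (coeff p s))"
    by (subst mpoly_sum_monomials[of p]) (simp add: sum_distrib_left mult_single)
  thus ?thesis by (auto simp: lookup_sum lookup_single when_def in_keys_iff)
qed

lemma lookup_monom_mult_not:
  fixes p :: "('v, 'k::field) mpoly"
  assumes "\<nexists>s. m = t + s"
  shows "coeff (monom t c * p) m = 0"
proof -
  have "monom t c * p =
      (\<Sum>s\<in>Poly_Mapping.keys p. monom (t + s) (c * coeff p s))"
    by (subst mpoly_sum_monomials[of p]) (simp add: sum_distrib_left mult_single)
  thus ?thesis using assms
    by (auto simp: lookup_sum lookup_single when_def intro!: sum.neutral)
qed

lemma lookup_mult_0: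
  "coeff (p * q) 0 = coeff p 0 * coeff q 0"
  for p q :: "('v, 'k::field) mpoly"
proof -
  have *: "coeff (monom t c * q) 0 =
      coeff (monom t c) 0 * coeff q 0" for t :: "'v \<Rightarrow>\<^sub>0 nat" and c :: 'k
  proof (cases "t = 0")
    case True
    thus ?thesis by (simp add: lookup_const_mult)
  next
    case False
    hence "\<nexists>s. 0 = t + s" by (metis add_eq_0_mon)
    thus ?thesis using False lookup_monom_mult_not[of 0 t] by (simp add: lookup_single)
  qed
  have "p * q = (\<Sum>m\<in>Poly_Mapping.keys p. monom m (coeff p m) * q)"
    by (subst mpoly_sum_monomials[of p]) (simp add: sum_distrib_right)
  hence "coeff (p * q) 0 =
      (\<Sum>m\<in>Poly_Mapping.keys p. coeff (monom m (coeff p m)) 0) * coeff q 0"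
    by (simp add: lookup_sum * sum_distrib_right)
  also have "(\<Sum>m\<in>Poly_Mapping.keys p. coeff (monom m (coeff p m)) 0) = coeff p 0"
    using arg_cong[OF mpoly_sum_monomials[of p], of "\<lambda>r. coeff r 0"] by (simp add: lookup_sum)
  finally show ?thesis .
qed

definition hcomp :: "int \<Rightarrow> ('v::finite, 'k::field) mpoly \<Rightarrow> ('v, 'k) mpoly" where
  "hcomp d p = Poly_Mapping.mapp (\<lambda>m c. if mdeg m = d then c else 0) p"

lemma lookup_hcomp:
  "coeff (hcomp d p) m = (if mdeg m = d then coeff p m else 0)"
  by (simp add: hcomp_def lookup_mapp in_keys_iff when_def)

lemma hcomp_homog: "hcomp d p \<in> homog d"
  by (simp add: homog_iff lookup_hcomp)

lemma hcomp_add: "hcomp d (p + q) = hcomp d p + hcomp d q"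
  by (rule poly_mapping_eqI) (simp add: lookup_hcomp lookup_add)

lemma hcomp_0 [simp]: "hcomp d 0 = 0"
  by (rule poly_mapping_eqI) (simp add: lookup_hcomp)

lemma hcomp_of_homog: "p \<in> homog e \<Longrightarrow> hcomp d p = (if d = e then p else 0)"
  by (rule poly_mapping_eqI) (auto simp: lookup_hcomp homog_iff)

text \<open>Kept as a constant with arbitrary index type, so that the same rules serve coordinate
  vectors indexed by \<open>nat\<close> and families indexed by sets of variables.\<close>

definition sm :: "('v, 'k::field) mpoly \<Rightarrow> ('i \<Rightarrow> ('v, 'k) mpoly) \<Rightarrow> 'i \<Rightarrow> ('v, 'k) mpoly" where
  "sm p f = (\<lambda>k. p * f k)"

lemma sm_apply [simp]: "sm p f k = p * f k"
  by (simp add: sm_def)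

lemma sm_add_left: "sm (p + q) f = sm p f + sm q f"
  and sm_add_right: "sm p (f + g) = sm p f + sm p g"
  and sm_assoc: "sm (p * q) f = sm p (sm q f)"
  and sm_one [simp]: "sm 1 f = f"
  and sm_zero_left [simp]: "sm 0 f = 0"
  and sm_zero_right [simp]: "sm p 0 = 0"
  and sm_minus_one: "sm (- 1) f = - f"
  by (auto simp: fun_eq_iff algebra_simps)

lemma sum_fun_apply: "sum f A x = (\<Sum>a\<in>A. f a x)"
  by (induction A rule: infinite_finite_induct) auto

lemma gfree_simps [simp]:
  "add (gfree ds) = (+)" "zero (gfree ds) = 0" "smult (gfree ds) = sm"
  by (auto simp: gfree_def fun_eq_iff)

abbreviation vecs :: "int list \<Rightarrow> (nat \<Rightarrow> ('v::finite, 'k::field) mpoly) set" where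
  "vecs ds \<equiv> carrier (gfree ds)"

abbreviation free_hom ::
    "int list \<Rightarrow> int list \<Rightarrow> ((nat \<Rightarrow> ('v::finite, 'k::field) mpoly) \<Rightarrow> nat \<Rightarrow> ('v, 'k) mpoly) \<Rightarrow> bool" where
  "free_hom ds es \<equiv> graded_hom (gfree ds) (gfree es)"

lemma carrier_gfree: "x \<in> vecs ds \<longleftrightarrow> (\<forall>k\<ge>length ds. x k = 0)"
  by (simp add: gfree_def)

lemma grade_gfree: "x \<in> grade (gfree ds) j \<longleftrightarrow>
    x \<in> vecs ds \<and> (\<forall>k<length ds. x k \<in> homog (j - ds ! k))"
  by (simp add: gfree_def)

lemma gfree_carrierI [simp, intro]:
  "0 \<in> vecs ds"
  "x \<in> vecs ds \<Longrightarrow> y \<in> vecs ds \<Longrightarrow> x + y \<in> vecs ds"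
  "x \<in> vecs ds \<Longrightarrow> - x \<in> vecs ds"
  "x \<in> vecs ds \<Longrightarrow> y \<in> vecs ds \<Longrightarrow> x - y \<in> vecs ds"
  "x \<in> vecs ds \<Longrightarrow> sm p x \<in> vecs ds"
  by (auto simp: carrier_gfree)

lemma gfree_carrier_sum [intro]:
  "(\<And>a. a \<in> A \<Longrightarrow> f a \<in> vecs ds) \<Longrightarrow> sum f A \<in> vecs ds"
  by (simp add: carrier_gfree sum_fun_apply)

lemma gfree_gradeI [simp, intro]:
  "0 \<in> grade (gfree ds) j"
  "x \<in> grade (gfree ds) j \<Longrightarrow> y \<in> grade (gfree ds) j \<Longrightarrow> x + y \<in> grade (gfree ds) j"
  "x \<in> grade (gfree ds) j \<Longrightarrow> - x \<in> grade (gfree ds) j"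
  "x \<in> grade (gfree ds) j \<Longrightarrow> y \<in> grade (gfree ds) j \<Longrightarrow> x - y \<in> grade (gfree ds) j"
  by (auto simp: grade_gfree intro: homog_add homog_uminus homog_diff)

lemma gfree_grade_sm: "p \<in> homog d \<Longrightarrow> x \<in> grade (gfree ds) j \<Longrightarrow> sm p x \<in> grade (gfree ds) (d + j)"
  using homog_mult[of p d] by (auto simp: grade_gfree add_diff_eq[symmetric])

lemma gfree_grade_carrier: "x \<in> grade (gfree ds) j \<Longrightarrow> x \<in> vecs ds"
  by (simp add: grade_gfree)

definition bas :: "nat \<Rightarrow> nat \<Rightarrow> ('v, 'k::field) mpoly" where
  "bas k = (\<lambda>l. if l = k then 1 else 0)"

lemma bas_grade: "k < length ds \<Longrightarrow> bas k \<in> grade (gfree ds) (ds ! k)"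
  by (auto simp: grade_gfree carrier_gfree bas_def)

lemma bas_carrier: "k < length ds \<Longrightarrow> bas k \<in> vecs ds"
  by (auto simp: carrier_gfree bas_def)

lemma gfree_expand:
  "x \<in> vecs ds \<Longrightarrow> x = (\<Sum>k<length ds. sm (x k) (bas k))"
  by (auto simp: fun_eq_iff sum_fun_apply bas_def carrier_gfree if_distrib sum.delta
      cong: if_cong)

text \<open>From \<open>length ds\<close> on the degree \<open>ds ! k\<close> is unspecified; this
  is harmless on \<open>vecs ds\<close>, where those coordinates vanish.\<close>

definition gcomp :: "int list \<Rightarrow> int \<Rightarrow> (nat \<Rightarrow> ('v::finite, 'k::field) mpoly) \<Rightarrow> nat \<Rightarrow> ('v, 'k) mpoly" where
  "gcomp ds j x = (\<lambda>k. hcomp (j - ds ! k) (x k))"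

lemma gcomp_grade: "x \<in> vecs ds \<Longrightarrow> gcomp ds j x \<in> grade (gfree ds) j"
  by (simp add: grade_gfree carrier_gfree gcomp_def hcomp_homog)

lemma gcomp_carrier: "x \<in> vecs ds \<Longrightarrow> gcomp ds j x \<in> vecs ds"
  using gcomp_grade gfree_grade_carrier by blast

lemma gcomp_add: "gcomp ds j (x + y) = gcomp ds j x + gcomp ds j y"
  by (simp add: gcomp_def fun_eq_iff hcomp_add)

lemma gcomp_0 [simp]: "gcomp ds j 0 = 0"
  by (simp add: gcomp_def fun_eq_iff)

lemma gcomp_sum: "gcomp ds j (sum f A) = (\<Sum>a\<in>A. gcomp ds j (f a))"
  using sum_comp_morphism[of "gcomp ds j" f A] by (simp add: gcomp_add o_def)

lemma gcomp_of_grade: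
  assumes "x \<in> grade (gfree ds) i"
  shows "gcomp ds j x = (if i = j then x else 0)"
proof
  fix k
  show "gcomp ds j x k = (if i = j then x else 0) k"
    using assms hcomp_of_homog[of "x k" "i - ds ! k"]
    by (cases "k < length ds") (auto simp: gcomp_def grade_gfree carrier_gfree)
qed

lemma gcomp_decomp:
  assumes "x \<in> vecs ds"
  obtains J where "finite J" "\<And>j. j \<notin> J \<Longrightarrow> gcomp ds j x = 0" "x = (\<Sum>j\<in>J. gcomp ds j x)"
proof
  \<comment> \<open>The degrees of all terms that occur, a monomial m in coordinate k having degree
    \<open>mdeg m + ds ! k\<close>.\<close>
  define J where "J = (\<Union>k<length ds. (\<lambda>m. mdeg m + ds ! k) ` Poly_Mapping.keys (x k))"
  show "finite J" unfolding J_def by auto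
  have mem: "mdeg m + ds ! k \<in> J" if "coeff (x k) m \<noteq> 0" for k m
  proof -
    have "m \<in> Poly_Mapping.keys (x k)" "k < length ds"
      using that assms by (auto simp: in_keys_iff carrier_gfree leI intro: ccontr)
    thus ?thesis unfolding J_def by blast
  qed
  have lk: "coeff (gcomp ds j x k) m =
      (if j = mdeg m + ds ! k then coeff (x k) m else 0)" for j k m
    by (auto simp: gcomp_def lookup_hcomp)
  show "gcomp ds j x = 0" if "j \<notin> J" for j
    using mem that by (intro ext poly_mapping_eqI) (auto simp: lk)
  show "x = (\<Sum>j\<in>J. gcomp ds j x)"
  proof (intro ext poly_mapping_eqI)
    fix k m
    show "coeff (x k) m = coeff ((\<Sum>j\<in>J. gcomp ds j x) k) m"
      using \<open>finite J\<close> mem[of k m] by (auto simp: sum_fun_apply lookup_sum lk)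
  qed
qed

section \<open>Graded modules as images of free modules\<close>

lemma cring_poly_ring: "cring (poly_ring :: ('v, 'k::field) mpoly ring)"
proof (rule cringI)
  show "abelian_group (poly_ring :: ('v, 'k) mpoly ring)"
  proof (rule abelian_groupI)
    fix x :: "('v, 'k) mpoly"
    show "\<exists>y\<in>carrier poly_ring. y \<oplus>\<^bsub>poly_ring\<^esub> x = \<zero>\<^bsub>poly_ring\<^esub>"
      by (rule bexI[of _ "- x"]) (auto simp: poly_ring_def)
  qed (auto simp: poly_ring_def algebra_simps)
  show "comm_monoid (poly_ring :: ('v, 'k) mpoly ring)"
    by (rule comm_monoidI) (auto simp: poly_ring_def algebra_simps)
qed (auto simp: poly_ring_def algebra_simps)

lemma poly_ring_simps [simp]:
  "carrier poly_ring = UNIV" "x \<otimes>\<^bsub>poly_ring\<^esub> y = x * y" "x \<oplus>\<^bsub>poly_ring\<^esub> y = x + y"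
  "\<one>\<^bsub>poly_ring\<^esub> = 1" "\<zero>\<^bsub>poly_ring\<^esub> = 0"
  by (auto simp: poly_ring_def)

lemma finsum_hom_gfree:
  assumes M: "abelian_group M"
    and f: "\<And>x. x \<in> vecs ds \<Longrightarrow> f x \<in> carrier M"
      "\<And>x y. x \<in> vecs ds \<Longrightarrow> y \<in> vecs ds \<Longrightarrow> f (x + y) = f x \<oplus>\<^bsub>M\<^esub> f y"
      "f 0 = \<zero>\<^bsub>M\<^esub>"
    and g: "\<And>j. j \<in> J \<Longrightarrow> g j \<in> vecs ds"
  shows "f (\<Sum>j\<in>J. g j) = (\<Oplus>\<^bsub>M\<^esub>j\<in>J. f (g j))"
proof -
  interpret abelian_group M by fact
  show ?thesis using g
  proof (induction J rule: infinite_finite_induct)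
    case (insert a J)
    have s: "sum g J \<in> vecs ds" using insert.prems by (intro gfree_carrier_sum) auto
    have "f (sum g (insert a J)) = f (g a + sum g J)" using insert.hyps by simp
    also have "\<dots> = f (g a) \<oplus>\<^bsub>M\<^esub> f (sum g J)" using insert.prems s f by blast
    also have "\<dots> = (\<Oplus>\<^bsub>M\<^esub>j\<in>insert a J. f (g j))" using insert f by (simp add: Pi_def)
    finally show ?case .
  qed (auto simp: f)
qed

lemma finsum_superset_support:
  assumes "abelian_group M" "finite A" "{j. F j \<noteq> \<zero>\<^bsub>M\<^esub>} \<subseteq> A" "\<And>j. F j \<in> carrier M"
  shows "(\<Oplus>\<^bsub>M\<^esub>j\<in>{j. F j \<noteq> \<zero>\<^bsub>M\<^esub>}. F j) = (\<Oplus>\<^bsub>M\<^esub>j\<in>A. F j)"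
proof -
  interpret abelian_group M by fact
  show ?thesis
    by (rule add.finprod_mono_neutral_cong_left) (use assms in auto)
qed

lemma finsum_gcomp:
  assumes M: "abelian_group M"
    and f: "\<And>x. x \<in> vecs ds \<Longrightarrow> f x \<in> carrier M"
      "\<And>x y. x \<in> vecs ds \<Longrightarrow> y \<in> vecs ds \<Longrightarrow> f (x + y) = f x \<oplus>\<^bsub>M\<^esub> f y"
      "f 0 = \<zero>\<^bsub>M\<^esub>"
    and x: "x \<in> vecs ds"
  shows "finite {j. f (gcomp ds j x) \<noteq> \<zero>\<^bsub>M\<^esub>}"
    and "f x = (\<Oplus>\<^bsub>M\<^esub>j\<in>{j. f (gcomp ds j x) \<noteq> \<zero>\<^bsub>M\<^esub>}. f (gcomp ds j x))"
proof -
  obtain J where J: "finite J" "\<And>j. j \<notin> J \<Longrightarrow> gcomp ds j x = 0" "x = (\<Sum>j\<in>J. gcomp ds j x)"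
    using gcomp_decomp[OF x] by blast
  have sub: "{j. f (gcomp ds j x) \<noteq> \<zero>\<^bsub>M\<^esub>} \<subseteq> J"
  proof (rule subsetI, rule ccontr)
    fix j assume "j \<in> {j. f (gcomp ds j x) \<noteq> \<zero>\<^bsub>M\<^esub>}" "j \<notin> J"
    thus False using J(2)[of j] f(3) by simp
  qed
  thus "finite {j. f (gcomp ds j x) \<noteq> \<zero>\<^bsub>M\<^esub>}" using J(1) finite_subset by blast
  have "f (\<Sum>j\<in>J. gcomp ds j x) = (\<Oplus>\<^bsub>M\<^esub>j\<in>J. f (gcomp ds j x))"
    by (rule finsum_hom_gfree[where ds = ds, OF M]) (use f gcomp_carrier[OF x] in blast)+
  hence "f x = (\<Oplus>\<^bsub>M\<^esub>j\<in>J. f (gcomp ds j x))" using J(3) by simp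
  also have "\<dots> = (\<Oplus>\<^bsub>M\<^esub>j\<in>{j. f (gcomp ds j x) \<noteq> \<zero>\<^bsub>M\<^esub>}. f (gcomp ds j x))"
    by (rule finsum_superset_support[OF M J(1) sub f(1)[OF gcomp_carrier[OF x]], symmetric])
  finally show "f x = (\<Oplus>\<^bsub>M\<^esub>j\<in>{j. f (gcomp ds j x) \<noteq> \<zero>\<^bsub>M\<^esub>}. f (gcomp ds j x))" .
qed

text \<open>Serves free modules, cokernels and syzygy modules alike. The module axioms pass along
  the surjection \<open>f\<close>; the homogeneity of its kernel, \<open>ker\<close>, is what makes
  the decomposition into graded pieces unique.\<close>

lemma graded_module_surj:
  fixes M :: "(('v::finite, 'k::field) mpoly, 'm) gmodule"
  assumes carr: "carrier M = f ` vecs ds"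
    and add: "\<And>x y. x \<in> vecs ds \<Longrightarrow> y \<in> vecs ds \<Longrightarrow> f (x + y) = f x \<oplus>\<^bsub>M\<^esub> f y"
    and sm: "\<And>p x. x \<in> vecs ds \<Longrightarrow> f (sm p x) = p \<odot>\<^bsub>M\<^esub> f x"
    and zero: "f 0 = \<zero>\<^bsub>M\<^esub>"
    and gr: "\<And>j. grade M j = f ` grade (gfree ds) j"
    and ker: "\<And>x j. x \<in> vecs ds \<Longrightarrow> f x = \<zero>\<^bsub>M\<^esub> \<Longrightarrow> f (gcomp ds j x) = \<zero>\<^bsub>M\<^esub>"
  shows "graded_module M"
proof -
  let ?G = "carrier (gfree ds :: (('v, 'k) mpoly, nat \<Rightarrow> ('v, 'k) mpoly) gmodule)"
  have ab: "abelian_group M"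
  proof (rule abelian_groupI)
    fix x y z assume "x \<in> carrier M" "y \<in> carrier M" "z \<in> carrier M"
    then obtain a b c where [simp]: "x = f a" "y = f b" "z = f c"
      and abc: "a \<in> ?G" "b \<in> ?G" "c \<in> ?G" unfolding carr by blast
    show "x \<oplus>\<^bsub>M\<^esub> y \<oplus>\<^bsub>M\<^esub> z = x \<oplus>\<^bsub>M\<^esub> (y \<oplus>\<^bsub>M\<^esub> z)"
      using abc by (simp add: add[symmetric] add.assoc gfree_carrierI)
    show "x \<oplus>\<^bsub>M\<^esub> y = y \<oplus>\<^bsub>M\<^esub> x"
      using abc by (simp add: add[symmetric] add.commute)
    show "x \<oplus>\<^bsub>M\<^esub> y \<in> carrier M"
      using abc by (simp add: add[symmetric] carr)
    show "\<zero>\<^bsub>M\<^esub> \<oplus>\<^bsub>M\<^esub> x = x"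
      using abc add[of 0 a] by (simp add: zero)
    show "\<exists>y\<in>carrier M. y \<oplus>\<^bsub>M\<^esub> x = \<zero>\<^bsub>M\<^esub>"
      using abc add[of "- a" a] by (intro bexI[of _ "f (- a)"]) (auto simp: zero carr)
  next
    show "\<zero>\<^bsub>M\<^esub> \<in> carrier M" by (auto simp: carr zero[symmetric])
  qed
  interpret M: abelian_group M by fact
  have fc: "f x \<in> carrier M" if "x \<in> ?G" for x using that carr by auto
  have modM: "Module.module poly_ring M"
  proof (rule moduleI[OF cring_poly_ring ab])
    fix p q :: "('v, 'k) mpoly" and x y assume "x \<in> carrier M"
    then obtain a where a: "x = f a" "a \<in> ?G" using carr by auto
    show "p \<odot>\<^bsub>M\<^esub> x \<in> carrier M" using a by (simp add: sm[symmetric] fc)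
    show "(p \<oplus>\<^bsub>poly_ring\<^esub> q) \<odot>\<^bsub>M\<^esub> x = p \<odot>\<^bsub>M\<^esub> x \<oplus>\<^bsub>M\<^esub> q \<odot>\<^bsub>M\<^esub> x"
      using a by (simp add: sm[symmetric] add[symmetric] sm_add_left)
    show "(p \<otimes>\<^bsub>poly_ring\<^esub> q) \<odot>\<^bsub>M\<^esub> x = p \<odot>\<^bsub>M\<^esub> (q \<odot>\<^bsub>M\<^esub> x)"
      using a by (simp add: sm[symmetric] sm_assoc)
    show "\<one>\<^bsub>poly_ring\<^esub> \<odot>\<^bsub>M\<^esub> x = x" using a by (simp add: sm[symmetric])
    assume "y \<in> carrier M"
    then obtain b where b: "y = f b" "b \<in> ?G" using carr by auto
    show "p \<odot>\<^bsub>M\<^esub> (x \<oplus>\<^bsub>M\<^esub> y) = p \<odot>\<^bsub>M\<^esub> x \<oplus>\<^bsub>M\<^esub> p \<odot>\<^bsub>M\<^esub> y"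
      using a b by (simp add: sm[symmetric] add[symmetric] sm_add_right)
  qed
  have neg: "\<ominus>\<^bsub>M\<^esub> f a = f (- a)" if "a \<in> ?G" for a
    using that add[of "- a" a] zero by (intro M.minus_equality) (auto simp: fc)
  have subgr: "subgroup (grade M j) (add_monoid M)" for j
  proof
    show "grade M j \<subseteq> carrier (add_monoid M)"
      by (auto simp: gr fc gfree_grade_carrier)
    show "x \<otimes>\<^bsub>add_monoid M\<^esub> y \<in> grade M j" if "x \<in> grade M j" "y \<in> grade M j" for x y
      using that by (auto simp: gr add[symmetric] gfree_grade_carrier)
    show "\<one>\<^bsub>add_monoid M\<^esub> \<in> grade M j" by (auto simp: gr zero[symmetric])
    show "inv\<^bsub>add_monoid M\<^esub> x \<in> grade M j" if x: "x \<in> grade M j" for x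
    proof -
      obtain a where a: "x = f a" "a \<in> grade (gfree ds) j" using x gr by auto
      have "inv\<^bsub>add_monoid M\<^esub> x = f (- a)"
        using neg[OF gfree_grade_carrier[OF a(2)]] a(1) by (simp add: a_inv_def)
      thus ?thesis using a gr by auto
    qed
  qed
  have fsum: "f (\<Sum>j\<in>J. g j) = (\<Oplus>\<^bsub>M\<^esub>j\<in>J. f (g j))" if "\<And>j. j \<in> J \<Longrightarrow> g j \<in> ?G" for J and g :: "int \<Rightarrow> _"
    by (rule finsum_hom_gfree[OF ab fc add zero that])
  have dec: "\<exists>!F. (\<forall>j. F j \<in> grade M j) \<and> finite {j. F j \<noteq> \<zero>\<^bsub>M\<^esub>} \<and>
        x = (\<Oplus>\<^bsub>M\<^esub>j\<in>{j. F j \<noteq> \<zero>\<^bsub>M\<^esub>}. F j)" if x: "x \<in> carrier M" for x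
  proof -
    obtain y where y: "x = f y" "y \<in> ?G" using x carr by auto
    show ?thesis
    proof (rule ex1I[of _ "\<lambda>j. f (gcomp ds j y)"], intro conjI allI)
      note H = finsum_gcomp[OF ab fc add zero y(2)]
      show "f (gcomp ds j y) \<in> grade M j" for j using gcomp_grade y gr by auto
      show "finite {j. f (gcomp ds j y) \<noteq> \<zero>\<^bsub>M\<^esub>}" by (rule H(1))
      show "x = (\<Oplus>\<^bsub>M\<^esub>j\<in>{j. f (gcomp ds j y) \<noteq> \<zero>\<^bsub>M\<^esub>}. f (gcomp ds j y))" unfolding y(1) by (rule H(2))
    next
      fix F assume F: "(\<forall>j. F j \<in> grade M j) \<and> finite {j. F j \<noteq> \<zero>\<^bsub>M\<^esub>} \<and>
        x = (\<Oplus>\<^bsub>M\<^esub>j\<in>{j. F j \<noteq> \<zero>\<^bsub>M\<^esub>}. F j)"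
      \<comment> \<open>Zero components get the preimage 0, so that the degree i part of the finite
        sum \<open>z\<close> below is \<open>a i\<close> for every i, inside the support or
        not.\<close>
      have "\<forall>j. \<exists>a. a \<in> grade (gfree ds) j \<and> F j = f a \<and> (F j = \<zero>\<^bsub>M\<^esub> \<longrightarrow> a = 0)"
      proof
        fix j
        show "\<exists>a. a \<in> grade (gfree ds) j \<and> F j = f a \<and> (F j = \<zero>\<^bsub>M\<^esub> \<longrightarrow> a = 0)"
        proof (cases "F j = \<zero>\<^bsub>M\<^esub>")
          case True
          thus ?thesis using zero by (intro exI[of _ 0]) simp
        next
          case False
          moreover have "F j \<in> f ` grade (gfree ds) j" using F gr by blast
          ultimately show ?thesis by blast
        qed
      qed
      then obtain a where a: "\<And>j. a j \<in> grade (gfree ds) j" "\<And>j. F j = f (a j)"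
        "\<And>j. F j = \<zero>\<^bsub>M\<^esub> \<Longrightarrow> a j = 0" by metis
      let ?S = "{j. F j \<noteq> \<zero>\<^bsub>M\<^esub>}"
      define z where "z = (\<Sum>j\<in>?S. a j)"
      have zG: "z \<in> ?G" unfolding z_def using a(1) gfree_grade_carrier by (intro gfree_carrier_sum) blast
      have "f z = (\<Oplus>\<^bsub>M\<^esub>j\<in>?S. f (a j))" unfolding z_def by (rule fsum[OF gfree_grade_carrier[OF a(1)]])
      also have "\<dots> = x" unfolding a(2)[symmetric] using F by simp
      finally have fz: "f z = x" .
      have yz: "y - z \<in> ?G" using y zG by blast
      have "f (y - z + z) = f (y - z) \<oplus>\<^bsub>M\<^esub> f z" by (rule add[OF yz zG])
      hence "f (y - z) \<oplus>\<^bsub>M\<^esub> x = \<zero>\<^bsub>M\<^esub> \<oplus>\<^bsub>M\<^esub> x" using y x fz by simp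
      hence "f (y - z) = \<zero>\<^bsub>M\<^esub>" using M.add.right_cancel[OF x fc[OF yz] M.zero_closed] by blast
      hence k: "f (gcomp ds i (y - z)) = \<zero>\<^bsub>M\<^esub>" for i using ker y zG by auto
      show "F = (\<lambda>j. f (gcomp ds j y))"
      proof
        fix i
        have "gcomp ds i z = (\<Sum>j\<in>?S. if j = i then a j else 0)"
          unfolding z_def gcomp_sum using gcomp_of_grade[OF a(1)] by (intro sum.cong) auto
        also have "\<dots> = a i" using F a(3)[of i] by auto
        finally have "gcomp ds i z = a i" .
        hence "gcomp ds i y = gcomp ds i (y - z) + a i" using gcomp_add[of ds i "y - z" z] by simp
        moreover have "gcomp ds i (y - z) \<in> ?G" "a i \<in> ?G"
          using gcomp_carrier[OF yz] gfree_grade_carrier[OF a(1)] by blast+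
        ultimately have "f (gcomp ds i y) = f (a i)" using add k fc by simp
        thus "F i = f (gcomp ds i y)" using a by simp
      qed
    qed
  qed
  have "p \<odot>\<^bsub>M\<^esub> x \<in> grade M (d + j)" if p: "p \<in> homog d" and x: "x \<in> grade M j" for p d j x
  proof -
    obtain a where a: "x = f a" "a \<in> grade (gfree ds) j" using x gr by auto
    thus ?thesis using gfree_grade_sm[OF p a(2)] by (simp add: sm[symmetric] gfree_grade_carrier gr)
  qed
  thus ?thesis unfolding graded_module_def using modM subgr dec by blast
qed

lemma graded_module_gfree: "graded_module (gfree ds)"
  by (rule graded_module_surj[where f = id and ds = ds])
    (auto simp: gcomp_def fun_eq_iff)

lemma graded_module_abelian_group: "graded_module M \<Longrightarrow> abelian_group M"
  unfolding graded_module_def by (auto dest: module.axioms)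

lemma graded_module_module: "graded_module M \<Longrightarrow> Module.module poly_ring M"
  by (simp add: graded_module_def)

lemma graded_homD:
  assumes "graded_hom (gfree ds) M f"
  shows "\<And>x. x \<in> vecs ds \<Longrightarrow> f x \<in> carrier M"
    and "\<And>x y. x \<in> vecs ds \<Longrightarrow> y \<in> vecs ds \<Longrightarrow> f (x + y) = f x \<oplus>\<^bsub>M\<^esub> f y"
    and "\<And>p x. x \<in> vecs ds \<Longrightarrow> f (sm p x) = p \<odot>\<^bsub>M\<^esub> f x"
    and "\<And>j x. x \<in> grade (gfree ds) j \<Longrightarrow> f x \<in> grade M j"
  using assms unfolding graded_hom_def by auto

lemma graded_homI:
  assumes "\<And>x. x \<in> vecs ds \<Longrightarrow> f x \<in> carrier M"
    and "\<And>x y. x \<in> vecs ds \<Longrightarrow> y \<in> vecs ds \<Longrightarrow> f (x + y) = f x \<oplus>\<^bsub>M\<^esub> f y"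
    and "\<And>p x. x \<in> vecs ds \<Longrightarrow> f (sm p x) = p \<odot>\<^bsub>M\<^esub> f x"
    and "\<And>j x. x \<in> grade (gfree ds) j \<Longrightarrow> f x \<in> grade M j"
  shows "graded_hom (gfree ds) M f"
  using assms unfolding graded_hom_def by auto

lemma graded_hom_zero:
  assumes M: "graded_module M" and f: "graded_hom (gfree ds) M f"
  shows "f 0 = \<zero>\<^bsub>M\<^esub>"
proof -
  interpret M: Module.module poly_ring M using M graded_module_module by blast
  have "f (sm 0 0) = 0 \<odot>\<^bsub>M\<^esub> f 0" using graded_homD(3)[OF f] by blast
  thus ?thesis using graded_homD(1)[OF f, of 0] M.smult_l_null by simp
qed

text \<open>Both families of images of components decompose the same element of \<open>M\<close>,
  and such a decomposition is unique. With \<open>g\<close> the identity this says that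
  homomorphisms commute with \<open>gcomp\<close>.\<close>

lemma graded_hom_gcomp_eq:
  assumes M: "graded_module M" and f: "graded_hom (gfree ds) M f" and g: "graded_hom (gfree es) M g"
    and x: "x \<in> vecs ds" and y: "y \<in> vecs es" and eq: "f x = g y"
  shows "f (gcomp ds j x) = g (gcomp es j y)"
proof -
  note ab = graded_module_abelian_group[OF M]
  have P: "(\<forall>j. h (gcomp ds j x) \<in> grade M j) \<and> finite {j. h (gcomp ds j x) \<noteq> \<zero>\<^bsub>M\<^esub>} \<and>
        h x = (\<Oplus>\<^bsub>M\<^esub>j\<in>{j. h (gcomp ds j x) \<noteq> \<zero>\<^bsub>M\<^esub>}. h (gcomp ds j x))"
    if h: "graded_hom (gfree ds) M h" and x: "x \<in> vecs ds" for h ds x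
  proof (intro conjI allI)
    note H = finsum_gcomp[OF ab graded_homD(1,2)[OF h] graded_hom_zero[OF M h] x]
    show "h (gcomp ds j x) \<in> grade M j" for j using graded_homD(4)[OF h] gcomp_grade x by blast
    show "finite {j. h (gcomp ds j x) \<noteq> \<zero>\<^bsub>M\<^esub>}" by (rule H(1))
    show "h x = (\<Oplus>\<^bsub>M\<^esub>j\<in>{j. h (gcomp ds j x) \<noteq> \<zero>\<^bsub>M\<^esub>}. h (gcomp ds j x))" by (rule H(2))
  qed
  define Q where "Q F \<longleftrightarrow> (\<forall>j. F j \<in> grade M j) \<and> finite {j. F j \<noteq> \<zero>\<^bsub>M\<^esub>} \<and>
        f x = (\<Oplus>\<^bsub>M\<^esub>j\<in>{j. F j \<noteq> \<zero>\<^bsub>M\<^esub>}. F j)" for F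
  have "\<exists>!F. Q F"
    using M graded_homD(1)[OF f x] unfolding graded_module_def Q_def by blast
  moreover have "Q (\<lambda>j. f (gcomp ds j x))" unfolding Q_def by (rule P[OF f x])
  moreover have "Q (\<lambda>j. g (gcomp es j y))" unfolding Q_def eq by (rule P[OF g y])
  ultimately have "(\<lambda>j. f (gcomp ds j x)) = (\<lambda>j. g (gcomp es j y))" by blast
  thus ?thesis by metis
qed

subsection \<open>Independence of Tor from the resolution\<close>

lemma graded_hom_eq_on_bas:
  assumes M: "graded_module M"
    and f: "\<And>x. x \<in> vecs ds \<Longrightarrow> f x \<in> carrier M"
      "\<And>x y. x \<in> vecs ds \<Longrightarrow> y \<in> vecs ds \<Longrightarrow> f (x + y) = f x \<oplus>\<^bsub>M\<^esub> f y"
      "\<And>p x. x \<in> vecs ds \<Longrightarrow> f (sm p x) = p \<odot>\<^bsub>M\<^esub> f x"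
    and g: "\<And>x. x \<in> vecs ds \<Longrightarrow> g x \<in> carrier M"
      "\<And>x y. x \<in> vecs ds \<Longrightarrow> y \<in> vecs ds \<Longrightarrow> g (x + y) = g x \<oplus>\<^bsub>M\<^esub> g y"
      "\<And>p x. x \<in> vecs ds \<Longrightarrow> g (sm p x) = p \<odot>\<^bsub>M\<^esub> g x"
    and eq: "\<And>k. k < length ds \<Longrightarrow> f (bas k) = g (bas k)"
    and x: "x \<in> vecs ds"
  shows "f x = g x"
proof -
  interpret M: Module.module poly_ring M using M graded_module_module by blast
  have z: "h 0 = \<zero>\<^bsub>M\<^esub>" if "\<And>x. x \<in> vecs ds \<Longrightarrow> h x \<in> carrier M"
      "\<And>p x. x \<in> vecs ds \<Longrightarrow> h (sm p x) = p \<odot>\<^bsub>M\<^esub> h x" for h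
  proof -
    have "h (sm 0 0) = 0 \<odot>\<^bsub>M\<^esub> h 0" by (rule that(2)) simp
    also have "\<dots> = \<zero>\<^bsub>M\<^esub>" using M.smult_l_null[of "h 0"] that(1)[of 0] by simp
    finally show ?thesis by simp
  qed
  have *: "h x = (\<Oplus>\<^bsub>M\<^esub>k\<in>{..<length ds}. x k \<odot>\<^bsub>M\<^esub> h (bas k))"
    if "\<And>x. x \<in> vecs ds \<Longrightarrow> h x \<in> carrier M"
      "\<And>x y. x \<in> vecs ds \<Longrightarrow> y \<in> vecs ds \<Longrightarrow> h (x + y) = h x \<oplus>\<^bsub>M\<^esub> h y"
      "\<And>p x. x \<in> vecs ds \<Longrightarrow> h (sm p x) = p \<odot>\<^bsub>M\<^esub> h x" for h
  proof -
    have "h (\<Sum>k<length ds. sm (x k) (bas k)) = (\<Oplus>\<^bsub>M\<^esub>k\<in>{..<length ds}. h (sm (x k) (bas k)))"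
      by (rule finsum_hom_gfree[OF graded_module_abelian_group[OF M] that(1,2) z[OF that(1,3)]])
        (auto intro: bas_carrier)
    also have "\<dots> = (\<Oplus>\<^bsub>M\<^esub>k\<in>{..<length ds}. x k \<odot>\<^bsub>M\<^esub> h (bas k))"
    proof (rule M.finsum_cong')
      show "(\<lambda>k. x k \<odot>\<^bsub>M\<^esub> h (bas k)) \<in> {..<length ds} \<rightarrow> carrier M"
        using M.smult_closed that(1)[OF bas_carrier] by auto
    qed (auto intro: that(3)[OF bas_carrier])
    finally show ?thesis by (rule trans[OF arg_cong[OF gfree_expand[OF x], of h]])
  qed
  have "f x = (\<Oplus>\<^bsub>M\<^esub>k\<in>{..<length ds}. x k \<odot>\<^bsub>M\<^esub> f (bas k))" by (rule *[OF f])
  also have "\<dots> = (\<Oplus>\<^bsub>M\<^esub>k\<in>{..<length ds}. x k \<odot>\<^bsub>M\<^esub> g (bas k))"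
    using M.smult_closed g(1)[OF bas_carrier] eq by (intro M.finsum_cong') auto
  also have "\<dots> = g x" by (rule *[OF g, symmetric])
  finally show ?thesis .
qed

text \<open>Projectivity of free modules in its graded form: basis vectors are lifted one by one and
  the lift is extended linearly.\<close>

lemma graded_hom_lift:
  fixes P :: "(('v::finite, 'k::field) mpoly, 'm) gmodule"
  assumes P: "graded_module P" and \<phi>: "graded_hom (gfree ds) P \<phi>" and \<psi>: "graded_hom (gfree es) P \<psi>"
    and sub: "\<phi> ` vecs ds \<subseteq> \<psi> ` vecs es"
  obtains \<theta> where "free_hom ds es \<theta>"
    "\<And>x. x \<in> vecs ds \<Longrightarrow> \<psi> (\<theta> x) = \<phi> x"
proof -
  have "\<exists>y. y \<in> grade (gfree es) (ds ! k) \<and> \<psi> y = \<phi> (bas k)" if k: "k < length ds" for k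
  proof -
    obtain y where y: "y \<in> vecs es" "\<psi> y = \<phi> (bas k)"
      using subsetD[OF sub imageI[OF bas_carrier[OF k]]] by auto
    \<comment> \<open>An arbitrary preimage need not be homogeneous; its component of degree
      \<open>ds ! k\<close> is again a preimage, since \<open>bas k\<close> is homogeneous of that
      degree.\<close>
    have "\<psi> (gcomp es (ds ! k) y) = \<phi> (gcomp ds (ds ! k) (bas k))"
      using graded_hom_gcomp_eq[OF P \<psi> \<phi> y(1) bas_carrier[OF k] y(2)] .
    also have "\<dots> = \<phi> (bas k)" by (subst gcomp_of_grade[OF bas_grade[OF k]]) simp
    finally show ?thesis using gcomp_grade[OF y(1)] by blast
  qed
  then obtain Y where Y: "\<And>k. k < length ds \<Longrightarrow> Y k \<in> grade (gfree es) (ds ! k)"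
    "\<And>k. k < length ds \<Longrightarrow> \<psi> (Y k) = \<phi> (bas k)" by metis
  define \<theta> :: "(nat \<Rightarrow> ('v, 'k) mpoly) \<Rightarrow> nat \<Rightarrow> ('v, 'k) mpoly"
    where "\<theta> x = (\<Sum>k<length ds. sm (x k) (Y k))" for x
  have \<theta>add: "\<theta> (x + y) = \<theta> x + \<theta> y" and \<theta>sm: "\<theta> (sm p x) = sm p (\<theta> x)" for x y p
    by (auto simp: \<theta>_def sum.distrib algebra_simps fun_eq_iff sum_fun_apply sum_distrib_left)
  have \<theta>car: "\<theta> x \<in> vecs es" for x
    unfolding \<theta>_def using Y(1) gfree_grade_carrier by (intro gfree_carrier_sum gfree_carrierI) auto
  have hom: "free_hom ds es \<theta>"
  proof (rule graded_homI)
    fix j and x :: "nat \<Rightarrow> ('v, 'k) mpoly" assume x: "x \<in> grade (gfree ds) j"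
    have "sm (x k) (Y k) \<in> grade (gfree es) j" if "k < length ds" for k
      using gfree_grade_sm[of "x k" "j - ds ! k" "Y k" es "ds ! k"] Y(1)[OF that] x that
      by (simp add: grade_gfree)
    thus "\<theta> x \<in> grade (gfree es) j" unfolding \<theta>_def
      by (auto simp: grade_gfree carrier_gfree sum_fun_apply intro!: homog_sum)
  qed (auto simp: \<theta>add \<theta>sm \<theta>car)
  have \<theta>bas: "\<theta> (bas k) = Y k" if "k < length ds" for k
  proof
    fix l
    have "\<theta> (bas k) l = (\<Sum>j<length ds. if j = k then Y k l else 0)"
      unfolding \<theta>_def sum_fun_apply by (rule sum.cong) (auto simp: bas_def)
    thus "\<theta> (bas k) l = Y k l" using that by simp
  qed
  have "\<psi> (\<theta> x) = \<phi> x" if x: "x \<in> vecs ds" for x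
    by (rule graded_hom_eq_on_bas[OF P _ _ _ graded_homD(1,2,3)[OF \<phi>] _ x, where f = "\<lambda>x. \<psi> (\<theta> x)"])
      (auto simp: \<theta>car \<theta>bas Y(2) \<theta>add \<theta>sm graded_homD[OF \<psi>])
  thus thesis using that hom by blast
qed

lemma gfree_homD:
  assumes "free_hom ds es f"
  shows "\<And>x. x \<in> vecs ds \<Longrightarrow> f x \<in> vecs es"
    and "\<And>x y. x \<in> vecs ds \<Longrightarrow> y \<in> vecs ds \<Longrightarrow> f (x + y) = f x + f y"
    and "\<And>p x. x \<in> vecs ds \<Longrightarrow> f (sm p x) = sm p (f x)"
    and "\<And>j x. x \<in> grade (gfree ds) j \<Longrightarrow> f x \<in> grade (gfree es) j"
    and "f 0 = 0"
    and "\<And>x. x \<in> vecs ds \<Longrightarrow> f (- x) = - f x"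
    and "\<And>x y. x \<in> vecs ds \<Longrightarrow> y \<in> vecs ds \<Longrightarrow> f (x - y) = f x - f y"
proof -
  show 1: "f x \<in> vecs es" if "x \<in> vecs ds" for x
    using graded_homD(1)[OF assms that] .
  show 2: "f (x + y) = f x + f y" if "x \<in> vecs ds" "y \<in> vecs ds" for x y
    using graded_homD(2)[OF assms that] by simp
  show 3: "f (sm p x) = sm p (f x)" if "x \<in> vecs ds" for p x
    using graded_homD(3)[OF assms that] by simp
  show "f x \<in> grade (gfree es) j" if "x \<in> grade (gfree ds) j" for j x
    using graded_homD(4)[OF assms that] .
  show 5: "f 0 = 0" using 3[of 0 0] by simp
  show 6: "f (- x) = - f x" if "x \<in> vecs ds" for x
    using 3[OF that, of "- 1"] by (simp only: sm_minus_one)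
  show "f (x - y) = f x - f y" if "x \<in> vecs ds" "y \<in> vecs ds" for x y
    using 2[of x "- y"] 6[of y] that by simp
qed

lemma gfree_hom_sum:
  assumes f: "free_hom ds es f"
    and g: "\<And>a. a \<in> A \<Longrightarrow> g a \<in> vecs ds"
  shows "f (\<Sum>a\<in>A. g a) = (\<Sum>a\<in>A. f (g a))"
  using g
proof (induction A rule: infinite_finite_induct)
  case (insert a A)
  have "sum g A \<in> vecs ds" using insert.prems by (intro gfree_carrier_sum) auto
  hence "f (g a + sum g A) = f (g a) + f (sum g A)" using gfree_homD(2)[OF f] insert.prems by blast
  moreover have "f (sum g A) = (\<Sum>a\<in>A. f (g a))" using insert by blast
  ultimately have "f (sum g (insert a A)) = (\<Sum>a\<in>insert a A. f (g a))" using insert.hyps by simp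
  thus ?case .
next
  case (infinite A)
  hence "f (sum g A) = (\<Sum>a\<in>A. f (g a))" using gfree_homD(5)[OF f] by simp
  thus ?case .
next
  case empty
  have "f (sum g {}) = (\<Sum>a\<in>{}. f (g a))" using gfree_homD(5)[OF f] by simp
  thus ?case .
qed

lemma gfree_homI:
  assumes "\<And>x. x \<in> vecs ds \<Longrightarrow> f x \<in> vecs es"
    and "\<And>x y. x \<in> vecs ds \<Longrightarrow> y \<in> vecs ds \<Longrightarrow> f (x + y) = f x + f y"
    and "\<And>p x. x \<in> vecs ds \<Longrightarrow> f (sm p x) = sm p (f x)"
    and "\<And>j x. x \<in> grade (gfree ds) j \<Longrightarrow> f x \<in> grade (gfree es) j"
  shows "free_hom ds es f"
  by (rule graded_homI) (use assms in auto)

lemma gfree_hom_comp: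
  assumes "free_hom ds es f" "graded_hom (gfree es) M g"
  shows "graded_hom (gfree ds) M (\<lambda>x. g (f x))"
  using assms unfolding graded_hom_def by auto

lemma gfree_hom_diff:
  assumes "free_hom ds es f" "free_hom ds es g"
  shows "free_hom ds es (\<lambda>x. f x - g x)"
  by (rule gfree_homI)
    (use gfree_homD[OF assms(1)] gfree_homD[OF assms(2)] in
      \<open>auto simp: fun_eq_iff algebra_simps\<close>)

lemma gfree_hom_id: "free_hom ds ds (\<lambda>x. x)"
  by (rule gfree_homI) auto

section \<open>Comparison maps and homotopies between resolutions\<close>

lemma resolutionD:
  assumes "graded_free_resolution M F"
  shows "graded_hom (gfree (shifts F 0)) M (aug F)"
    and "\<And>i. free_hom (shifts F (Suc i)) (shifts F i) (diff F i)"
    and "aug F ` vecs (shifts F 0) = carrier M"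
    and "diff F 0 ` vecs (shifts F 1) = {x \<in> vecs (shifts F 0). aug F x = \<zero>\<^bsub>M\<^esub>}"
    and "\<And>i. diff F (Suc i) ` vecs (shifts F (Suc (Suc i))) =
      {x \<in> vecs (shifts F (Suc i)). diff F i x = 0}"
  using assms unfolding graded_free_resolution_def term_at_def hom_kernel_def by auto

lemma resolution_diff_diff:
  assumes "graded_free_resolution M F" "x \<in> vecs (shifts F (Suc (Suc i)))"
  shows "diff F i (diff F (Suc i) x) = 0"
  using resolutionD(5)[OF assms(1), of i] assms(2) by blast

lemma resolution_aug_diff:
  assumes "graded_free_resolution M F" "x \<in> vecs (shifts F 1)"
  shows "aug F (diff F 0 x) = \<zero>\<^bsub>M\<^esub>"
  using resolutionD(4)[OF assms(1)] assms(2) by blast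

text \<open>The comparison theorem: the identity of \<open>M\<close> lifts step by step, since the
  terms of \<open>F\<close> are free and \<open>G\<close> is exact.\<close>

lemma resolution_lift:
  fixes M :: "(('v::finite, 'k::field) mpoly, 'm) gmodule" and F G :: "('v, 'k, 'm) free_complex"
  assumes M: "graded_module M" and F: "graded_free_resolution M F" and G: "graded_free_resolution M G"
  obtains \<alpha> where "\<And>i. free_hom (shifts F i) (shifts G i) (\<alpha> i)"
    "\<And>x. x \<in> vecs (shifts F 0) \<Longrightarrow> aug G (\<alpha> 0 x) = aug F x"
    "\<And>i x. x \<in> vecs (shifts F (Suc i)) \<Longrightarrow> diff G i (\<alpha> (Suc i) x) = \<alpha> i (diff F i x)"
proof -
  define A where "A i = carrier (gfree (shifts F i) :: (('v, 'k) mpoly, _) gmodule)" for i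
  define B where "B i = carrier (gfree (shifts G i) :: (('v, 'k) mpoly, _) gmodule)" for i
  note FD = resolutionD[OF F] note GD = resolutionD[OF G]
  \<comment> \<open>The inclusion of images is the invariant of the recursion: it is exactly the
    hypothesis of \<open>graded_hom_lift\<close> for the next map.\<close>
  define P where "P i a \<longleftrightarrow> free_hom (shifts F i) (shifts G i) a \<and>
      a ` diff F i ` A (Suc i) \<subseteq> diff G i ` B (Suc i) \<and>
      (i = 0 \<longrightarrow> (\<forall>x\<in>A 0. aug G (a x) = aug F x))" for i and a :: "(nat \<Rightarrow> ('v, 'k) mpoly) \<Rightarrow> nat \<Rightarrow> ('v, 'k) mpoly"
  have "\<exists>\<alpha>. \<forall>i. P i (\<alpha> i) \<and> (\<forall>x\<in>A (Suc i). diff G i (\<alpha> (Suc i) x) = \<alpha> i (diff F i x))"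
  proof (rule dependent_nat_choice)
    have sub: "aug F ` vecs (shifts F 0) \<subseteq> aug G ` vecs (shifts G 0)"
      using FD(3) GD(3) by simp
    obtain a where a: "free_hom (shifts F 0) (shifts G 0) a"
      "\<And>x. x \<in> vecs (shifts F 0) \<Longrightarrow> aug G (a x) = aug F x"
      by (rule graded_hom_lift[OF M FD(1) GD(1) sub]) blast
    have "a (diff F 0 x) \<in> diff G 0 ` B 1" if "x \<in> A 1" for x
    proof -
      have dx: "diff F 0 x \<in> A 0" using gfree_homD(1)[OF FD(2)] that by (simp add: A_def)
      have "aug G (a (diff F 0 x)) = \<zero>\<^bsub>M\<^esub>"
        using a(2) dx resolution_aug_diff[OF F] that by (simp add: A_def)
      thus ?thesis using gfree_homD(1)[OF a(1)] dx unfolding A_def B_def GD(4) by simp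
    qed
    hence "P 0 a" unfolding P_def using a by (auto simp: A_def)
    thus "\<exists>a. P 0 a" by blast
  next
    fix a i assume P: "P i a"
    hence a: "free_hom (shifts F i) (shifts G i) a" unfolding P_def by blast
    have sub: "(\<lambda>x. a (diff F i x)) ` vecs (shifts F (Suc i)) \<subseteq> diff G i ` vecs (shifts G (Suc i))"
      using P unfolding P_def A_def B_def by blast
    obtain b where b: "free_hom (shifts F (Suc i)) (shifts G (Suc i)) b"
      "\<And>x. x \<in> vecs (shifts F (Suc i)) \<Longrightarrow> diff G i (b x) = a (diff F i x)"
      by (rule graded_hom_lift[OF graded_module_gfree gfree_hom_comp[OF FD(2) a] GD(2) sub]) blast
    have "b (diff F (Suc i) x) \<in> diff G (Suc i) ` B (Suc (Suc i))" if "x \<in> A (Suc (Suc i))" for x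
    proof -
      have dx: "diff F (Suc i) x \<in> A (Suc i)" using gfree_homD(1)[OF FD(2)] that by (simp add: A_def)
      have "diff G i (b (diff F (Suc i) x)) = 0"
        using b(2) dx resolution_diff_diff[OF F] that gfree_homD(5)[OF a] by (simp add: A_def)
      thus ?thesis using gfree_homD(1)[OF b(1)] dx unfolding A_def B_def GD(5) by simp
    qed
    hence "P (Suc i) b" unfolding P_def using b(1) by auto
    thus "\<exists>b. P (Suc i) b \<and> (\<forall>x\<in>A (Suc i). diff G i (b x) = a (diff F i x))"
      using b(2) unfolding A_def by blast
  qed
  then obtain \<alpha> where \<alpha>: "\<And>i. P i (\<alpha> i)"
    "\<And>i x. x\<in>A (Suc i) \<Longrightarrow> diff G i (\<alpha> (Suc i) x) = \<alpha> i (diff F i x)"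
    by blast
  show thesis
  proof (rule that)
    show "free_hom (shifts F i) (shifts G i) (\<alpha> i)" for i
      using \<alpha>(1)[of i] unfolding P_def by blast
    show "aug G (\<alpha> 0 x) = aug F x" if "x \<in> vecs (shifts F 0)" for x
      using \<alpha>(1)[of 0] that unfolding P_def A_def by blast
    show "diff G i (\<alpha> (Suc i) x) = \<alpha> i (diff F i x)" if "x \<in> vecs (shifts F (Suc i))" for i x
      using \<alpha>(2) that unfolding A_def by blast
  qed
qed

text \<open>A chain endomorphism over the zero map of \<open>M\<close> is null-homotopic. It is
  needed for the difference of the identity and a round trip between two resolutions.\<close>

lemma resolution_homotopy:
  fixes M :: "(('v::finite, 'k::field) mpoly, 'm) gmodule" and F :: "('v, 'k, 'm) free_complex"
  assumes M: "graded_module M" and F: "graded_free_resolution M F"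
    and \<delta>: "\<And>i. free_hom (shifts F i) (shifts F i) (\<delta> i)"
    and aug\<delta>: "\<And>x. x \<in> vecs (shifts F 0) \<Longrightarrow> aug F (\<delta> 0 x) = \<zero>\<^bsub>M\<^esub>"
    and comm: "\<And>i x. x \<in> vecs (shifts F (Suc i)) \<Longrightarrow> diff F i (\<delta> (Suc i) x) = \<delta> i (diff F i x)"
  obtains s where "\<And>i. free_hom (shifts F i) (shifts F (Suc i)) (s i)"
    "\<And>x. x \<in> vecs (shifts F 0) \<Longrightarrow> \<delta> 0 x = diff F 0 (s 0 x)"
    "\<And>i x. x \<in> vecs (shifts F (Suc i)) \<Longrightarrow>
      \<delta> (Suc i) x = diff F (Suc i) (s (Suc i) x) + s i (diff F i x)"
proof -
  define A where "A i = carrier (gfree (shifts F i) :: (('v, 'k) mpoly, _) gmodule)" for i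
  note FD = resolutionD[OF F]
  \<comment> \<open>The middle condition makes \<open>\<delta> (Suc i) x - a (diff F i x)\<close> a
    cycle, hence a boundary by exactness, so that the next homotopy is a lift.\<close>
  define P where "P i a \<longleftrightarrow> free_hom (shifts F i) (shifts F (Suc i)) a \<and>
      (\<forall>x\<in>A (Suc i). diff F i (a (diff F i x)) = \<delta> i (diff F i x)) \<and>
      (i = 0 \<longrightarrow> (\<forall>x\<in>A 0. \<delta> 0 x = diff F 0 (a x)))" for i and a :: "(nat \<Rightarrow> ('v, 'k) mpoly) \<Rightarrow> nat \<Rightarrow> ('v, 'k) mpoly"
  have "\<exists>s. \<forall>i. P i (s i) \<and> (\<forall>x\<in>A (Suc i). \<delta> (Suc i) x = diff F (Suc i) (s (Suc i) x) + s i (diff F i x))"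
  proof (rule dependent_nat_choice)
    have sub: "\<delta> 0 ` vecs (shifts F 0) \<subseteq> diff F 0 ` vecs (shifts F (Suc 0))"
      using FD(4) aug\<delta> gfree_homD(1)[OF \<delta>] by auto
    obtain a where a: "free_hom (shifts F 0) (shifts F (Suc 0)) a"
      "\<And>x. x \<in> vecs (shifts F 0) \<Longrightarrow> diff F 0 (a x) = \<delta> 0 x"
      by (rule graded_hom_lift[OF graded_module_gfree \<delta> FD(2) sub]) blast
    hence "P 0 a" unfolding P_def A_def using gfree_homD(1)[OF FD(2)] by simp
    thus "\<exists>a. P 0 a" by blast
  next
    fix a i assume P: "P i a"
    hence a: "free_hom (shifts F i) (shifts F (Suc i)) a" unfolding P_def by blast
    let ?\<phi> = "\<lambda>x. \<delta> (Suc i) x - a (diff F i x)"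
    have "?\<phi> x \<in> diff F (Suc i) ` vecs (shifts F (Suc (Suc i)))" if x: "x \<in> A (Suc i)" for x
    proof -
      have dx: "diff F i x \<in> A i" using gfree_homD(1)[OF FD(2)] x by (simp add: A_def)
      have c: "\<delta> (Suc i) x \<in> A (Suc i)" "a (diff F i x) \<in> A (Suc i)"
        using gfree_homD(1)[OF \<delta>] gfree_homD(1)[OF a] x dx by (auto simp: A_def)
      have "diff F i (?\<phi> x) = diff F i (\<delta> (Suc i) x) - diff F i (a (diff F i x))"
        using gfree_homD(7)[OF FD(2)] c by (simp add: A_def)
      also have "\<dots> = 0" using comm x P unfolding P_def by (simp add: A_def)
      finally show ?thesis using FD(5)[of i] c by (auto simp: A_def)
    qed
    hence sub: "?\<phi> ` vecs (shifts F (Suc i)) \<subseteq> diff F (Suc i) ` vecs (shifts F (Suc (Suc i)))"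
      unfolding A_def by blast
    obtain b where b: "free_hom (shifts F (Suc i)) (shifts F (Suc (Suc i))) b"
      "\<And>x. x \<in> vecs (shifts F (Suc i)) \<Longrightarrow> diff F (Suc i) (b x) = ?\<phi> x"
      by (rule graded_hom_lift[OF graded_module_gfree gfree_hom_diff[OF \<delta> gfree_hom_comp[OF FD(2) a]] FD(2) sub])
        blast
    have "diff F (Suc i) (b (diff F (Suc i) x)) = \<delta> (Suc i) (diff F (Suc i) x)" if x: "x \<in> A (Suc (Suc i))" for x
    proof -
      have "diff F (Suc i) x \<in> A (Suc i)" using gfree_homD(1)[OF FD(2)] x by (simp add: A_def)
      thus ?thesis using b(2) resolution_diff_diff[OF F] x gfree_homD(5)[OF a] by (simp add: A_def)
    qed
    hence "P (Suc i) b" unfolding P_def using b(1) by simp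
    moreover have "\<delta> (Suc i) x = diff F (Suc i) (b x) + a (diff F i x)" if "x \<in> A (Suc i)" for x
      using b(2) that unfolding A_def by simp
    ultimately show "\<exists>b. P (Suc i) b \<and> (\<forall>x\<in>A (Suc i). \<delta> (Suc i) x = diff F (Suc i) (b x) + a (diff F i x))"
      by blast
  qed
  then obtain s where s: "\<And>i. P i (s i)"
    "\<And>i x. x\<in>A (Suc i) \<Longrightarrow> \<delta> (Suc i) x = diff F (Suc i) (s (Suc i) x) + s i (diff F i x)"
    by blast
  show thesis
  proof (rule that)
    show "free_hom (shifts F i) (shifts F (Suc i)) (s i)" for i
      using s(1)[of i] unfolding P_def by blast
    show "\<delta> 0 x = diff F 0 (s 0 x)" if "x \<in> vecs (shifts F 0)" for x
      using s(1)[of 0] that unfolding P_def A_def by blast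
    show "\<delta> (Suc i) x = diff F (Suc i) (s (Suc i) x) + s i (diff F i x)"
      if "x \<in> vecs (shifts F (Suc i))" for i x
      using s(2) that unfolding A_def by blast
  qed
qed

section \<open>Tensoring with the residue field\<close>

definition cst :: "('i \<Rightarrow> ('v, 'k::field) mpoly) \<Rightarrow> 'i \<Rightarrow> 'k" where
  "cst x = (\<lambda>k. coeff (x k) 0)"

definition emb :: "('i \<Rightarrow> 'k::field) \<Rightarrow> 'i \<Rightarrow> ('v, 'k) mpoly" where
  "emb c = (\<lambda>k. monom 0 (c k))"

lemma cst_emb [simp]: "cst (emb c) = c"
  by (simp add: cst_def emb_def)

lemma cst_add: "cst (x + y) = cst x + cst y"
  and cst_0 [simp]: "cst 0 = 0"
  by (auto simp: cst_def fun_eq_iff lookup_add)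

lemma emb_0: "emb 0 = 0"
  by (simp add: emb_def fun_eq_iff)

lemma emb_add: "emb (c + d) = emb c + emb d"
  and emb_scale: "emb (\<lambda>k. a * c k) = sm (monom 0 a) (emb c)"
  by (auto simp: emb_def fun_eq_iff single_add mult_single)

lemma cst_sm: "cst (sm p x) = (\<lambda>k. coeff p 0 * cst x k)"
  by (simp add: cst_def fun_eq_iff lookup_mult_0)

lemma tensor_map_eq: "tensor_map \<phi> c = cst (\<phi> (emb c))"
  by (simp add: tensor_map_def cst_def emb_def)

lemma emb_carrier:
  fixes c :: "nat \<Rightarrow> 'k::field"
  shows "c \<in> tensor_piece ds j \<Longrightarrow> (emb c :: nat \<Rightarrow> ('v::finite, 'k) mpoly) \<in> vecs ds"
  unfolding tensor_piece_def carrier_gfree emb_def by (auto, metis not_less single_zero)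

lemma emb_grade:
  fixes c :: "nat \<Rightarrow> 'k::field"
  assumes c: "c \<in> tensor_piece ds j"
  shows "(emb c :: nat \<Rightarrow> ('v::finite, 'k) mpoly) \<in> grade (gfree ds) j"
proof -
  have "(emb c :: nat \<Rightarrow> ('v, 'k) mpoly) k \<in> homog (j - ds ! k)" if "k < length ds" for k
    using c unfolding tensor_piece_def emb_def by (cases "c k = 0") auto
  thus ?thesis using emb_carrier[OF c] by (simp add: grade_gfree)
qed

lemma cst_grade: "x \<in> grade (gfree ds) j \<Longrightarrow> cst x \<in> tensor_piece ds j"
proof -
  assume x: "x \<in> grade (gfree ds) j"
  have "k < length ds \<and> ds ! k = j" if k: "cst x k \<noteq> 0" for k
  proof
    show l: "k < length ds" using k x by (auto simp: cst_def grade_gfree carrier_gfree intro: ccontr)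
    hence "x k \<in> homog (j - ds ! k)" using x by (simp add: grade_gfree)
    thus "ds ! k = j" using k lookup_homog_0 unfolding cst_def by fastforce
  qed
  thus ?thesis unfolding tensor_piece_def by blast
qed

text \<open>Functoriality: constant coefficients are multiplicative, so the reduction of
  \<open>\<phi> x\<close> depends only on the reduction of \<open>x\<close>. This turns identities
  between chain maps into identities between their tensor maps.\<close>

lemma tensor_map_cst:
  assumes \<phi>: "free_hom ds es \<phi>" and x: "x \<in> vecs ds"
  shows "cst (\<phi> x) = tensor_map \<phi> (cst x)"
proof -
  have car: "emb (cst x) \<in> vecs ds" using x by (auto simp: carrier_gfree emb_def cst_def)
  have expand: "cst (\<phi> y) k = (\<Sum>l<length ds. cst y l * cst (\<phi> (bas l)) k)" if y: "y \<in> vecs ds" for y k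
  proof -
    have "\<phi> y = (\<Sum>l<length ds. sm (y l) (\<phi> (bas l)))"
    proof -
      have "\<phi> (\<Sum>l<length ds. sm (y l) (bas l)) = (\<Sum>l<length ds. \<phi> (sm (y l) (bas l)))"
        by (rule gfree_hom_sum[OF \<phi>]) (intro gfree_carrierI(5) bas_carrier, simp)
      also have "\<dots> = (\<Sum>l<length ds. sm (y l) (\<phi> (bas l)))"
        by (rule sum.cong) (auto simp: gfree_homD(3)[OF \<phi> bas_carrier])
      finally show ?thesis by (rule trans[OF arg_cong[OF gfree_expand[OF y], of \<phi>]])
    qed
    thus ?thesis by (simp add: cst_def sum_fun_apply lookup_sum lookup_mult_0)
  qed
  show ?thesis unfolding tensor_map_eq using expand[OF x] expand[OF car] by (simp add: fun_eq_iff)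
qed

lemma tensor_map_piece:
  assumes "free_hom ds es \<phi>" "c \<in> tensor_piece ds j"
  shows "tensor_map \<phi> c \<in> tensor_piece es j"
  unfolding tensor_map_eq using gfree_homD(4)[OF assms(1) emb_grade[OF assms(2)]] cst_grade by blast

lemma tensor_map_linear_on:
  fixes \<phi> :: "(nat \<Rightarrow> ('v::finite, 'k::field) mpoly) \<Rightarrow> nat \<Rightarrow> ('v, 'k) mpoly"
  assumes \<phi>: "free_hom ds es \<phi>" and c: "c \<in> tensor_piece ds j" "d \<in> tensor_piece ds j"
  shows "tensor_map \<phi> (c + d) = tensor_map \<phi> c + tensor_map \<phi> d"
    "tensor_map \<phi> (\<lambda>k. a * c k) = (\<lambda>k. a * tensor_map \<phi> c k)"
  unfolding tensor_map_eq using gfree_homD(2,3)[OF \<phi>] emb_carrier[OF c(1), where 'v = 'v] emb_carrier[OF c(2), where 'v = 'v]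
  by (auto simp: emb_add emb_scale cst_add cst_sm)

definition piece_basis :: "int list \<Rightarrow> int \<Rightarrow> (nat \<Rightarrow> 'k::field) set" where
  "piece_basis ds j = (\<lambda>a k. if k = a then 1 else 0) ` {k. k < length ds \<and> ds ! k = j}"

lemma finite_piece_basis: "finite (piece_basis ds j)"
  by (simp add: piece_basis_def)

lemma
  fixes ds j
  defines "T \<equiv> tensor_piece ds j :: (nat \<Rightarrow> 'k::field) set"
  shows tensor_piece_subspace: "fs.subspace T"
    and dim_tensor_piece: "fs.dim T = count_list ds j"
    and tensor_piece_span: "T \<subseteq> fs.span (piece_basis ds j)"
proof -
  have fin: "finite {k. k < length ds \<and> ds ! k = j}" by simp
  have eq: "T = {c :: nat \<Rightarrow> 'k. \<forall>k. c k \<noteq> 0 \<longrightarrow> k \<in> {k. k < length ds \<and> ds ! k = j}}"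
    by (simp add: T_def tensor_piece_def)
  note D = dim_supported[OF fin, where 'k = 'k, folded eq]
  show "fs.subspace T" "T \<subseteq> fs.span (piece_basis ds j)"
    using D unfolding piece_basis_def by auto
  show "fs.dim T = count_list ds j"
    using D(3) by (simp add: count_list_eq_length_filter length_filter_conv_card eq_commute)
qed

lemma tensor_map_0:
  assumes "free_hom ds es \<phi>"
  shows "tensor_map \<phi> 0 = 0"
  unfolding tensor_map_eq emb_0 gfree_homD(5)[OF assms] by simp

lemma tensor_cycles_subspace:
  assumes F: "graded_free_resolution M F"
  shows "fs.subspace (tensor_cycles F i j)" "tensor_cycles F i j \<subseteq> tensor_piece (shifts F i) j"
proof -
  note FD = resolutionD[OF F]
  show "tensor_cycles F i j \<subseteq> tensor_piece (shifts F i) j"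
    unfolding tensor_cycles_def by (auto split: nat.splits)
  show "fs.subspace (tensor_cycles F i j)"
  proof (cases i)
    case (Suc i')
    note z = tensor_map_0[OF FD(2)[of i']]
    show ?thesis unfolding Suc tensor_cycles_def nat.case
      by (rule fs.subspaceI)
        (use tensor_map_linear_on[OF FD(2)[of i']] z fs.subspace_0[OF tensor_piece_subspace]
          fs.subspace_add[OF tensor_piece_subspace] fs.subspace_scale[OF tensor_piece_subspace] in \<open>auto\<close>)
  qed (simp add: tensor_cycles_def tensor_piece_subspace)
qed

lemma tensor_boundaries_subspace:
  fixes M :: "(('v::finite, 'k::field) mpoly, 'm) gmodule" and F :: "('v, 'k, 'm) free_complex"
  assumes F: "graded_free_resolution M F"
  shows "fs.subspace (tensor_boundaries F i j)" "tensor_boundaries F i j \<subseteq> tensor_cycles F i j"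
proof -
  note FD = resolutionD[OF F]
  note z = tensor_map_0[OF FD(2)[of i]]
  show "fs.subspace (tensor_boundaries F i j)"
  proof (rule fs.subspaceI)
    show "0 \<in> tensor_boundaries F i j"
      unfolding tensor_boundaries_def using z fs.subspace_0[OF tensor_piece_subspace] by (metis imageI)
  next
    fix x y assume "x \<in> tensor_boundaries F i j" "y \<in> tensor_boundaries F i j"
    then obtain c d where c: "c \<in> tensor_piece (shifts F (Suc i)) j" "d \<in> tensor_piece (shifts F (Suc i)) j"
      and "x = tensor_map (diff F i) c" "y = tensor_map (diff F i) d"
      unfolding tensor_boundaries_def by blast
    hence "x + y = tensor_map (diff F i) (c + d)" using tensor_map_linear_on(1)[OF FD(2)] by simp
    thus "x + y \<in> tensor_boundaries F i j" unfolding tensor_boundaries_def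
      using fs.subspace_add[OF tensor_piece_subspace c] by blast
  next
    fix a x assume "x \<in> tensor_boundaries F i j"
    then obtain c where c: "c \<in> tensor_piece (shifts F (Suc i)) j" and "x = tensor_map (diff F i) c"
      unfolding tensor_boundaries_def by blast
    hence "(\<lambda>k. a * x k) = tensor_map (diff F i) (\<lambda>k. a * c k)"
      using tensor_map_linear_on(2)[OF FD(2) c c] by simp
    thus "(\<lambda>k. a * x k) \<in> tensor_boundaries F i j" unfolding tensor_boundaries_def
      using fs.subspace_scale[OF tensor_piece_subspace c] by blast
  qed
  show "tensor_boundaries F i j \<subseteq> tensor_cycles F i j"
  proof (cases i)
    case (Suc i')
    have "tensor_map (diff F i') (tensor_map (diff F i) c) = 0" if c: "c \<in> tensor_piece (shifts F (Suc i)) j" for c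
    proof -
      have "tensor_map (diff F i') (cst (diff F i (emb c))) = cst (diff F i' (diff F i (emb c)))"
        using tensor_map_cst[OF FD(2)[of i']] gfree_homD(1)[OF FD(2)[of i] emb_carrier[OF c, where 'v = 'v]] Suc by simp
      thus ?thesis unfolding tensor_map_eq[of "diff F i"]
        using resolution_diff_diff[OF F, of "emb c" i'] emb_carrier[OF c, where 'v = 'v] Suc by simp
    qed
    thus ?thesis using tensor_map_piece[OF FD(2)[of i]] Suc
      unfolding tensor_boundaries_def tensor_cycles_def by auto
  next
    case 0
    thus ?thesis using tensor_map_piece[OF FD(2)[of 0]]
      unfolding tensor_boundaries_def tensor_cycles_def by auto
  qed
qed

text \<open>With comparison maps \<open>\<alpha>\<close> and \<open>\<beta>\<close>, the identity
  minus \<open>\<beta> \<alpha>\<close> is null-homotopic, so \<open>\<alpha>\<close> is injective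
  on homology after tensoring and \<open>dim_quotient_le\<close> applies. Exchanging
  \<open>F\<close> and \<open>G\<close> gives equality.\<close>

lemma tor_dim_le:
  fixes M :: "(('v::finite, 'k::field) mpoly, 'm) gmodule" and F G :: "('v, 'k, 'm) free_complex"
  assumes M: "graded_module M" and F: "graded_free_resolution M F" and G: "graded_free_resolution M G"
  shows "fs.dim (tensor_cycles F i j) + fs.dim (tensor_boundaries G i j) \<le>
    fs.dim (tensor_cycles G i j) + fs.dim (tensor_boundaries F i j)"
proof -
  note FD = resolutionD[OF F] note GD = resolutionD[OF G]
  obtain \<alpha> where \<alpha>: "\<And>i. free_hom (shifts F i) (shifts G i) (\<alpha> i)"
    "\<And>x. x \<in> vecs (shifts F 0) \<Longrightarrow> aug G (\<alpha> 0 x) = aug F x"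
    "\<And>i x. x \<in> vecs (shifts F (Suc i)) \<Longrightarrow> diff G i (\<alpha> (Suc i) x) = \<alpha> i (diff F i x)"
    using resolution_lift[OF M F G] by blast
  obtain \<beta> where \<beta>: "\<And>i. free_hom (shifts G i) (shifts F i) (\<beta> i)"
    "\<And>x. x \<in> vecs (shifts G 0) \<Longrightarrow> aug F (\<beta> 0 x) = aug G x"
    "\<And>i x. x \<in> vecs (shifts G (Suc i)) \<Longrightarrow> diff F i (\<beta> (Suc i) x) = \<beta> i (diff G i x)"
    using resolution_lift[OF M G F] by blast
  define \<delta> where "\<delta> i x = x - \<beta> i (\<alpha> i x)" for i x
  have \<delta>: "free_hom (shifts F i) (shifts F i) (\<delta> i)" for i
    unfolding \<delta>_def by (rule gfree_hom_diff[OF gfree_hom_id gfree_hom_comp[OF \<alpha>(1) \<beta>(1)]])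
  have ba: "\<beta> i (\<alpha> i x) \<in> vecs (shifts F i)" if "x \<in> vecs (shifts F i)" for i x
    using gfree_homD(1)[OF \<beta>(1)] gfree_homD(1)[OF \<alpha>(1)] that by blast
  have aug\<delta>: "aug F (\<delta> 0 x) = \<zero>\<^bsub>M\<^esub>" if x: "x \<in> vecs (shifts F 0)" for x
  proof -
    interpret M: Module.module poly_ring M using M graded_module_module by blast
    have d: "\<delta> 0 x \<in> vecs (shifts F 0)" using gfree_homD(1)[OF \<delta> x] .
    have ax: "aug F (\<beta> 0 (\<alpha> 0 x)) = aug F x"
      using \<alpha>(2)[OF x] \<beta>(2)[OF gfree_homD(1)[OF \<alpha>(1) x]] by simp
    have "aug F (\<delta> 0 x + \<beta> 0 (\<alpha> 0 x)) = aug F (\<delta> 0 x) \<oplus>\<^bsub>M\<^esub> aug F x"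
      using graded_homD(2)[OF FD(1) d ba[OF x]] ax by simp
    moreover have "\<delta> 0 x + \<beta> 0 (\<alpha> 0 x) = x" by (simp add: \<delta>_def)
    ultimately have "aug F (\<delta> 0 x) \<oplus>\<^bsub>M\<^esub> aug F x = \<zero>\<^bsub>M\<^esub> \<oplus>\<^bsub>M\<^esub> aug F x"
      using graded_homD(1)[OF FD(1) x] by simp
    thus ?thesis
      using M.add.right_cancel[OF graded_homD(1)[OF FD(1) x] graded_homD(1)[OF FD(1) d] M.zero_closed] by blast
  qed
  have comm: "diff F i (\<delta> (Suc i) x) = \<delta> i (diff F i x)" if x: "x \<in> vecs (shifts F (Suc i))" for i x
    unfolding \<delta>_def using gfree_homD(7)[OF FD(2) x ba[OF x]] \<alpha>(3)[OF x] \<beta>(3) gfree_homD(1)[OF \<alpha>(1) x] by simp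
  obtain s where s: "\<And>i. free_hom (shifts F i) (shifts F (Suc i)) (s i)"
    "\<And>x. x \<in> vecs (shifts F 0) \<Longrightarrow> \<delta> 0 x = diff F 0 (s 0 x)"
    "\<And>i x. x \<in> vecs (shifts F (Suc i)) \<Longrightarrow>
      \<delta> (Suc i) x = diff F (Suc i) (s (Suc i) x) + s i (diff F i x)"
    using resolution_homotopy[OF M F \<delta> aug\<delta> comm] by blast
  define Z where "Z = tensor_cycles F i j"
  have ZP: "Z \<subseteq> tensor_piece (shifts F i) j" unfolding Z_def by (rule tensor_cycles_subspace[OF F])
  \<comment> \<open>A tensor map is known to be linear only on the pieces; restricting coordinates
    first gives the globally linear map that \<open>dim_quotient_le\<close> asks for.\<close>
  define res where "res c = (\<lambda>k. if k < length (shifts F i) \<and> shifts F i ! k = j then c k else 0)" for c :: "nat \<Rightarrow> 'k"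
  have res: "res c \<in> tensor_piece (shifts F i) j" for c by (simp add: res_def tensor_piece_def)
  define a where "a c = tensor_map (\<alpha> i) (res c)" for c
  have alin: "flinear a"
  proof (rule flinearI)
    have "res (c + d) = res c + res d" for c d by (auto simp: res_def)
    thus "a (c + d) = a c + a d" for c d
      unfolding a_def using tensor_map_linear_on(1)[OF \<alpha>(1) res res] by metis
    have "res (\<lambda>k. t * c k) = (\<lambda>k. t * res c k)" for t c by (auto simp: res_def)
    thus "a (\<lambda>k. t * c k) = (\<lambda>k. t * a c k)" for t c
      unfolding a_def using tensor_map_linear_on(2)[OF \<alpha>(1) res res] by metis
  qed
  have a: "a c = tensor_map (\<alpha> i) c" if "c \<in> tensor_piece (shifts F i) j" for c
  proof -
    have "res c = c" using that by (auto simp: res_def tensor_piece_def fun_eq_iff)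
    thus ?thesis by (simp add: a_def)
  qed
  show ?thesis unfolding Z_def[symmetric]
  proof (rule fsp.dim_quotient_le[OF alin finite_piece_basis _ _ _ _ finite_piece_basis])
    show "Z \<subseteq> fs.span (piece_basis (shifts F i) j)" using ZP tensor_piece_span by blast
    show "tensor_cycles G i j \<subseteq> fs.span (piece_basis (shifts G i) j)"
      using tensor_cycles_subspace(2)[OF G] tensor_piece_span by blast
    show "fs.subspace Z" "fs.subspace (tensor_boundaries F i j)" "tensor_boundaries F i j \<subseteq> Z"
      "fs.subspace (tensor_boundaries G i j)" "tensor_boundaries G i j \<subseteq> tensor_cycles G i j"
      unfolding Z_def using tensor_cycles_subspace[OF F] tensor_boundaries_subspace[OF F] tensor_boundaries_subspace[OF G]
      by auto
    show "a ` Z \<subseteq> tensor_cycles G i j"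
    proof
      fix y assume "y \<in> a ` Z"
      then obtain c where c: "c \<in> Z" "y = tensor_map (\<alpha> i) c" using a ZP by auto
      have cp: "c \<in> tensor_piece (shifts F i) j" using c ZP by auto
      have yp: "y \<in> tensor_piece (shifts G i) j" using c tensor_map_piece[OF \<alpha>(1) cp] by simp
      show "y \<in> tensor_cycles G i j"
      proof (cases i)
        case (Suc i')
        have ec: "(emb c :: nat \<Rightarrow> ('v, 'k) mpoly) \<in> vecs (shifts F (Suc i'))" using emb_carrier[OF cp, where 'v = 'v] Suc by simp
        have dz: "tensor_map (diff F i') c = 0" using c unfolding Z_def tensor_cycles_def Suc by simp
        have "tensor_map (diff G i') y = cst (diff G i' (\<alpha> i (emb c)))"
          using tensor_map_cst[OF GD(2)[of i'] gfree_homD(1)[OF \<alpha>(1) ec]] c Suc by (simp add: tensor_map_eq[of "\<alpha> (Suc i')"])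
        also have "\<dots> = cst (\<alpha> i' (diff F i' (emb c)))" using \<alpha>(3)[OF ec] Suc by simp
        also have "\<dots> = tensor_map (\<alpha> i') (tensor_map (diff F i') c)"
          using tensor_map_cst[OF \<alpha>(1) gfree_homD(1)[OF FD(2) ec]] by (simp add: tensor_map_eq[of "diff F i'"])
        also have "\<dots> = 0" unfolding dz by (rule tensor_map_0[OF \<alpha>(1)])
        finally show ?thesis using yp Suc by (simp add: tensor_cycles_def)
      qed (use yp in \<open>simp add: tensor_cycles_def\<close>)
    qed
    \<comment> \<open>Split c into its images under \<open>\<delta>\<close> and under
      \<open>\<beta> \<alpha>\<close>. The second is a boundary because \<open>\<beta>\<close> maps
      boundaries to boundaries, the first because of the homotopy, whose other summand vanishes on
      cycles.\<close>
    show "c \<in> tensor_boundaries F i j" if c: "c \<in> Z" and ac: "a c \<in> tensor_boundaries G i j" for c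
    proof -
      have cp: "c \<in> tensor_piece (shifts F i) j" using c ZP by auto
      note ec = emb_carrier[OF cp, where 'v = 'v]
      obtain d where d: "d \<in> tensor_piece (shifts G (Suc i)) j" "tensor_map (\<alpha> i) c = tensor_map (diff G i) d"
        using ac a[OF cp] unfolding tensor_boundaries_def by auto
      note ed = emb_carrier[OF d(1), where 'v = 'v]
      have "cst (\<beta> i (\<alpha> i (emb c))) = tensor_map (\<beta> i) (tensor_map (\<alpha> i) c)"
        using tensor_map_cst[OF \<beta>(1) gfree_homD(1)[OF \<alpha>(1) ec]] by (simp add: tensor_map_eq[of "\<alpha> i"])
      also have "\<dots> = cst (\<beta> i (diff G i (emb d)))"
        using tensor_map_cst[OF \<beta>(1) gfree_homD(1)[OF GD(2) ed]] d(2) by (simp add: tensor_map_eq[of "diff G i"])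
      also have "\<dots> = cst (diff F i (\<beta> (Suc i) (emb d)))" using \<beta>(3)[OF ed] by simp
      also have "\<dots> = tensor_map (diff F i) (tensor_map (\<beta> (Suc i)) d)"
        using tensor_map_cst[OF FD(2) gfree_homD(1)[OF \<beta>(1) ed]] by (simp add: tensor_map_eq[of "\<beta> (Suc i)"])
      finally have 1: "cst (\<beta> i (\<alpha> i (emb c))) \<in> tensor_boundaries F i j"
        unfolding tensor_boundaries_def using tensor_map_piece[OF \<beta>(1) d(1)] by auto
      have "cst (\<delta> i (emb c)) = cst (diff F i (s i (emb c)))"
      proof (cases i)
        case (Suc i')
        have ec': "(emb c :: nat \<Rightarrow> ('v, 'k) mpoly) \<in> vecs (shifts F (Suc i'))" using ec Suc by simp
        have dz: "tensor_map (diff F i') c = 0" using c unfolding Z_def tensor_cycles_def Suc by simp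
        have "cst (s i' (diff F i' (emb c))) = tensor_map (s i') (tensor_map (diff F i') c)"
          using tensor_map_cst[OF s(1) gfree_homD(1)[OF FD(2) ec']] by (simp add: tensor_map_eq[of "diff F i'"])
        also have "\<dots> = 0" unfolding dz by (rule tensor_map_0[OF s(1)])
        finally show ?thesis using s(3)[OF ec'] Suc by (simp add: cst_add)
      qed (use s(2) ec in simp)
      also have "\<dots> = tensor_map (diff F i) (tensor_map (s i) c)"
        using tensor_map_cst[OF FD(2) gfree_homD(1)[OF s(1) ec]] by (simp add: tensor_map_eq[of "s i"])
      finally have 2: "cst (\<delta> i (emb c)) \<in> tensor_boundaries F i j"
        unfolding tensor_boundaries_def using tensor_map_piece[OF s(1) cp] by auto
      have "c = cst (\<delta> i (emb c)) + cst (\<beta> i (\<alpha> i (emb c)))"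
        unfolding cst_add[symmetric] \<delta>_def by simp
      thus ?thesis using fs.subspace_add[OF tensor_boundaries_subspace(1)[OF F] 2 1] by simp
    qed
  qed
qed

subsection \<open>Minimal resolutions and syzygy modules\<close>

lemma tensor_dim_boundaries_le:
  assumes F: "graded_free_resolution M F"
  shows "fs.dim (tensor_boundaries F i j) \<le> fs.dim (tensor_cycles F i j)"
proof (rule fs.dim_subset_le[OF finite_piece_basis])
  show "tensor_cycles F i j \<subseteq> fs.span (piece_basis (shifts F i) j)"
    using tensor_cycles_subspace(2)[OF F] tensor_piece_span by blast
qed (rule tensor_boundaries_subspace(2)[OF F])

lemma some_resolution:
  "graded_free_resolution M F \<Longrightarrow> graded_free_resolution M (some_resolution M)"
  unfolding some_resolution_def by (rule someI)

text \<open>Boundaries never have larger dimension than cycles, so the truncated differences are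
  true ones and the two inequalities of \<open>tor_dim_le\<close> force equality.\<close>

lemma betti_eq:
  assumes M: "graded_module M" and F: "graded_free_resolution M F"
  shows "betti M i j = fs.dim (tensor_cycles F i j) - fs.dim (tensor_boundaries F i j)"
  using tor_dim_le[OF M F some_resolution[OF F], of i j] tor_dim_le[OF M some_resolution[OF F] F, of i j]
    tensor_dim_boundaries_le[OF F, of i j] tensor_dim_boundaries_le[OF some_resolution[OF F], of i j]
  unfolding betti_def tor_cycles_def tor_boundaries_def by linarith

text \<open>Links the two ways in which Tor enters: \<open>regularity\<close> compares subspaces,
  \<open>betti\<close> dimensions. The resolution \<open>F\<close> guarantees that the chosen one is
  a resolution.\<close>

lemma tor_nonzero_iff:
  assumes F: "graded_free_resolution M F"
  shows "tor_cycles M i j \<noteq> tor_boundaries M i j \<longleftrightarrow> betti M i j \<noteq> 0"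
proof
  let ?G = "some_resolution M"
  note G = some_resolution[OF F]
  assume ne: "tor_cycles M i j \<noteq> tor_boundaries M i j"
  show "betti M i j \<noteq> 0"
  proof
    assume "betti M i j = 0"
    hence le: "fs.dim (tensor_cycles ?G i j) \<le> fs.dim (tensor_boundaries ?G i j)"
      unfolding betti_def tor_cycles_def tor_boundaries_def by simp
    have "tensor_boundaries ?G i j = tensor_cycles ?G i j"
    proof (rule fs.subspace_eq_if_dim_le[OF finite_piece_basis _ _ _ le])
      show "tensor_cycles ?G i j \<subseteq> fs.span (piece_basis (shifts ?G i) j)"
        using tensor_cycles_subspace(2)[OF G] tensor_piece_span by blast
    qed (use tensor_boundaries_subspace[OF G] in auto)
    thus False using ne unfolding tor_cycles_def tor_boundaries_def by simp
  qed
qed (auto simp: betti_def)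

lemma minimal_resolutionD:
  assumes "minimal_resolution M F"
  shows "graded_free_resolution M F"
    "\<And>i x k. x \<in> vecs (shifts F (Suc i)) \<Longrightarrow> coeff (diff F i x k) 0 = 0"
  using assms unfolding minimal_resolution_def term_at_def by auto

text \<open>Minimality makes every tensor map zero on the pieces: all elements are cycles and only 0
  is a boundary, so basis elements of degree j are counted.\<close>

lemma betti_minimal:
  fixes M :: "(('v::finite, 'k::field) mpoly, 'm) gmodule" and F :: "('v, 'k, 'm) free_complex"
  assumes M: "graded_module M" and F: "minimal_resolution M F"
  shows "betti M i j = count_list (shifts F i) j"
proof -
  have z: "tensor_map (diff F i) c = 0" if "c \<in> tensor_piece (shifts F (Suc i)) j" for i c
    unfolding tensor_map_eq cst_def
    using minimal_resolutionD(2)[OF F emb_carrier[OF that, where 'v = 'v]] by (simp add: fun_eq_iff)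
  have cyc: "tensor_cycles F i j = tensor_piece (shifts F i) j"
    unfolding tensor_cycles_def using z by (auto split: nat.splits)
  have "tensor_boundaries F i j \<subseteq> {0}" unfolding tensor_boundaries_def using z by blast
  hence "tensor_boundaries F i j = {0}"
    using fs.subspace_0[OF tensor_boundaries_subspace(1)[OF minimal_resolutionD(1)[OF F]], of i j] by blast
  moreover have "fs.dim {0::nat \<Rightarrow> 'k} = 0"
    using fs.dim_unique[of "{}" "{0::nat \<Rightarrow> 'k}" 0] fs.independent_empty by auto
  ultimately show ?thesis using betti_eq[OF M minimal_resolutionD(1)[OF F], of i j] dim_tensor_piece
    unfolding cyc by simp
qed

lemma generates_bas:
  fixes N :: "(('v::finite, 'k::field) mpoly, 'm) gmodule"
  assumes N: "graded_module N" and f: "graded_hom (gfree ds) N f" and surj: "f ` vecs ds = carrier N"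
  shows "generates N (f ` bas ` {..<length ds})"
  unfolding generates_def
proof (intro conjI allI impI)
  show "f ` bas ` {..<length ds} \<subseteq> carrier N"
    using graded_homD(1)[OF f] bas_carrier by auto
  fix H assume H: "submodule H poly_ring N \<and> f ` bas ` {..<length ds} \<subseteq> H"
  then interpret H: submodule H poly_ring N by blast
  have hb: "f (bas k) \<in> H" if "k < length ds" for k using H that by blast
  have mem: "f (\<Sum>k\<in>K. sm (x k) (bas k)) \<in> H" if "finite K" "K \<subseteq> {..<length ds}" for K and x :: "nat \<Rightarrow> ('v, 'k) mpoly"
    using that
  proof (induction K)
    case empty
    have "f 0 \<in> H" using graded_hom_zero[OF N f] H.one_closed by simp
    hence "f (\<Sum>k\<in>{}. sm (x k) (bas k)) \<in> H" by simp
    thus ?case .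
  next
    case (insert k K)
    have k: "k < length ds" using insert.prems by simp
    have s: "(\<Sum>k\<in>K. sm (x k) (bas k)) \<in> vecs ds"
      using insert.prems bas_carrier by (intro gfree_carrier_sum gfree_carrierI(5)) auto
    have "f (sm (x k) (bas k) + (\<Sum>k\<in>K. sm (x k) (bas k))) =
        f (sm (x k) (bas k)) \<oplus>\<^bsub>N\<^esub> f (\<Sum>k\<in>K. sm (x k) (bas k))"
      using graded_homD(2)[OF f _ s] bas_carrier[OF k] by blast
    moreover have "f (sm (x k) (bas k)) = x k \<odot>\<^bsub>N\<^esub> f (bas k)"
      using graded_homD(3)[OF f bas_carrier[OF k]] .
    moreover have "x k \<odot>\<^bsub>N\<^esub> f (bas k) \<in> H" using H.smult_closed hb[OF k] by simp
    moreover have "f (\<Sum>k\<in>K. sm (x k) (bas k)) \<in> H" using insert by blast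
    ultimately have "f (sm (x k) (bas k) + (\<Sum>k\<in>K. sm (x k) (bas k))) \<in> H"
      using H.m_closed by simp
    moreover have "(\<Sum>k\<in>insert k K. sm (x k) (bas k)) = sm (x k) (bas k) + (\<Sum>k\<in>K. sm (x k) (bas k))"
      by (rule sum.insert) (use insert in auto)
    ultimately have "f (\<Sum>k\<in>insert k K. sm (x k) (bas k)) \<in> H" by (simp only:)
    thus ?case .
  qed
  have "f x \<in> H" if "x \<in> vecs ds" for x
    by (subst gfree_expand[OF that], rule mem) simp_all
  hence "carrier N \<subseteq> H" unfolding surj[symmetric] by blast
  moreover have "H \<subseteq> carrier N" using H.subset by simp
  ultimately show "H = carrier N" by blast
qed

section \<open>Cokernels and syzygy modules\<close>

definition coset :: "(nat \<Rightarrow> ('v, 'k::field) mpoly) set \<Rightarrow> (nat \<Rightarrow> ('v, 'k) mpoly) \<Rightarrow> (nat \<Rightarrow> ('v, 'k) mpoly) set" where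
  "coset I x = (+) x ` I"

text \<open>In the scalar product \<open>I\<close> is added again because the multiples of a coset
  need not fill a coset: for p = 0 they are just 0.\<close>

definition quotient_gmodule ::
    "int list \<Rightarrow> (nat \<Rightarrow> ('v::finite, 'k::field) mpoly) set \<Rightarrow> (('v, 'k) mpoly, (nat \<Rightarrow> ('v, 'k) mpoly) set) gmodule" where
  "quotient_gmodule ds I =
     \<lparr>carrier = coset I ` vecs ds,
      mult = undefined, one = undefined,
      zero = I, add = (\<lambda>X Y. {x + y | x y. x \<in> X \<and> y \<in> Y}),
      smult = (\<lambda>p X. {sm p x + y | x y. x \<in> X \<and> y \<in> I}),
      grade = (\<lambda>j. coset I ` grade (gfree ds) j)\<rparr>"

lemma quotient_gmodule:
  fixes I :: "(nat \<Rightarrow> ('v::finite, 'k::field) mpoly) set"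
  assumes I: "0 \<in> I" "\<And>x y. x \<in> I \<Longrightarrow> y \<in> I \<Longrightarrow> x + y \<in> I" "\<And>p x. x \<in> I \<Longrightarrow> sm p x \<in> I"
    and gr: "\<And>x j. x \<in> I \<Longrightarrow> gcomp ds j x \<in> I"
  shows "graded_module (quotient_gmodule ds I)"
    and "graded_hom (gfree ds) (quotient_gmodule ds I) (coset I)"
    and "coset I x = I \<longleftrightarrow> x \<in> I"
proof -
  let ?Q = "quotient_gmodule ds I"
  have neg: "- x \<in> I" if "x \<in> I" for x using I(3)[OF that, of "- 1"] by (simp add: sm_minus_one)
  have mem: "y \<in> coset I x \<longleftrightarrow> y - x \<in> I" for x y
    unfolding coset_def by (auto intro!: image_eqI[of _ _ "y - x"])
  have add: "coset I (x + y) = coset I x \<oplus>\<^bsub>?Q\<^esub> coset I y" for x y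
  proof -
    have "coset I (x + y) = {a + b |a b. a \<in> coset I x \<and> b \<in> coset I y}"
    proof (intro Set.set_eqI iffI)
      fix z assume "z \<in> coset I (x + y)"
      hence "z - (x + y) \<in> I" by (simp add: mem)
      hence "z - y \<in> coset I x \<and> y \<in> coset I y" using I(1) by (simp add: mem algebra_simps)
      moreover have "z = (z - y) + y" by simp
      ultimately show "z \<in> {a + b |a b. a \<in> coset I x \<and> b \<in> coset I y}" by blast
    next
      fix z assume "z \<in> {a + b |a b. a \<in> coset I x \<and> b \<in> coset I y}"
      then obtain a b where "z = a + b" "a - x \<in> I" "b - y \<in> I" by (auto simp: mem)
      thus "z \<in> coset I (x + y)" using I(2)[of "a - x" "b - y"] by (simp add: mem algebra_simps)
    qed
    thus ?thesis by (simp add: quotient_gmodule_def)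
  qed
  have smu: "coset I (sm p x) = p \<odot>\<^bsub>?Q\<^esub> coset I x" for p x
  proof -
    have "coset I (sm p x) = {sm p a + b |a b. a \<in> coset I x \<and> b \<in> I}"
    proof (intro Set.set_eqI iffI)
      fix z assume "z \<in> coset I (sm p x)"
      hence "z - sm p x \<in> I" by (simp add: mem)
      moreover have "z = sm p x + (z - sm p x)" "x \<in> coset I x" using I(1) by (auto simp: mem)
      ultimately show "z \<in> {sm p a + b |a b. a \<in> coset I x \<and> b \<in> I}" by blast
    next
      fix z assume "z \<in> {sm p a + b |a b. a \<in> coset I x \<and> b \<in> I}"
      then obtain a b where *: "z = sm p a + b" "a - x \<in> I" "b \<in> I" by (auto simp: mem)
      have "z - sm p x = sm p (a - x) + b" using *(1) by (auto simp: fun_eq_iff algebra_simps)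
      thus "z \<in> coset I (sm p x)" using I(2)[OF I(3)[OF *(2), of p] *(3)] by (simp add: mem)
    qed
    thus ?thesis by (simp add: quotient_gmodule_def)
  qed
  show iff: "coset I x = I \<longleftrightarrow> x \<in> I" for x
  proof
    assume "coset I x = I"
    moreover have "x \<in> coset I x" using I(1) by (simp add: mem)
    ultimately show "x \<in> I" by simp
  next
    assume x: "x \<in> I"
    show "coset I x = I"
    proof (intro Set.set_eqI iffI)
      fix z assume "z \<in> coset I x"
      thus "z \<in> I" using I(2)[of "z - x" x] x by (simp add: mem)
    next
      fix z assume "z \<in> I"
      thus "z \<in> coset I x" using I(2)[of z "- x"] neg[OF x] by (simp add: mem)
    qed
  qed
  have q: "carrier ?Q = coset I ` vecs ds" "\<zero>\<^bsub>?Q\<^esub> = I" "\<And>j. grade ?Q j = coset I ` grade (gfree ds) j"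
    by (auto simp: quotient_gmodule_def)
  show "graded_module ?Q"
  proof (rule graded_module_surj[where f = "coset I" and ds = ds])
    show "coset I 0 = \<zero>\<^bsub>?Q\<^esub>" using iff I(1) q(2) by simp
    show "coset I (gcomp ds j x) = \<zero>\<^bsub>?Q\<^esub>" if "coset I x = \<zero>\<^bsub>?Q\<^esub>" for x j
      using that gr[of x j] iff q(2) by simp
  qed (simp_all only: add smu q)
  show "graded_hom (gfree ds) ?Q (coset I)"
    by (rule graded_homI) (simp_all only: add smu, simp_all add: q)
qed

lemma gfree_hom_gcomp:
  assumes "free_hom ds es f" "x \<in> vecs ds"
  shows "f (gcomp ds j x) = gcomp es j (f x)"
  using graded_hom_gcomp_eq[OF graded_module_gfree assms(1) gfree_hom_id assms(2) gfree_homD(1)[OF assms]] by simp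

text \<open>The module is the cokernel of \<open>d 0\<close>, so exactness at position 0 and at the
  module holds by construction. The image of \<open>d 0\<close> is a homogeneous submodule because
  \<open>d 0\<close> commutes with \<open>gcomp\<close>.\<close>

lemma module_of_exact_sequence:
  fixes d :: "nat \<Rightarrow> (nat \<Rightarrow> ('v::finite, 'k::field) mpoly) \<Rightarrow> nat \<Rightarrow> ('v, 'k) mpoly"
  assumes hom: "\<And>i. free_hom (ds (Suc i)) (ds i) (d i)"
    and exact: "\<And>i. d (Suc i) ` vecs (ds (Suc (Suc i))) = {x \<in> vecs (ds (Suc i)). d i x = 0}"
    and min: "\<And>i x k. x \<in> vecs (ds (Suc i)) \<Longrightarrow> coeff (d i x k) 0 = 0"
  obtains M :: "(('v, 'k) mpoly, (nat \<Rightarrow> ('v, 'k) mpoly) set) gmodule" and F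
    where "graded_module M" "minimal_resolution M F" "shifts F = ds"
proof -
  define I where "I = d 0 ` vecs (ds 1)"
  define M where "M = quotient_gmodule (ds 0) I"
  define F where "F = \<lparr>shifts = ds, diff = d, aug = coset I\<rparr>"
  note h0 = hom[of 0, simplified]
  have Ic: "I \<subseteq> vecs (ds 0)" unfolding I_def using gfree_homD(1)[OF h0] by auto
  have I: "0 \<in> I" "\<And>x y. x \<in> I \<Longrightarrow> y \<in> I \<Longrightarrow> x + y \<in> I" "\<And>p x. x \<in> I \<Longrightarrow> sm p x \<in> I"
    "\<And>x j. x \<in> I \<Longrightarrow> gcomp (ds 0) j x \<in> I"
  proof -
    show "0 \<in> I" unfolding I_def using gfree_homD(5)[OF h0] by (intro image_eqI[of _ _ 0]) auto
    show "x + y \<in> I" if xy: "x \<in> I" "y \<in> I" for x y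
    proof -
      obtain a b where "x = d 0 a" "y = d 0 b" and ab: "a \<in> vecs (ds 1)" "b \<in> vecs (ds 1)"
        using xy unfolding I_def by blast
      hence "x + y = d 0 (a + b)" using gfree_homD(2)[OF h0] by simp
      thus ?thesis unfolding I_def using ab by blast
    qed
    show "sm p x \<in> I" if x: "x \<in> I" for p x
    proof -
      obtain a where "x = d 0 a" and a: "a \<in> vecs (ds 1)" using x unfolding I_def by blast
      hence "sm p x = d 0 (sm p a)" using gfree_homD(3)[OF h0] by simp
      thus ?thesis unfolding I_def using a by blast
    qed
    show "gcomp (ds 0) j x \<in> I" if x: "x \<in> I" for x j
    proof -
      obtain a where "x = d 0 a" and a: "a \<in> vecs (ds 1)" using x unfolding I_def by blast
      hence "gcomp (ds 0) j x = d 0 (gcomp (ds 1) j a)" using gfree_hom_gcomp[OF h0] by simp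
      thus ?thesis unfolding I_def using gcomp_carrier[OF a] by blast
    qed
  qed
  note Q = quotient_gmodule[where ds = "ds 0", OF I]
  have "graded_free_resolution M F"
    unfolding graded_free_resolution_def term_at_def hom_kernel_def
  proof (intro conjI allI)
    show "graded_hom (gfree (shifts F 0)) M (aug F)" using Q(2) by (simp add: F_def M_def)
    show "aug F ` vecs (shifts F 0) = carrier M" by (simp add: F_def M_def quotient_gmodule_def)
    have "diff F 0 ` vecs (shifts F 1) = I" by (simp add: F_def I_def)
    also have "I = {x \<in> vecs (shifts F 0). aug F x = \<zero>\<^bsub>M\<^esub>}"
      using Q(3) Ic by (auto simp: F_def M_def quotient_gmodule_def)
    finally show "diff F 0 ` vecs (shifts F 1) =
        {x \<in> vecs (shifts F 0). aug F x = \<zero>\<^bsub>M\<^esub>}" .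
  qed (use hom exact in \<open>auto simp: F_def\<close>)
  hence "minimal_resolution M F"
    unfolding minimal_resolution_def using min by (simp add: term_at_def F_def)
  thus thesis using that[of M F] Q(1) by (simp add: M_def F_def)
qed

text \<open>The chosen minimal resolution is cut at position n: its tail, with
  \<open>diff F (n - 1)\<close> as augmentation, resolves the syzygy module, and its beginning
  exhibits that module as an n-th syzygy. \<open>F0\<close> ensures that a minimal resolution exists
  to be chosen.\<close>

lemma Syz_resolution:
  fixes M :: "(('v::finite, 'k::field) mpoly, 'm) gmodule"
  assumes M: "graded_module M" and ex: "minimal_resolution M F0" and n: "n > 0"
  defines "F \<equiv> some_minimal_resolution M"
  shows "minimal_resolution M F"
    and "grade (Syz n M) j \<subseteq> diff F (n - 1) ` grade (gfree (shifts F n)) j"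
    and "graded_module (Syz n M)"
    and "graded_syzygy_module n (Syz n M)"
    and "minimal_resolution (Syz n M) \<lparr>shifts = (\<lambda>i. shifts F (n + i)), diff = (\<lambda>i. diff F (n + i)), aug = diff F (n - 1)\<rparr>"
proof -
  show F: "minimal_resolution M F"
    unfolding F_def some_minimal_resolution_def using ex by (rule someI)
  obtain m where n: "n = Suc m" using n by (cases n) auto
  note FR = minimal_resolutionD(1)[OF F] note FD = resolutionD[OF FR]
  let ?N = "Syz n M" and ?f = "diff F m"
  define I where "I = ?f ` vecs (shifts F n)"
  note f = FD(2)[of m, folded n]
  have N: "carrier ?N = I" "add ?N = (+)" "zero ?N = 0" "smult ?N = sm"
    "\<And>j. grade ?N j = I \<inter> grade (gfree (shifts F m)) j"
    unfolding Syz_def F_def[symmetric] Let_def term_at_def by (simp_all add: n I_def)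
  have grN: "grade ?N j = ?f ` grade (gfree (shifts F n)) j" for j
  proof
    show "?f ` grade (gfree (shifts F n)) j \<subseteq> grade ?N j"
      unfolding N I_def using gfree_homD(4)[OF f] by (blast intro: gfree_grade_carrier)
    show "grade ?N j \<subseteq> ?f ` grade (gfree (shifts F n)) j"
    proof
      fix x assume "x \<in> grade ?N j"
      then obtain y where y: "x = ?f y" "y \<in> vecs (shifts F n)" "x \<in> grade (gfree (shifts F m)) j"
        unfolding N I_def by blast
      have "?f (gcomp (shifts F n) j y) = x"
        using gfree_hom_gcomp[OF f y(2)] gcomp_of_grade[OF y(3)] y(1) by simp
      thus "x \<in> ?f ` grade (gfree (shifts F n)) j" using gcomp_grade[OF y(2)] by blast
    qed
  qed
  show "grade ?N j \<subseteq> diff F (n - 1) ` grade (gfree (shifts F n)) j"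
    using grN[of j] by (simp add: n)
  have homN: "graded_hom (gfree (shifts F n)) ?N ?f"
    by (rule graded_homI) (use gfree_homD[OF f] in \<open>auto simp: N(1-4) I_def grN\<close>)
  show grm: "graded_module ?N"
  proof (rule graded_module_surj[where f = ?f and ds = "shifts F n"])
    show "?f (gcomp (shifts F n) j x) = \<zero>\<^bsub>?N\<^esub>"
      if "x \<in> vecs (shifts F n)" "?f x = \<zero>\<^bsub>?N\<^esub>" for x j
      using gfree_hom_gcomp[OF f that(1)] that(2) by (simp add: N)
  qed (use gfree_homD[OF f] in \<open>auto simp: N(1-4) I_def grN\<close>)
  let ?F' = "\<lparr>shifts = (\<lambda>i. shifts F (n + i)), diff = (\<lambda>i. diff F (n + i)), aug = diff F (n - 1)\<rparr>"
  have "graded_free_resolution ?N ?F'"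
    unfolding graded_free_resolution_def term_at_def hom_kernel_def
  proof (intro conjI allI)
    show "graded_hom (gfree (shifts ?F' 0)) ?N (aug ?F')" using homN n by simp
    show "aug ?F' ` vecs (shifts ?F' 0) = carrier ?N" unfolding N(1) I_def by (simp add: n)
    show "diff ?F' 0 ` vecs (shifts ?F' 1) =
        {x \<in> vecs (shifts ?F' 0). aug ?F' x = \<zero>\<^bsub>?N\<^esub>}"
      unfolding N(3) using FD(5)[of m] by (simp add: n)
  qed (use FD(2,5) in \<open>simp_all add: n\<close>)
  thus "minimal_resolution ?N ?F'"
    unfolding minimal_resolution_def term_at_def using minimal_resolutionD(2)[OF F] by simp
  have incl: "graded_hom ?N (gfree (shifts F m)) (\<lambda>x. x)"
    unfolding graded_hom_def N using gfree_homD(1)[OF f] by (auto simp: I_def)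
  have e: "I = hom_kernel (gfree (shifts F (n - 1))) (gfree (shifts F (n - 2))) (diff F (n - 2))" if "n \<ge> 2"
  proof -
    obtain l where m: "m = Suc l" using \<open>n \<ge> 2\<close> n by (cases m) auto
    show ?thesis using FD(5)[of l] unfolding I_def hom_kernel_def by (simp add: n m)
  qed
  show "graded_syzygy_module n ?N"
    unfolding graded_syzygy_module_def
  proof (intro conjI grm exI[of _ "shifts F"] exI[of _ "diff F"] exI[of _ "\<lambda>x. x"])
    show "graded_hom ?N (gfree (shifts F (n - 1))) (\<lambda>x. x)" using incl by (simp add: n)
    show "2 \<le> n \<longrightarrow> (\<lambda>x. x) ` carrier ?N =
        hom_kernel (gfree (shifts F (n - 1))) (gfree (shifts F (n - 2))) (diff F (n - 2))"
      unfolding N(1) using e by simp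
  qed (use FD(2,5) in \<open>auto simp: n hom_kernel_def\<close>)
qed

text \<open>\<open>initial_degree\<close> ranges over all minimal generating sets. One of them has
  to be found in degree d, and elements of all of them must be shown to have no degree below
  d.\<close>

lemma initial_degree_eq:
  fixes N :: "(('v::finite, 'k::field) mpoly, 'm) gmodule" and F :: "('v, 'k, 'm) free_complex"
  assumes N: "graded_module N" and F: "minimal_resolution N F"
    and gr: "\<And>e. grade N e \<subseteq> aug F ` grade (gfree (shifts F 0)) e"
    and sh: "shifts F 0 \<noteq> []" "\<And>e. e \<in> set (shifts F 0) \<Longrightarrow> e = d"
  shows "initial_degree N = d"
  unfolding initial_degree_def
proof (rule Least_equality)
  interpret N: Module.module poly_ring N using N graded_module_module by blast
  note FD = resolutionD[OF minimal_resolutionD(1)[OF F]]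
  let ?f = "aug F" and ?ds = "shifts F 0"
  have dsk: "?ds ! k = d" if "k < length ?ds" for k using that sh by auto
  have gen: "generates N (?f ` bas ` {..<length ?ds})"
    by (rule generates_bas[OF N FD(1,3)])
  define C where "C = {Y. Y \<subseteq> ?f ` bas ` {..<length ?ds} \<and> generates N Y}"
  have "finite C" "C \<noteq> {}" unfolding C_def using gen by auto
  \<comment> \<open>The images of the basis vectors form a finite generating set, which contains an
    inclusion-minimal one.\<close>
  from finite_has_minimal[OF this] obtain Y where Y: "Y \<in> C" "\<forall>Z\<in>C. Z \<subseteq> Y \<longrightarrow> Y = Z"
    by blast
  have bg: "?f (bas k) \<in> grade N d" if "k < length ?ds" for k
    using graded_homD(4)[OF FD(1) bas_grade[OF that]] dsk[OF that] by simp
  have Yg: "Y \<subseteq> grade N d" using Y(1) bg unfolding C_def by blast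
  have minY: "minimal_generators N Y"
    unfolding minimal_generators_def
  proof (intro conjI allI impI)
    show "Y \<subseteq> (\<Union>j. grade N j)" using Yg by blast
    show "generates N Y" using Y(1) by (simp add: C_def)
    fix Z assume Z: "Z \<subset> Y"
    show "\<not> generates N Z"
    proof
      assume "generates N Z"
      hence "Z \<in> C" using Z Y(1) unfolding C_def by auto
      thus False using Y(2) Z by blast
    qed
  qed
  \<comment> \<open>Otherwise N = 0, and exactness would make \<open>bas 0\<close> a boundary; its
    constant coefficient 1 contradicts minimality.\<close>
  have "Y \<noteq> {}"
  proof
    assume "Y = {}"
    moreover have "submodule {\<zero>\<^bsub>N\<^esub>} poly_ring N"
      by (rule N.submoduleI) auto
    moreover have "generates N Y" using Y(1) by (simp add: C_def)
    ultimately have "{\<zero>\<^bsub>N\<^esub>} = carrier N" by (simp add: generates_def)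
    hence "?f (bas 0) = \<zero>\<^bsub>N\<^esub>" using graded_homD(1)[OF FD(1) bas_carrier[of 0]] sh(1) by auto
    then obtain y where y: "y \<in> vecs (shifts F 1)" "bas 0 = diff F 0 y"
    proof -
      have "bas 0 \<in> diff F 0 ` vecs (shifts F 1)"
        unfolding FD(4) using bas_carrier[of 0 ?ds] sh(1) \<open>?f (bas 0) = \<zero>\<^bsub>N\<^esub>\<close> by simp
      thus ?thesis using that by blast
    qed
    have "coeff (bas 0 0 :: ('v, 'k) mpoly) 0 = 0"
      using minimal_resolutionD(2)[OF F, of y 0 0] y by simp
    thus False by (simp add: bas_def)
  qed
  thus "\<exists>X. minimal_generators N X \<and> (\<exists>x\<in>X. x \<in> grade N d)" using minY Yg by blast
  fix e assume "\<exists>X. minimal_generators N X \<and> (\<exists>x\<in>X. x \<in> grade N e)"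
  then obtain X x where X: "minimal_generators N X" "x \<in> X" "x \<in> grade N e" by blast
  have gX: "X \<subseteq> carrier N" "\<And>H. submodule H poly_ring N \<Longrightarrow> X \<subseteq> H \<Longrightarrow> H = carrier N"
    using X(1) by (simp_all add: minimal_generators_def generates_def)
  have mX: "\<not> generates N (X - {x})" using X(1,2) by (auto simp: minimal_generators_def)
  have "x \<noteq> \<zero>\<^bsub>N\<^esub>"
  proof
    assume z: "x = \<zero>\<^bsub>N\<^esub>"
    have "generates N (X - {x})" unfolding generates_def
    proof (intro conjI allI impI)
      show "X - {x} \<subseteq> carrier N" using gX(1) by blast
      fix H assume H: "submodule H poly_ring N \<and> X - {x} \<subseteq> H"
      then interpret H: submodule H poly_ring N by blast
      have "X \<subseteq> H" using H z H.one_closed by auto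
      thus "H = carrier N" using gX(2) H by simp
    qed
    thus False using mX by simp
  qed
  obtain y where y: "y \<in> grade (gfree ?ds) e" "?f y = x" using X(3) gr[of e] by blast
  show "d \<le> e"
  \<comment> \<open>A preimage of degree e < d has coordinates of negative degree, hence is
    0.\<close>
  proof (rule ccontr)
    assume "\<not> d \<le> e"
    hence "y k = 0" for k
      using homog_neg_eq_0[of "y k" "e - ?ds ! k"] dsk[of k] y(1)
      by (cases "k < length ?ds") (auto simp: grade_gfree carrier_gfree)
    hence "y = 0" by (simp add: fun_eq_iff)
    thus False using \<open>x \<noteq> \<zero>\<^bsub>N\<^esub>\<close> graded_hom_zero[OF N FD(1)] y(2) by simp
  qed
qed

subsection \<open>Extension of scalars\<close>

definition slice :: "('v \<Rightarrow>\<^sub>0 nat) \<Rightarrow> ('i \<Rightarrow> ('v, 'k::field) mpoly) \<Rightarrow> 'i \<Rightarrow> 'k" where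
  "slice m f = (\<lambda>B. coeff (f B) m)"

text \<open>The extension of scalars \<open>S \<otimes> W\<close>, as the set of families all of whose coefficient slices lie in \<open>W\<close>.\<close>

definition extend_scalars :: "('i \<Rightarrow> 'k::field) set \<Rightarrow> ('i \<Rightarrow> ('v, 'k) mpoly) set" where
  "extend_scalars W = {f. \<forall>m. slice m f \<in> W}"

text \<open>The matrix of \<open>T\<close> with respect to unit vectors, applied to polynomial
  coordinates. The finite set \<open>A\<close> of columns is explicit because the index type can be
  \<open>nat\<close>.\<close>

definition extend_map ::
    "'i set \<Rightarrow> (('i \<Rightarrow> 'k::field) \<Rightarrow> 'j \<Rightarrow> 'k) \<Rightarrow> ('i \<Rightarrow> ('v, 'k) mpoly) \<Rightarrow> 'j \<Rightarrow> ('v, 'k) mpoly" where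
  "extend_map A T f = (\<lambda>B. \<Sum>C\<in>A. monom 0 (T (\<lambda>k. if k = C then 1 else 0) B) * f C)"

lemma slice_0 [simp]: "slice m 0 = 0"
  by (simp add: slice_def fun_eq_iff)

lemma slice_eqI: "(\<And>m. slice m f = slice m g) \<Longrightarrow> f = g"
  by (intro ext poly_mapping_eqI) (simp add: slice_def fun_eq_iff)

lemma flinear_expand:
  fixes T :: "('i \<Rightarrow> 'k::field) \<Rightarrow> 'j \<Rightarrow> 'k"
  assumes T: "flinear T" and A: "finite A" and c: "\<And>k. k \<notin> A \<Longrightarrow> c k = 0"
  shows "T c B = (\<Sum>C\<in>A. T (\<lambda>k. if k = C then 1 else 0) B * c C)"
proof -
  interpret T: Vector_Spaces.linear fscale fscale T by fact
  have "c = (\<Sum>C\<in>A. (\<lambda>k. c C * (if k = C then 1 else 0)))"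
  proof
    fix k
    have "(\<Sum>C\<in>A. (\<lambda>k. c C * (if k = C then 1 else 0))) k = (\<Sum>C\<in>A. if k = C then c k else 0)"
      unfolding sum_fun_apply by (rule sum.cong) auto
    thus "c k = (\<Sum>C\<in>A. (\<lambda>k. c C * (if k = C then 1 else 0))) k" using A c by simp
  qed
  hence "T c = T (\<Sum>C\<in>A. (\<lambda>k. c C * (if k = C then 1 else 0)))" by (rule arg_cong)
  also have "\<dots> = (\<Sum>C\<in>A. T (\<lambda>k. c C * (if k = C then 1 else 0)))" by (rule T.sum)
  also have "\<dots> = (\<Sum>C\<in>A. (\<lambda>B. c C * T (\<lambda>k. if k = C then 1 else 0) B))"
    by (rule sum.cong) (auto simp: T.scale)
  finally show ?thesis by (simp add: sum_fun_apply mult.commute)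
qed

text \<open>The bridge between K and S: identities over S are checked on the coefficients of each
  monomial, where they are identities over K.\<close>

lemma slice_extend_map:
  assumes "flinear T" "finite A" "\<And>k. k \<notin> A \<Longrightarrow> f k = 0"
  shows "slice m (extend_map A T f) = T (slice m f)"
proof
  fix B
  show "slice m (extend_map A T f) B = T (slice m f) B"
    by (subst flinear_expand[OF assms(1,2)])
      (auto simp: slice_def extend_map_def lookup_sum lookup_const_mult assms(3))
qed

lemma extend_map_add: "extend_map A T (f + g) = extend_map A T f + extend_map A T g"
  and extend_map_diff: "extend_map A T (f - g) = extend_map A T f - extend_map A T g"
  and extend_map_sm: "extend_map A T (sm p f) = sm p (extend_map A T f)"
  and extend_map_0 [simp]: "extend_map A T 0 = 0"
  by (auto simp: extend_map_def fun_eq_iff algebra_simps sum.distrib sum_subtractf sum_distrib_left)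

lemma extend_map_homog:
  "(\<And>C. f C \<in> homog d) \<Longrightarrow> extend_map A T f B \<in> homog d"
  unfolding extend_map_def by (intro homog_sum mult_in_homog_0) auto

lemma extend_map_cst_0:
  "(\<And>C. coeff (f C) 0 = 0) \<Longrightarrow> coeff (extend_map A T f B) 0 = 0"
  by (simp add: extend_map_def lookup_sum lookup_const_mult)

text \<open>\<open>P\<close> sends unit vectors to a basis of W, and \<open>Q\<close> is a linear
  left inverse of \<open>P\<close> on the vectors supported below \<open>dim W\<close>. Both are
  total linear maps, so that they can be extended to S.\<close>

lemma subspace_coordinates:
  fixes W :: "('i::finite \<Rightarrow> 'k::field) set"
  assumes W: "fs.subspace W"
  obtains P :: "(nat \<Rightarrow> 'k) \<Rightarrow> 'i \<Rightarrow> 'k" and Q :: "('i \<Rightarrow> 'k) \<Rightarrow> nat \<Rightarrow> 'k"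
    where "flinear P" "flinear Q"
      "\<And>c. (\<And>k. k \<ge> fs.dim W \<Longrightarrow> c k = 0) \<Longrightarrow> P c \<in> W \<and> Q (P c) = c"
      "\<And>w. w \<in> W \<Longrightarrow> P (Q w) = w"
      "\<And>w k. k \<ge> fs.dim W \<Longrightarrow> Q w k = 0"
proof -
  define r where "r = fs.dim W"
  have "W \<subseteq> fs.span ((\<lambda>a k. if k = a then 1 else 0) ` UNIV)"
    using dim_supported(2)[of "UNIV :: 'i set", where 'k = 'k] by auto
  then obtain B where B: "finite B" "B \<subseteq> W" "fs.independent B" "W \<subseteq> fs.span B" "card B = r"
    using fs.finite_basis_exists[of "(\<lambda>a k. if k = a then 1 else 0) ` UNIV" W] unfolding r_def by auto
  obtain b where b: "bij_betw b {..<r} B"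
    using ex_bij_betw_nat_finite[OF B(1)] B(5) by (auto simp: atLeast0LessThan)
  define P where "P c = (\<Sum>k<r. (\<lambda>i. c k * b k i))" for c :: "nat \<Rightarrow> 'k"
  have Papp: "P c i = (\<Sum>k<r. c k * b k i)" for c i by (simp add: P_def sum_fun_apply)
  have P: "flinear P"
    by (rule flinearI) (auto simp: fun_eq_iff Papp algebra_simps sum.distrib sum_distrib_left)
  interpret P: Vector_Spaces.linear fscale fscale P by fact
  define V where "V = {c :: nat \<Rightarrow> 'k. \<forall>k. c k \<noteq> 0 \<longrightarrow> k \<in> {..<r}}"
  have V: "fs.subspace V" unfolding V_def by (rule dim_supported(1)) simp
  have PW: "P c \<in> W" for c
    unfolding P_def
    by (rule fs.subspace_sum[OF W], rule fs.subspace_scale[OF W]) (use b B(2) in \<open>auto simp: bij_betw_def\<close>)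
  have ker: "c = 0" if c: "c \<in> V" "P c = 0" for c
  proof
    fix k
    define u where "u v = c (the_inv_into {..<r} b v)" for v
    have inj: "inj_on b {..<r}" and im: "b ` {..<r} = B" using b by (auto simp: bij_betw_def)
    have "(\<Sum>v\<in>B. (\<lambda>i. u v * v i)) = P c"
      unfolding P_def im[symmetric] sum.reindex[OF inj]
      by (rule sum.cong) (auto simp: u_def the_inv_into_f_f[OF inj])
    hence "\<forall>v\<in>B. u v = 0" using fs.independentD[OF B(3,1) subset_refl, of u] c(2) by simp
    hence "c k = 0" if "k < r" for k
      using that im u_def the_inv_into_f_f[OF inj, of k] by force
    thus "c k = 0 k" using c(1) by (auto simp: V_def)
  qed
  have "inj_on P V"
  proof (rule inj_onI)
    fix x y assume xy: "x \<in> V" "y \<in> V" "P x = P y"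
    hence "x - y = 0" using ker[of "x - y"] fs.subspace_diff[OF V] by (simp add: P.diff)
    thus "x = y" by simp
  qed
  then obtain Q where Q: "Q ` UNIV \<subseteq> V" "flinear Q" "\<forall>v\<in>V. Q (P v) = v"
    using fsp.linear_exists_left_inverse_on[OF P V] by blast
  show thesis
  proof (rule that[OF P Q(2)])
    show "P c \<in> W \<and> Q (P c) = c" if "\<And>k. k \<ge> fs.dim W \<Longrightarrow> c k = 0" for c
      using that PW Q(3) unfolding V_def r_def by (auto simp: not_le[symmetric])
    show "P (Q w) = w" if w: "w \<in> W" for w
    proof -
      have "w \<in> fs.span B" using w B(4) by blast
      then obtain u where u: "w = (\<Sum>v\<in>B. (\<lambda>i. u v * v i))"
        by (auto simp: fs.span_finite[OF B(1)])
      have inj: "inj_on b {..<r}" and im: "b ` {..<r} = B" using b by (auto simp: bij_betw_def)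
      define c where "c k = (if k < r then u (b k) else 0)" for k
      have "w = P c" unfolding u P_def im[symmetric] sum.reindex[OF inj]
        by (rule sum.cong) (auto simp: c_def)
      moreover have "c \<in> V" by (auto simp: V_def c_def)
      ultimately show ?thesis using Q(3) by simp
    qed
    show "Q w k = 0" if "k \<ge> fs.dim W" for w k
    proof -
      have "Q w \<in> V" using Q(1) by blast
      thus ?thesis using that unfolding V_def r_def by (auto simp: not_le[symmetric])
    qed
  qed
qed

text \<open>Choosing a basis of each \<open>W i\<close> identifies
  \<open>extend_scalars (W i)\<close> with a free module generated in the single degree
  \<open>e i\<close>. The complex is transported along these isomorphisms, which have constant
  matrices and so preserve degrees and minimality.\<close>

lemma module_of_subspaces:
  fixes W :: "nat \<Rightarrow> ('i::finite \<Rightarrow> 'k::field) set" and e :: "nat \<Rightarrow> int"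
    and D :: "nat \<Rightarrow> ('i \<Rightarrow> ('v::finite, 'k) mpoly) \<Rightarrow> 'i \<Rightarrow> ('v, 'k) mpoly"
  assumes W: "\<And>i. fs.subspace (W i)"
    and add: "\<And>i f g. D i (f + g) = D i f + D i g" and sm: "\<And>i p f. D i (sm p f) = sm p (D i f)"
    and maps: "\<And>i f. f \<in> extend_scalars (W (Suc i)) \<Longrightarrow> D i f \<in> extend_scalars (W i)"
    and hom: "\<And>i f d B. (\<And>C. f C \<in> homog d) \<Longrightarrow> D i f B \<in> homog (d + e (Suc i) - e i)"
    and comp: "\<And>i f. f \<in> extend_scalars (W (Suc (Suc i))) \<Longrightarrow> D i (D (Suc i) f) = 0"
    and exact: "\<And>i f. f \<in> extend_scalars (W (Suc i)) \<Longrightarrow> D i f = 0 \<Longrightarrow>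
      \<exists>g \<in> extend_scalars (W (Suc (Suc i))). D (Suc i) g = f"
    and min: "\<And>i f B. coeff (D i f B) 0 = 0"
  obtains M :: "(('v, 'k) mpoly, (nat \<Rightarrow> ('v, 'k) mpoly) set) gmodule" and F
    where "graded_module M" "minimal_resolution M F"
      "shifts F = (\<lambda>i. replicate (fs.dim (W i)) (e i))"
proof -
  define r where "r i = fs.dim (W i)" for i
  define ds where "ds i = replicate (r i) (e i)" for i
  define C where "C i P Q \<longleftrightarrow> flinear P \<and> flinear Q \<and>
      (\<forall>c. (\<forall>k \<ge> r i. c k = 0) \<longrightarrow> P c \<in> W i \<and> Q (P c) = c) \<and>
      (\<forall>w\<in>W i. P (Q w) = w) \<and> (\<forall>w k. k \<ge> r i \<longrightarrow> Q w k = 0)" for i P Q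
  have "\<exists>P Q. C i P Q" for i
  proof (rule subspace_coordinates[OF W[of i]])
    fix P Q
    assume "flinear P" "flinear Q"
      and "\<And>c. (\<And>k. k \<ge> fs.dim (W i) \<Longrightarrow> c k = 0) \<Longrightarrow> P c \<in> W i \<and> Q (P c) = c"
      and "\<And>w. w \<in> W i \<Longrightarrow> P (Q w) = w" "\<And>w k. k \<ge> fs.dim (W i) \<Longrightarrow> Q w k = 0"
    hence "C i P Q" unfolding C_def r_def by simp
    thus "\<exists>P Q. C i P Q" by blast
  qed
  then obtain P Q where C: "\<And>i. C i (P i) (Q i)" by metis
  have PQ: "\<And>i. flinear (P i)" "\<And>i. flinear (Q i)"
    "\<And>i c. (\<forall>k \<ge> r i. c k = 0) \<Longrightarrow> P i c \<in> W i \<and> Q i (P i c) = c"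
    "\<And>i w. w \<in> W i \<Longrightarrow> P i (Q i w) = w" "\<And>i w k. k \<ge> r i \<Longrightarrow> Q i w k = 0"
    using C unfolding C_def by blast+
  define p :: "nat \<Rightarrow> (nat \<Rightarrow> ('v, 'k) mpoly) \<Rightarrow> 'i \<Rightarrow> ('v, 'k) mpoly"
    where "p i = extend_map {..<r i} (P i)" for i
  define q :: "nat \<Rightarrow> ('i \<Rightarrow> ('v, 'k) mpoly) \<Rightarrow> nat \<Rightarrow> ('v, 'k) mpoly"
    where "q i = extend_map UNIV (Q i)" for i
  have car: "c \<in> vecs (ds i) \<longleftrightarrow> (\<forall>k\<ge>r i. c k = 0)" for c :: "nat \<Rightarrow> ('v, 'k) mpoly" and i
    by (simp add: carrier_gfree ds_def)
  have slp: "slice m (p i c) = P i (slice m c)" if "c \<in> vecs (ds i)" for i c m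
    unfolding p_def by (rule slice_extend_map[OF PQ(1)]) (use that car in auto)
  have slq: "slice m (q i f) = Q i (slice m f)" for i f m
    unfolding q_def by (rule slice_extend_map[OF PQ(2)]) auto
  have pS: "p i c \<in> extend_scalars (W i)" and qp: "q i (p i c) = c" if c: "c \<in> vecs (ds i)" for i c
  proof -
    have *: "P i (slice m c) \<in> W i \<and> Q i (P i (slice m c)) = slice m c" for m
      by (rule PQ(3)) (use c car in \<open>auto simp: slice_def\<close>)
    show "p i c \<in> extend_scalars (W i)" using * by (simp add: extend_scalars_def slp[OF c])
    show "q i (p i c) = c" by (rule slice_eqI) (simp add: slq slp[OF c] *)
  qed
  have qc: "q i f \<in> vecs (ds i)" for i f
  proof -
    have "q i f k = 0" if "k \<ge> r i" for k
      unfolding q_def extend_map_def using PQ(5)[OF that] by simp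
    thus ?thesis using car by blast
  qed
  have pq: "p i (q i f) = f" if f: "f \<in> extend_scalars (W i)" for i f
    by (rule slice_eqI) (use f in \<open>simp add: slp[OF qc] slq PQ(4) extend_scalars_def\<close>)
  define d where "d i x = q i (D i (p (Suc i) x))" for i x
  have dadd: "d i (x + y) = d i x + d i y" and dsm: "d i (sm t x) = sm t (d i x)" for i x y t
    by (simp_all add: d_def p_def q_def extend_map_add extend_map_sm add sm)
  have "free_hom (ds (Suc i)) (ds i) (d i)" for i
  proof (rule gfree_homI)
    fix j and x :: "nat \<Rightarrow> ('v, 'k) mpoly" assume x: "x \<in> grade (gfree (ds (Suc i))) j"
    have "x k \<in> homog (j - e (Suc i))" for k
      using x by (cases "k < r (Suc i)") (auto simp: grade_gfree carrier_gfree ds_def)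
    hence "p (Suc i) x B \<in> homog (j - e (Suc i))" for B
      unfolding p_def by (rule extend_map_homog)
    hence "D i (p (Suc i) x) B \<in> homog (j - e (Suc i) + e (Suc i) - e i)" for B by (rule hom)
    hence "D i (p (Suc i) x) B \<in> homog (j - e i)" for B by simp
    hence "d i x k \<in> homog (j - e i)" for k unfolding d_def q_def by (rule extend_map_homog)
    moreover have "d i x \<in> vecs (ds i)" unfolding d_def by (rule qc)
    ultimately show "d i x \<in> grade (gfree (ds i)) j" by (simp add: grade_gfree ds_def)
  qed (simp_all only: dadd dsm, simp add: d_def qc)
  moreover have "d (Suc i) ` vecs (ds (Suc (Suc i))) = {x \<in> vecs (ds (Suc i)). d i x = 0}" for i
  proof (intro equalityI subsetI)
    fix x assume "x \<in> d (Suc i) ` vecs (ds (Suc (Suc i)))"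
    then obtain y where y: "x = d (Suc i) y" "y \<in> vecs (ds (Suc (Suc i)))" by blast
    have "p (Suc i) x = D (Suc i) (p (Suc (Suc i)) y)"
      unfolding y(1) d_def by (rule pq[OF maps[OF pS[OF y(2)]]])
    hence "d i x = 0" using comp[OF pS[OF y(2)]] by (simp add: d_def q_def)
    thus "x \<in> {x \<in> vecs (ds (Suc i)). d i x = 0}" using qc unfolding y(1) d_def by simp
  next
    fix x assume "x \<in> {x \<in> vecs (ds (Suc i)). d i x = 0}"
    hence x: "x \<in> vecs (ds (Suc i))" "d i x = 0" by auto
    have "D i (p (Suc i) x) = p i (d i x)" unfolding d_def by (rule pq[OF maps[OF pS[OF x(1)]], symmetric])
    hence "D i (p (Suc i) x) = 0" unfolding x(2) p_def by simp
    then obtain g where g: "g \<in> extend_scalars (W (Suc (Suc i)))" "D (Suc i) g = p (Suc i) x"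
      using exact[OF pS[OF x(1)]] by blast
    have "d (Suc i) (q (Suc (Suc i)) g) = x" unfolding d_def pq[OF g(1)] g(2) by (rule qp[OF x(1)])
    thus "x \<in> d (Suc i) ` vecs (ds (Suc (Suc i)))" using qc by blast
  qed
  moreover have "coeff (d i x k) 0 = 0" for i x k
    unfolding d_def q_def by (rule extend_map_cst_0) (rule min)
  ultimately obtain M :: "(('v, 'k) mpoly, (nat \<Rightarrow> ('v, 'k) mpoly) set) gmodule" and F
    where "graded_module M" "minimal_resolution M F" "shifts F = ds"
    by (rule module_of_exact_sequence[of ds d]) blast+
  moreover have "ds = (\<lambda>i. replicate (fs.dim (W i)) (e i))" by (simp add: fun_eq_iff ds_def r_def)
  ultimately show thesis using that[of M F] by simp
qed

subsection \<open>The Koszul complex\<close>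

text \<open>The sign for moving the factor a to its place in the ordered wedge product over B. The
  target ring is arbitrary because the sign is needed both in S and in K.\<close>

definition sgn_at :: "('v \<Rightarrow> nat) \<Rightarrow> 'v set \<Rightarrow> 'v \<Rightarrow> 'a::comm_ring_1" where
  "sgn_at idx B a = (- 1) ^ card {b \<in> B. idx b < idx a}"

lemma sgn_at_square: "sgn_at idx B a * sgn_at idx B a = 1"
  by (simp add: sgn_at_def power_mult_distrib[symmetric])

lemma sgn_at_insert:
  fixes B :: "'v::finite set"
  assumes "c \<notin> B"
  shows "sgn_at idx (insert c B) a = (if idx c < idx a then - sgn_at idx B a else sgn_at idx B a)"
proof -
  have "{b \<in> insert c B. idx b < idx a} =
      (if idx c < idx a then insert c {b \<in> B. idx b < idx a} else {b \<in> B. idx b < idx a})" by auto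
  thus ?thesis using assms by (simp add: sgn_at_def)
qed

text \<open>Exactly one of a and c precedes the other, so exactly one of the two insertions changes
  a sign. This anticommutation yields both the square-zero property and the contraction of the
  Koszul complex.\<close>

lemma sgn_at_swap:
  fixes B :: "'v::finite set"
  assumes "inj idx" "a \<noteq> c" "a \<notin> B" "c \<notin> B"
  shows "sgn_at idx B a * sgn_at idx (insert a B) c = - (sgn_at idx B c * sgn_at idx (insert c B) a)"
proof -
  have "idx a < idx c \<longleftrightarrow> \<not> idx c < idx a" using assms(1,2) by (metis injD linorder_neqE_nat not_less_iff_gr_or_eq)
  thus ?thesis using assms by (simp add: sgn_at_insert mult.commute)
qed

definition X_var :: "'v \<Rightarrow> ('v, 'k::field) mpoly" where
  "X_var a = monom (monom a 1) 1"

lemma X_var_homog: "X_var (a :: 'v::finite) \<in> homog 1"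
proof -
  have "mdeg (monom a 1) = 1"
    by (simp add: mdeg_def lookup_single when_def)
  thus ?thesis using homog_single[of "monom a 1"] by (simp add: X_var_def)
qed

lemma lookup_X_var_mult:
  "coeff (X_var a * p) m =
    (if coeff m a > 0 then coeff p (m - monom a 1) else 0)"
proof (cases "coeff m a > 0")
  case True
  have "m = monom a 1 + (m - monom a 1)"
    using True by (intro poly_mapping_eqI) (auto simp: lookup_add lookup_minus lookup_single when_def)
  thus ?thesis using True lookup_monom_mult[of "monom a 1" p "m - monom a 1"]
    by (simp add: X_var_def)
next
  case False
  hence "\<nexists>s. m = monom a 1 + s" by (auto simp: lookup_add)
  thus ?thesis using False lookup_monom_mult_not[of m "monom a 1" 1 p] by (simp add: X_var_def)
qed

lemma lookup_X_var_0: "coeff (X_var a) 0 = 0"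
  using lookup_X_var_mult[of a 1 0] by simp

text \<open>
  The exterior power \<open>\<And>\<^sup>k\<close> of the space with basis \<open>'v\<close> is modelled by the functions on \<open>'v set\<close> supported
  on sets with \<open>k\<close> elements (with coefficients in \<open>K\<close> or in \<open>S\<close>). The function \<open>idx\<close> orders the basis
  and thus fixes the signs.
\<close>

definition ext_power :: "int \<Rightarrow> ('v set \<Rightarrow> 'b::zero) set" where
  "ext_power k = {f. \<forall>B. f B \<noteq> 0 \<longrightarrow> int (card B) = k}"

text \<open>Interior multiplication by the vector of variables, written from the side of the target:
  the basis element of B is reached from those of the sets with one more element.\<close>

definition koszul :: "('v::finite \<Rightarrow> nat) \<Rightarrow> ('v set \<Rightarrow> ('v, 'k::field) mpoly) \<Rightarrow> 'v set \<Rightarrow> ('v, 'k) mpoly" where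
  "koszul idx f = (\<lambda>B. \<Sum>a\<in>- B. sgn_at idx B a * X_var a * f (insert a B))"

lemma koszul_add: "koszul idx (f + g) = koszul idx f + koszul idx g"
  and koszul_diff: "koszul idx (f - g) = koszul idx f - koszul idx g"
  and koszul_sm: "koszul idx (sm p f) = sm p (koszul idx f)"
  and koszul_0 [simp]: "koszul idx 0 = 0"
  by (auto simp: koszul_def fun_eq_iff algebra_simps sum.distrib sum_subtractf sum_distrib_left)

lemma koszul_homog:
  fixes f :: "'v::finite set \<Rightarrow> ('v, 'k::field) mpoly"
  assumes "\<And>C. f C \<in> homog d"
  shows "koszul idx f B \<in> homog (d + 1)"
proof -
  have "sgn_at idx B a * X_var a * f C \<in> homog (d + 1)" for a C
  proof -
    have "(sgn_at idx B a :: ('v, 'k) mpoly) \<in> homog 0"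
      unfolding sgn_at_def by (cases "even (card {b \<in> B. idx b < idx a})") (auto intro: homog_uminus)
    from homog_mult[OF homog_mult[OF this X_var_homog[of a]] assms[of C]]
    show ?thesis by (simp add: add.commute)
  qed
  thus ?thesis unfolding koszul_def by (intro homog_sum)
qed

lemma koszul_cst_0: "coeff (koszul idx f B) 0 = 0"
  by (simp add: koszul_def lookup_sum lookup_mult_0 lookup_X_var_0)

lemma koszul_ext_power:
  assumes "f \<in> ext_power (k + 1)"
  shows "koszul idx f \<in> ext_power k"
  unfolding ext_power_def
proof (intro CollectI allI impI, rule ccontr)
  fix B assume B: "koszul idx f B \<noteq> 0" "int (card B) \<noteq> k"
  have "f (insert a B) = 0" if "a \<in> - B" for a
    using assms B(2) that by (auto simp: ext_power_def)
  hence "koszul idx f B = 0" by (simp add: koszul_def)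
  thus False using B(1) by simp
qed

text \<open>Removing a and then c cancels against removing c and then a; the pairs are split by the
  order of their indices.\<close>

lemma koszul_koszul:
  fixes f :: "'v::finite set \<Rightarrow> ('v, 'k::field) mpoly"
  assumes idx: "inj idx"
  shows "koszul idx (koszul idx f) = 0"
proof
  fix B
  let ?T = "\<lambda>a c. sgn_at idx B a * X_var a * (sgn_at idx (insert a B) c * X_var c * f (insert c (insert a B)))"
  define P1 :: "('v \<times> 'v) set" where "P1 = {(a, c). a \<notin> B \<and> c \<notin> B \<and> idx a < idx c}"
  define P2 :: "('v \<times> 'v) set" where "P2 = {(a, c). a \<notin> B \<and> c \<notin> B \<and> idx c < idx a}"
  have swap: "?T a c = - ?T c a" if "a \<notin> B" "c \<notin> B" "a \<noteq> c" for a c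
  proof -
    have "?T a c = (sgn_at idx B a * sgn_at idx (insert a B) c) * (X_var a * X_var c * f (insert c (insert a B)))"
      by (simp add: mult_ac)
    also have "\<dots> = - ((sgn_at idx B c * sgn_at idx (insert c B) a) * (X_var a * X_var c * f (insert c (insert a B))))"
      using sgn_at_swap[OF idx that(3,1,2)] by (metis mult_minus_left)
    also have "\<dots> = - ?T c a" by (simp add: mult_ac insert_commute)
    finally show ?thesis .
  qed
  have "koszul idx (koszul idx f) B = (\<Sum>a\<in>- B. \<Sum>c\<in>- insert a B. ?T a c)"
    by (simp add: koszul_def sum_distrib_left)
  also have "\<dots> = (\<Sum>(a, c)\<in>Sigma (- B) (\<lambda>a. - insert a B). ?T a c)"
    by (rule sum.Sigma) auto
  also have "Sigma (- B) (\<lambda>a. - insert a B) = P1 \<union> P2"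
  proof (rule Set.set_eqI)
    fix x
    obtain a c :: 'v where x: "x = (a, c)" by (cases x)
    have "c \<noteq> a \<longleftrightarrow> idx a < idx c \<or> idx c < idx a" using inj_eq[OF idx, of a c] nat_neq_iff[of "idx a" "idx c"] by blast
    thus "x \<in> Sigma (- B) (\<lambda>a. - insert a B) \<longleftrightarrow> x \<in> P1 \<union> P2" unfolding x P1_def P2_def by blast
  qed
  also have "(\<Sum>(a, c)\<in>P1 \<union> P2. ?T a c) = (\<Sum>(a, c)\<in>P1. ?T a c) + (\<Sum>(a, c)\<in>P2. ?T a c)"
    by (rule sum.union_disjoint) (auto simp: P1_def P2_def)
  also have "(\<Sum>(a, c)\<in>P2. ?T a c) = (\<Sum>(a, c)\<in>P1. ?T c a)"
    by (rule sum.reindex_bij_witness[of _ "\<lambda>(a, c). (c, a)" "\<lambda>(a, c). (c, a)"]) (auto simp: P1_def P2_def)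
  also have "(\<Sum>(a, c)\<in>P1. ?T a c) + (\<Sum>(a, c)\<in>P1. ?T c a) = (\<Sum>(a, c)\<in>P1. ?T a c + ?T c a)"
    by (simp add: sum.distrib[symmetric] case_prod_beta)
  also have "\<dots> = 0"
  proof (rule sum.neutral, clarify)
    fix a c assume "(a, c) \<in> P1"
    hence "?T a c = - ?T c a" by (intro swap) (auto simp: P1_def)
    thus "?T a c + ?T c a = 0" by simp
  qed
  finally show "koszul idx (koszul idx f) B = 0 B" by simp
qed

text \<open>
  The Koszul complex is multigraded, the coefficient of the monomial \<open>m\<close> at the set \<open>B\<close> having multidegree
  \<open>m + 1\<^sub>B\<close>. In a multidegree \<open>u \<noteq> 0\<close> it is the chain complex of the full simplex on the support of \<open>u\<close>,
  which is contracted by the cone construction from a vertex \<open>c u\<close> of this simplex.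
\<close>

definition set_mon :: "'v::finite set \<Rightarrow> 'v \<Rightarrow>\<^sub>0 nat" where
  "set_mon B = (\<Sum>b\<in>B. monom b 1)"

lemma lookup_set_mon: "coeff (set_mon B) a = (if a \<in> B then 1 else 0)"
  by (simp add: set_mon_def lookup_sum lookup_single when_def)

lemma koszul_exact:
  fixes f :: "'v::finite set \<Rightarrow> ('v, 'k::field) mpoly"
  assumes idx: "inj idx" and f: "f \<in> ext_power k" and k: "k \<ge> 1" and df: "koszul idx f = 0"
  obtains g where "g \<in> ext_power (k + 1)" "koszul idx g = f"
proof -
  \<comment> \<open>In multidegree 0 this choice is meaningless; that case is excluded below through
    \<open>k \<ge> 1\<close>.\<close>
  define c where "c u = (SOME a. coeff u a > 0)" for u :: "'v \<Rightarrow>\<^sub>0 nat"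
  have c: "coeff u (c u) > 0" if "coeff u a > 0" for u a
    unfolding c_def using that by (rule someI)
  let ?e = "\<lambda>a. monom a (1::nat)"
  \<comment> \<open>The cone from the vertex a: the coefficient at B comes from the face without a,
    and the monomial is multiplied by the variable of a, so that the multidegree stays the
    same.\<close>
  define G where "G B m = (let a = c (m + set_mon B) in
      if a \<in> B then sgn_at idx (B - {a}) a * coeff (f (B - {a})) (m + ?e a) else 0)" for B m
  \<comment> \<open>The vertex varies with m, but only finitely many vertices exist, each
    contributing shifted monomials of one polynomial.\<close>
  have fin: "finite {m. G B m \<noteq> 0}" for B
  proof (rule finite_subset)
    show "{m. G B m \<noteq> 0} \<subseteq> (\<Union>a. (\<lambda>m. m - ?e a) ` Poly_Mapping.keys (f (B - {a})))"
    proof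
      fix m assume "m \<in> {m. G B m \<noteq> 0}"
      hence "coeff (f (B - {c (m + set_mon B)})) (m + ?e (c (m + set_mon B))) \<noteq> 0"
        by (auto simp: G_def Let_def split: if_splits)
      thus "m \<in> (\<Union>a. (\<lambda>m. m - ?e a) ` Poly_Mapping.keys (f (B - {a})))"
        by (intro UN_I[of "c (m + set_mon B)"] image_eqI[of _ _ "m + ?e (c (m + set_mon B))"]) (auto simp: in_keys_iff)
    qed
  qed auto
  define g where "g B = Abs_poly_mapping (G B)" for B
  have g: "coeff (g B) m = G B m" for B m
    unfolding g_def by (simp add: fin)
  have gk: "g \<in> ext_power (k + 1)"
    unfolding ext_power_def
  proof (intro CollectI allI impI)
    fix B assume "g B \<noteq> 0"
    then obtain m where "G B m \<noteq> 0" using g by (metis lookup_zero poly_mapping_eqI)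
    hence "c (m + set_mon B) \<in> B" "f (B - {c (m + set_mon B)}) \<noteq> 0"
      by (auto simp: G_def Let_def split: if_splits)
    hence "int (card (B - {c (m + set_mon B)})) = k" "card B = Suc (card (B - {c (m + set_mon B)}))"
      using f unfolding ext_power_def by (blast, intro card.remove finite)
    thus "int (card B) = k + 1" by simp
  qed
  have sgl: "coeff (sgn_at idx B a * p) m = sgn_at idx B a * coeff p m"
    for B a m and p :: "('v, 'k) mpoly"
    by (cases "even (card {b \<in> B. idx b < idx a})") (auto simp: sgn_at_def)
  have kl: "coeff (koszul idx h B) m =
      (\<Sum>a\<in>{a. a \<notin> B \<and> coeff m a > 0}.
        sgn_at idx B a * coeff (h (insert a B)) (m - ?e a))"
    for h :: "'v set \<Rightarrow> ('v, 'k) mpoly" and B m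
  proof -
    have "coeff (koszul idx h B) m = (\<Sum>a\<in>- B. sgn_at idx B a *
        (if coeff m a > 0 then coeff (h (insert a B)) (m - ?e a) else 0))"
      by (simp add: koszul_def lookup_sum mult.assoc sgl lookup_X_var_mult)
    also have "\<dots> = (\<Sum>a\<in>{a. a \<notin> B \<and> coeff m a > 0}.
        sgn_at idx B a * coeff (h (insert a B)) (m - ?e a))"
      by (rule sum.mono_neutral_cong_right) auto
    finally show ?thesis .
  qed
  have "coeff (koszul idx g B) m = coeff (f B) m" for B m
  proof -
    define u where "u = m + set_mon B"
    define A where "A = {a. a \<notin> B \<and> coeff m a > 0}"
    \<comment> \<open>All terms of the boundary at B and m share one multidegree u, hence are coned
      from the same vertex.\<close>
    have u: "m - ?e a + set_mon (insert a B) = u" if "a \<in> A" for a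
      using that unfolding u_def A_def
      by (intro poly_mapping_eqI) (auto simp: lookup_add lookup_minus lookup_set_mon lookup_single when_def)
    have 1: "coeff (koszul idx g B) m = (\<Sum>a\<in>A. sgn_at idx B a *
        (if c u \<in> insert a B then sgn_at idx (insert a B - {c u}) (c u) *
          coeff (f (insert a B - {c u})) (m - ?e a + ?e (c u)) else 0))"
      unfolding kl A_def[symmetric]
    proof (rule sum.cong)
      fix a assume "a \<in> A"
      hence "G (insert a B) (m - ?e a) = (if c u \<in> insert a B then sgn_at idx (insert a B - {c u}) (c u) *
          coeff (f (insert a B - {c u})) (m - ?e a + ?e (c u)) else 0)"
        unfolding G_def Let_def by (simp only: u)
      thus "sgn_at idx B a * coeff (g (insert a B)) (m - ?e a) = sgn_at idx B a *
        (if c u \<in> insert a B then sgn_at idx (insert a B - {c u}) (c u) *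
          coeff (f (insert a B - {c u})) (m - ?e a + ?e (c u)) else 0)"
        by (simp only: g)
    qed simp
    show ?thesis
    proof (cases "\<exists>a. coeff u a > 0")
      case False
      hence "A = {}" "B = {}"
        by (auto simp: A_def u_def lookup_add lookup_set_mon split: if_splits)
      \<comment> \<open>Only multidegree 0 has homology, in exterior degree 0, and f has degree
        \<open>k \<ge> 1\<close>.\<close>
      moreover have "f {} = 0" using f k by (auto simp: ext_power_def)
      ultimately show ?thesis unfolding 1 by simp
    next
      case True
      hence pos: "coeff u (c u) > 0" using c by blast
      define a0 where "a0 = c u"
      show ?thesis
      proof (cases "a0 \<in> B")
        case False
        hence mpos: "coeff m a0 > 0"
          using pos by (simp add: u_def[symmetric] a0_def) (simp add: u_def lookup_add lookup_set_mon a0_def)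
        have m: "m - ?e a0 + ?e a0 = m"
          using mpos by (intro poly_mapping_eqI) (auto simp: lookup_add lookup_minus lookup_single when_def)
        \<comment> \<open>As \<open>a0\<close> is not in B, the cone has a nonzero coefficient at
          \<open>insert a B\<close> only if a = \<open>a0\<close>; that term returns f at B.\<close>
        have "coeff (koszul idx g B) m = (\<Sum>a\<in>A. if a = a0 then coeff (f B) m else 0)"
          unfolding 1 a0_def[symmetric]
        proof (rule sum.cong)
          fix a assume "a \<in> A"
          show "sgn_at idx B a * (if a0 \<in> insert a B then sgn_at idx (insert a B - {a0}) a0 *
              coeff (f (insert a B - {a0})) (m - ?e a + ?e a0) else 0) =
            (if a = a0 then coeff (f B) m else 0)"
          proof (cases "a = a0")
            case True
            have "insert a0 B - {a0} = B" using False by auto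
            thus ?thesis using True m by (simp only: if_True insert_iff simp_thms mult.assoc[symmetric] sgn_at_square mult_1)
          qed (use False in simp)
        qed simp
        thus ?thesis using False mpos by (simp add: A_def)
      next
        case True
        \<comment> \<open>The cycle condition for f is read off at the face \<open>B'\<close> and
          the monomial m times the variable of \<open>a0\<close>. Its term for \<open>a0\<close> is
          the wanted coefficient of f at B; by \<open>sgn_at_swap\<close> the others add up to the
          boundary of the cone.\<close>
        define B' where "B' = B - {a0}"
        have B: "B = insert a0 B'" "a0 \<notin> B'" using True by (auto simp: B'_def)
        have a0A: "a0 \<notin> A" using True by (simp add: A_def)
        let ?F = "\<lambda>a. coeff (f (insert a B')) (m + ?e a0 - ?e a)"
        have A': "{a. a \<notin> B' \<and> coeff (m + ?e a0) a > 0} = insert a0 A"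
          using B by (auto simp: A_def lookup_add lookup_single when_def split: if_splits)
        have "0 = coeff (koszul idx f B') (m + ?e a0)" using df by simp
        also have "\<dots> = (\<Sum>a\<in>insert a0 A. sgn_at idx B' a * ?F a)" unfolding kl A' ..
        also have "\<dots> = sgn_at idx B' a0 * coeff (f B) m + (\<Sum>a\<in>A. sgn_at idx B' a * ?F a)"
          using a0A B by simp
        finally have 2: "sgn_at idx B' a0 * coeff (f B) m = - (\<Sum>a\<in>A. sgn_at idx B' a * ?F a)"
          by (simp add: eq_neg_iff_add_eq_0)
        have "coeff (koszul idx g B) m = (\<Sum>a\<in>A. - (sgn_at idx B' a0 * (sgn_at idx B' a * ?F a)))"
          unfolding 1 a0_def[symmetric]
        proof (rule sum.cong)
          fix a assume a: "a \<in> A"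
          have ne: "a \<noteq> a0" "a \<notin> B'" using a a0A B by (auto simp: A_def)
          have e: "insert a B - {a0} = insert a B'" using ne B by auto
          have m: "m - ?e a + ?e a0 = m + ?e a0 - ?e a"
            using a by (intro poly_mapping_eqI) (auto simp: lookup_add lookup_minus lookup_single when_def A_def)
          let ?s0 = "sgn_at idx B' a0 :: 'k" and ?s1 = "sgn_at idx B a :: 'k"
            and ?t0 = "sgn_at idx B' a :: 'k" and ?t1 = "sgn_at idx (insert a B') a0 :: 'k"
          have sw: "?s0 * ?s1 = - (?t0 * ?t1)"
            using sgn_at_swap[OF idx ne(1)[symmetric] B(2) ne(2)] B(1) by simp
          have "?s1 * ?t1 = ?s0 * ?s0 * (?s1 * ?t1)" by (simp add: sgn_at_square)
          also have "\<dots> = ?s0 * (?s0 * ?s1) * ?t1" by (simp only: mult_ac)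
          also have "\<dots> = - (?s0 * ?t0 * (?t1 * ?t1))" unfolding sw by (simp add: mult_ac)
          also have "\<dots> = - (?s0 * ?t0)" by (simp add: sgn_at_square)
          finally have st: "?s1 * ?t1 = - (?s0 * ?t0)" .
          show "?s1 * (if a0 \<in> insert a B then sgn_at idx (insert a B - {a0}) a0 *
              coeff (f (insert a B - {a0})) (m - ?e a + ?e a0) else 0) =
            - (?s0 * (?t0 * ?F a))"
            using True st unfolding e m by (simp add: mult.assoc[symmetric])
        qed simp
        also have "\<dots> = sgn_at idx B' a0 * (sgn_at idx B' a0 * coeff (f B) m)"
          unfolding 2 by (simp add: sum_negf sum_distrib_left)
        also have "\<dots> = coeff (f B) m" by (simp add: mult.assoc[symmetric] sgn_at_square)
        finally show ?thesis .
      qed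
    qed
  qed
  hence "koszul idx g = f" by (intro ext poly_mapping_eqI)
  thus thesis using that gk by blast
qed

subsection \<open>Hard Lefschetz\<close>

text \<open>
  Contraction with the symplectic form and multiplication by its dual, \<open>Pr\<close> being the set of pairs of a
  symplectic basis. No signs occur because the two elements of a pair will be adjacent in the order of the
  basis.
\<close>

definition lower :: "'v set set \<Rightarrow> ('v set \<Rightarrow> 'b::comm_monoid_add) \<Rightarrow> 'v set \<Rightarrow> 'b" where
  "lower Pr f = (\<lambda>B. \<Sum>p\<in>{p \<in> Pr. p \<inter> B = {}}. f (B \<union> p))"

definition raise :: "'v set set \<Rightarrow> ('v set \<Rightarrow> 'b::comm_monoid_add) \<Rightarrow> 'v set \<Rightarrow> 'b" where
  "raise Pr f = (\<lambda>B. \<Sum>p\<in>{p \<in> Pr. p \<subseteq> B}. f (B - p))"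

lemma lower_add: "lower Pr (f + g) = lower Pr f + lower Pr g"
  and raise_add: "raise Pr (f + g) = raise Pr f + raise Pr g"
  and lower_0 [simp]: "lower Pr 0 = 0"
  and raise_0 [simp]: "raise Pr 0 = 0"
  by (auto simp: lower_def raise_def fun_eq_iff sum.distrib)

lemma lower_diff: "lower Pr (f - g) = lower Pr f - lower Pr (g :: _ \<Rightarrow> 'b::ab_group_add)"
  by (auto simp: lower_def fun_eq_iff sum_subtractf)

lemma lower_scale: "lower Pr (\<lambda>B. a * f B) = (\<lambda>B. a * lower Pr f B)"
  and raise_scale: "raise Pr (\<lambda>B. a * f B) = (\<lambda>B. a * raise Pr f B)"
  for a :: "'b::comm_ring_1"
  by (auto simp: lower_def raise_def fun_eq_iff sum_distrib_left)

lemma slice_lower: "slice m (lower Pr f) = lower Pr (slice m f)"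
  by (simp add: slice_def lower_def lookup_sum)

lemma lower_sm: "lower Pr (sm p f) = sm p (lower Pr f)"
  by (auto simp: lower_def fun_eq_iff sum_distrib_left)

lemma lower_homog: "(\<And>C. f C \<in> homog d) \<Longrightarrow> lower Pr f B \<in> homog d"
  unfolding lower_def by (rule homog_sum)

lemma lower_cst_0: "(\<And>C. coeff (f C) 0 = 0) \<Longrightarrow> coeff (lower Pr f B) 0 = 0"
  by (simp add: lower_def lookup_sum)

lemma flinear_lower: "flinear (lower Pr)"
  by (rule flinearI) (simp_all only: lower_add lower_scale)

lemma flinear_funpow:
  fixes T :: "('i \<Rightarrow> 'k::field) \<Rightarrow> 'i \<Rightarrow> 'k"
  assumes "flinear T"
  shows "flinear (T ^^ r)"
proof -
  interpret T: Vector_Spaces.linear fscale fscale T by fact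
  have add: "(T ^^ r) (f + g) = (T ^^ r) f + (T ^^ r) g" for f g
    by (induction r) (simp_all only: funpow.simps id_apply o_apply T.add)
  have scale: "(T ^^ r) (\<lambda>k. a * f k) = (\<lambda>k. a * (T ^^ r) f k)" for a f
    by (induction r) (simp_all only: funpow.simps id_apply o_apply T.scale)
  show ?thesis by (rule flinearI) (fact add, fact scale)
qed

lemma ext_power_subspace: "fs.subspace (ext_power k :: ('v set \<Rightarrow> 'k::field) set)"
  unfolding ext_power_def fs.subspace_def by (auto, metis add.right_neutral)

lemma dim_ext_power:
  "int (fs.dim (ext_power k :: ('v::finite set \<Rightarrow> 'k::field) set)) = binom (card (UNIV :: 'v set)) k"
  "ext_power k \<subseteq> fs.span ((\<lambda>a k. if k = a then 1 else 0 :: 'k) ` {B :: 'v set. int (card B) = k})"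
proof -
  let ?A = "{B :: 'v set. int (card B) = k}"
  have eq: "ext_power k = {c :: 'v set \<Rightarrow> 'k. \<forall>B. c B \<noteq> 0 \<longrightarrow> B \<in> ?A}" by (simp add: ext_power_def)
  have fin: "finite ?A" by simp
  have "int (card ?A) = binom (card (UNIV :: 'v set)) k"
  proof (cases "k < 0")
    case True
    hence "?A = {}" by auto
    thus ?thesis using True by (simp add: binom_def)
  next
    case False
    hence "?A = {B. B \<subseteq> UNIV \<and> card B = nat k}" by auto
    thus ?thesis using False n_subsets[of "UNIV :: 'v set" "nat k"] by (simp add: binom_def)
  qed
  thus "int (fs.dim (ext_power k :: ('v set \<Rightarrow> 'k) set)) = binom (card (UNIV :: 'v set)) k"
    using dim_supported(3)[OF fin, where 'k = 'k] by (simp add: eq)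
  show "ext_power k \<subseteq> fs.span ((\<lambda>a k. if k = a then 1 else 0 :: 'k) ` ?A)"
    using dim_supported(2)[OF fin, where 'k = 'k] by (simp add: eq)
qed

lemma ext_power_trivial:
  fixes f :: "'v::finite set \<Rightarrow> 'b::zero"
  assumes "f \<in> ext_power k" "k < 0 \<or> k > int (card (UNIV :: 'v set))"
  shows "f B = 0"
proof (rule ccontr)
  assume "f B \<noteq> 0"
  hence "int (card B) = k" using assms(1) by (simp add: ext_power_def)
  moreover have "card B \<le> card (UNIV :: 'v set)" by (rule card_mono) auto
  ultimately show False using assms(2) by linarith
qed

lemma slice_ext_power: "f \<in> ext_power k \<longleftrightarrow> (\<forall>m. slice m f \<in> ext_power k)"
proof
  assume "\<forall>m. slice m f \<in> ext_power k"
  hence *: "coeff (f B) m \<noteq> 0 \<Longrightarrow> int (card B) = k" for B m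
    by (auto simp: ext_power_def slice_def)
  show "f \<in> ext_power k" unfolding ext_power_def
  proof (intro CollectI allI impI)
    fix B assume "f B \<noteq> 0"
    then obtain m where "coeff (f B) m \<noteq> 0" using poly_mapping_eqI[of "f B" 0] by auto
    thus "int (card B) = k" by (rule *)
  qed
next
  assume f: "f \<in> ext_power k"
  have "f B \<noteq> 0" if "coeff (f B) m \<noteq> 0" for B m using that by auto
  thus "\<forall>m. slice m f \<in> ext_power k" using f by (simp add: ext_power_def slice_def)
qed

lemma lower_ext_power:
  fixes Pr :: "'v::finite set set"
  assumes card2: "\<And>p. p \<in> Pr \<Longrightarrow> card p = 2" and f: "f \<in> ext_power k"
  shows "lower Pr f \<in> ext_power (k - 2)" "raise Pr f \<in> ext_power (k + 2)"
proof -
  show "lower Pr f \<in> ext_power (k - 2)" unfolding ext_power_def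
  proof (intro CollectI allI impI, rule ccontr)
    fix B assume "lower Pr f B \<noteq> 0" "int (card B) \<noteq> k - 2"
    moreover have "f (B \<union> p) = 0" if "p \<in> Pr" "p \<inter> B = {}" "int (card B) \<noteq> k - 2" for p
    proof -
      have "card (B \<union> p) = card B + 2" using that card2[of p] by (subst card_Un_disjoint) auto
      thus ?thesis using f that(3) by (auto simp: ext_power_def)
    qed
    ultimately show False by (simp add: lower_def)
  qed
  show "raise Pr f \<in> ext_power (k + 2)" unfolding ext_power_def
  proof (intro CollectI allI impI, rule ccontr)
    fix B assume "raise Pr f B \<noteq> 0" "int (card B) \<noteq> k + 2"
    moreover have "f (B - p) = 0" if "p \<in> Pr" "p \<subseteq> B" "int (card B) \<noteq> k + 2" for p
    proof -
      have "card B = card (B - p) + 2"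
        using that card2[of p] card_mono[of B p] by (subst card_Diff_subset) auto
      thus ?thesis using f that(3) by (auto simp: ext_power_def)
    qed
    ultimately show False by (simp add: raise_def)
  qed
qed

text \<open>Adjacency of the two elements of a pair is stated as the parity condition that the signs
  require: every outside element has an even number of elements of the pair before it.\<close>

locale symplectic_basis =
  fixes idx :: "'v::finite \<Rightarrow> nat" and Pr :: "'v set set"
  assumes idx: "inj idx" and cover: "\<Union> Pr = UNIV"
    and disjoint: "\<And>p q. p \<in> Pr \<Longrightarrow> q \<in> Pr \<Longrightarrow> p \<noteq> q \<Longrightarrow> p \<inter> q = {}"
    and card2: "\<And>p. p \<in> Pr \<Longrightarrow> card p = 2"
    and adjacent: "\<And>p a. p \<in> Pr \<Longrightarrow> a \<notin> p \<Longrightarrow> even (card {b \<in> p. idx b < idx a})"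
begin

abbreviation \<Lambda> :: "('v set \<Rightarrow> 'b::comm_monoid_add) \<Rightarrow> 'v set \<Rightarrow> 'b" where "\<Lambda> \<equiv> lower Pr"
abbreviation L :: "('v set \<Rightarrow> 'b::comm_monoid_add) \<Rightarrow> 'v set \<Rightarrow> 'b" where "L \<equiv> raise Pr"
abbreviation boundary :: "('v set \<Rightarrow> ('v, 'k::field) mpoly) \<Rightarrow> 'v set \<Rightarrow> ('v, 'k) mpoly" (\<open>\<partial>\<close>) where "\<partial> \<equiv> koszul idx"
abbreviation n :: int where "n \<equiv> int (card Pr)"

lemma card_UNIV: "card (UNIV :: 'v set) = 2 * card Pr"
proof -
  have "card (\<Union> Pr) = sum card Pr"
    by (rule card_Union_disjoint) (use disjoint in \<open>auto simp: pairwise_def disjnt_def\<close>)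
  thus ?thesis using cover card2 by simp
qed

text \<open>By adjacency, adding a pair to B does not change the sign at an element outside the
  pair. Both sides then sum over the same disjoint choices of a pair and an element.\<close>

lemma lower_koszul: "\<Lambda> (\<partial> f) = \<partial> (\<Lambda> f)"
proof
  fix B
  let ?D = "{p \<in> Pr. p \<inter> B = {}}"
  let ?t = "\<lambda>p a. sgn_at idx B a * X_var a * f (insert a (B \<union> p))"
  have sg: "sgn_at idx (B \<union> p) a = (sgn_at idx B a :: ('v, 'a) mpoly)" if "p \<in> ?D" "a \<notin> p" for p a
  proof -
    have "{b \<in> B \<union> p. idx b < idx a} = {b \<in> B. idx b < idx a} \<union> {b \<in> p. idx b < idx a}" by auto
    hence "card {b \<in> B \<union> p. idx b < idx a} = card {b \<in> B. idx b < idx a} + card {b \<in> p. idx b < idx a}"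
      using that by (simp, subst card_Un_disjoint) auto
    thus ?thesis using adjacent[of p a] that by (simp add: sgn_at_def power_add)
  qed
  have "\<Lambda> (\<partial> f) B = (\<Sum>p\<in>?D. \<Sum>a\<in>- B. if a \<notin> p then ?t p a else 0)"
    unfolding lower_def koszul_def
  proof (rule sum.cong)
    fix p assume p: "p \<in> ?D"
    show "(\<Sum>a\<in>- (B \<union> p). sgn_at idx (B \<union> p) a * X_var a * f (insert a (B \<union> p))) =
        (\<Sum>a\<in>- B. if a \<notin> p then ?t p a else 0)"
      by (rule sum.mono_neutral_cong_left) (use sg[OF p] in auto)
  qed simp
  also have "\<dots> = (\<Sum>a\<in>- B. \<Sum>p\<in>?D. if a \<notin> p then ?t p a else 0)" by (rule sum.swap)
  also have "\<dots> = \<partial> (\<Lambda> f) B"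
    unfolding lower_def koszul_def
  proof (rule sum.cong)
    fix a assume a: "a \<in> - B"
    have "(\<Sum>p\<in>?D. if a \<notin> p then ?t p a else 0) = (\<Sum>p\<in>{p \<in> Pr. p \<inter> insert a B = {}}. ?t p a)"
      by (rule sum.mono_neutral_cong_right) auto
    also have "\<dots> = sgn_at idx B a * X_var a * (\<Sum>p\<in>{p \<in> Pr. p \<inter> insert a B = {}}. f (insert a B \<union> p))"
      by (simp add: sum_distrib_left)
    finally show "(\<Sum>p\<in>?D. if a \<notin> p then ?t p a else 0) =
      sgn_at idx B a * X_var a * (\<Sum>p\<in>{p \<in> Pr. p \<inter> insert a B = {}}. f (insert a B \<union> p))" .
  qed simp
  finally show "\<Lambda> (\<partial> f) B = \<partial> (\<Lambda> f) B" .
qed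

text \<open>The sl_2 commutator. Adding a pair p and removing a different pair q commute; what
  remains are the cases p = q, counted by pairs disjoint from B on one side and by pairs inside B on
  the other.\<close>

lemma lower_raise:
  fixes f :: "'v set \<Rightarrow> 'k::field"
  shows "\<Lambda> (L f) B = L (\<Lambda> f) B + of_int (n - int (card B)) * f B"
proof -
  define D where "D = {p \<in> Pr. p \<inter> B = {}}"
  define S where "S = {p \<in> Pr. p \<subseteq> B}"
  have fin: "finite D" "finite S" by simp_all
  have ne: "p \<noteq> {}" if "p \<in> Pr" for p using card2[OF that] by auto
  have 1: "{q \<in> Pr. q \<subseteq> B \<union> p} = insert p S" "p \<notin> S" if "p \<in> D" for p
    using that disjoint[of _ p] ne[of p] unfolding D_def S_def by blast+
  have 2: "{p \<in> Pr. p \<inter> (B - q) = {}} = insert q D" "q \<notin> D" if "q \<in> S" for q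
    using that disjoint[of _ q] ne[of q] unfolding D_def S_def by blast+
  have "\<Lambda> (L f) B = (\<Sum>p\<in>D. \<Sum>q\<in>insert p S. f (B \<union> p - q))"
    unfolding lower_def raise_def D_def[symmetric] by (rule sum.cong) (simp_all add: 1)
  also have "\<dots> = (\<Sum>p\<in>D. f B + (\<Sum>q\<in>S. f (B \<union> p - q)))"
  proof (rule sum.cong)
    fix p assume p: "p \<in> D"
    hence "B \<union> p - p = B" by (auto simp: D_def)
    thus "(\<Sum>q\<in>insert p S. f (B \<union> p - q)) = f B + (\<Sum>q\<in>S. f (B \<union> p - q))"
      using 1(2)[OF p] fin by simp
  qed simp
  also have "\<dots> = of_nat (card D) * f B + (\<Sum>p\<in>D. \<Sum>q\<in>S. f (B \<union> p - q))" by (simp add: sum.distrib)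
  finally have a: "\<Lambda> (L f) B = of_nat (card D) * f B + (\<Sum>p\<in>D. \<Sum>q\<in>S. f (B \<union> p - q))" .
  have "L (\<Lambda> f) B = (\<Sum>q\<in>S. \<Sum>p\<in>insert q D. f (B - q \<union> p))"
    unfolding lower_def raise_def S_def[symmetric] by (rule sum.cong) (simp_all add: 2)
  also have "\<dots> = (\<Sum>q\<in>S. f B + (\<Sum>p\<in>D. f (B - q \<union> p)))"
  proof (rule sum.cong)
    fix q assume q: "q \<in> S"
    hence "B - q \<union> q = B" by (auto simp: S_def)
    thus "(\<Sum>p\<in>insert q D. f (B - q \<union> p)) = f B + (\<Sum>p\<in>D. f (B - q \<union> p))"
      using 2(2)[OF q] fin by simp
  qed simp
  also have "\<dots> = of_nat (card S) * f B + (\<Sum>q\<in>S. \<Sum>p\<in>D. f (B - q \<union> p))" by (simp add: sum.distrib)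
  also have "(\<Sum>q\<in>S. \<Sum>p\<in>D. f (B - q \<union> p)) = (\<Sum>q\<in>S. \<Sum>p\<in>D. f (B \<union> p - q))"
  proof (intro sum.cong refl)
    fix p q assume "q \<in> S" "p \<in> D"
    hence "B - q \<union> p = B \<union> p - q" by (auto simp: S_def D_def)
    thus "f (B - q \<union> p) = f (B \<union> p - q)" by simp
  qed
  also have "\<dots> = (\<Sum>p\<in>D. \<Sum>q\<in>S. f (B \<union> p - q))" by (rule sum.swap)
  finally have b: "L (\<Lambda> f) B = of_nat (card S) * f B + (\<Sum>p\<in>D. \<Sum>q\<in>S. f (B \<union> p - q))" .
  \<comment> \<open>Each pair contributes 1 minus the number of its elements in B, which is 1, 0 or
    -1.\<close>
  have "int (card D) - int (card S) = n - int (card B)"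
  proof -
    have "B = (\<Union>p\<in>Pr. B \<inter> p)" using cover by auto
    hence "card B = card (\<Union>p\<in>Pr. B \<inter> p)" by simp
    also have "\<dots> = (\<Sum>p\<in>Pr. card (B \<inter> p))"
    proof (rule card_UN_disjoint)
      show "\<forall>p\<in>Pr. \<forall>q\<in>Pr. p \<noteq> q \<longrightarrow> B \<inter> p \<inter> (B \<inter> q) = {}" using disjoint by blast
    qed auto
    finally have "n - int (card B) = (\<Sum>p\<in>Pr. 1 - int (card (B \<inter> p)))" by (simp add: sum_subtractf)
    also have "\<dots> = (\<Sum>p\<in>Pr. (if p \<in> D then 1 else 0) - (if p \<in> S then 1 else 0))"
    proof (rule sum.cong)
      fix p assume p: "p \<in> Pr"
      consider "p \<inter> B = {}" | "p \<subseteq> B" | "p \<inter> B \<noteq> {}" "B \<inter> p \<subset> p" by auto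
      thus "1 - int (card (B \<inter> p)) = (if p \<in> D then 1 else 0) - (if p \<in> S then 1 else 0)"
      proof cases
        case 1
        thus ?thesis using p ne[OF p] by (auto simp: D_def S_def Int_commute)
      next
        case 2
        hence "B \<inter> p = p" by auto
        thus ?thesis using 2 p card2[OF p] ne[OF p] by (auto simp: D_def S_def)
      next
        case 3
        hence "card (B \<inter> p) < 2" "card (B \<inter> p) > 0"
          using psubset_card_mono[of p "B \<inter> p"] card2[OF p] by (auto simp: card_gt_0_iff)
        hence "card (B \<inter> p) = 1" by simp
        thus ?thesis using 3 by (auto simp: D_def S_def)
      qed
    qed simp
    also have "\<dots> = int (card (Pr \<inter> {p. p \<in> D})) - int (card (Pr \<inter> {p. p \<in> S}))"
      by (simp add: sum_subtractf sum.If_cases)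
    also have "Pr \<inter> {p. p \<in> D} = D" by (auto simp: D_def)
    also have "Pr \<inter> {p. p \<in> S} = S" by (auto simp: S_def)
    finally show ?thesis by simp
  qed
  hence "int (card D) = int (card S) + (n - int (card B))" by linarith
  hence "(of_int (int (card D)) :: 'k) = of_int (int (card S) + (n - int (card B)))" by (rule arg_cong)
  hence e: "(of_nat (card D) :: 'k) = of_nat (card S) + of_int (n - int (card B))"
    by (simp only: of_int_add of_int_of_nat_eq)
  show ?thesis unfolding a b e distrib_right by (simp only: add_ac)
qed

lemma lower_raise_ext:
  fixes f :: "'v set \<Rightarrow> 'k::field"
  assumes "f \<in> ext_power k"
  shows "\<Lambda> (L f) = L (\<Lambda> f) + (\<lambda>B. of_int (n - k) * f B)"
proof
  fix B
  show "\<Lambda> (L f) B = (L (\<Lambda> f) + (\<lambda>B. of_int (n - k) * f B)) B"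
    using lower_raise[of f B] assms by (cases "f B = 0") (auto simp: ext_power_def)
qed

lemma lower_pow_ext: "f \<in> ext_power k \<Longrightarrow> (\<Lambda> ^^ r) f \<in> ext_power (k - 2 * int r)"
proof (induction r)
  case (Suc r)
  hence "\<Lambda> ((\<Lambda> ^^ r) f) \<in> ext_power (k - 2 * int r - 2)" using lower_ext_power(1)[OF card2] by blast
  thus ?case by (simp add: algebra_simps)
qed simp

lemma raise_pow_ext: "f \<in> ext_power k \<Longrightarrow> (L ^^ r) f \<in> ext_power (k + 2 * int r)"
proof (induction r)
  case (Suc r)
  hence "L ((L ^^ r) f) \<in> ext_power (k + 2 * int r + 2)" using lower_ext_power(2)[OF card2] by blast
  thus ?case by (simp add: algebra_simps)
qed simp

text \<open>Commuting \<open>L\<close> past one \<open>\<Lambda>\<close> after another adds the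
  weights n - k + 2s for s = 0, ..., r, whose sum is (r+1)(n-k+r).\<close>

lemma lower_pow_raise:
  fixes f :: "'v set \<Rightarrow> 'k::field"
  assumes f: "f \<in> ext_power k"
  shows "(\<Lambda> ^^ Suc r) (L f) =
    L ((\<Lambda> ^^ Suc r) f) + (\<lambda>B. of_int ((int r + 1) * (n - k + int r)) * (\<Lambda> ^^ r) f B)"
proof (induction r)
  case 0
  show ?case using lower_raise_ext[OF f] by simp
next
  case (Suc r)
  let ?c = "(int r + 1) * (n - k + int r)" and ?g = "(\<Lambda> ^^ Suc r) f"
  have "(\<Lambda> ^^ Suc (Suc r)) (L f) = \<Lambda> ((\<Lambda> ^^ Suc r) (L f))" by simp
  also have "\<dots> = \<Lambda> (L ?g) + (\<lambda>B. of_int ?c * \<Lambda> ((\<Lambda> ^^ r) f) B)"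
    unfolding Suc lower_add lower_scale ..
  also have "\<Lambda> (L ?g) = L (\<Lambda> ?g) + (\<lambda>B. of_int (n - (k - 2 * int (Suc r))) * ?g B)"
    by (rule lower_raise_ext[OF lower_pow_ext[OF f]])
  also have "L (\<Lambda> ?g) + (\<lambda>B. of_int (n - (k - 2 * int (Suc r))) * ?g B) + (\<lambda>B. of_int ?c * \<Lambda> ((\<Lambda> ^^ r) f) B) =
      L (\<Lambda> ?g) + (\<lambda>B. of_int ((n - (k - 2 * int (Suc r))) + ?c) * ?g B)"
    by (simp add: fun_eq_iff algebra_simps)
  also have "(n - (k - 2 * int (Suc r))) + ?c = (int (Suc r) + 1) * (n - k + int (Suc r))"
    by (simp add: algebra_simps)
  finally show ?case by simp
qed

text \<open>Dually, the weights n - k - 2s for s = 0, ..., r add up to (r+1)(n-k-r).\<close>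

lemma lower_raise_pow:
  fixes f :: "'v set \<Rightarrow> 'k::field"
  assumes f: "f \<in> ext_power k"
  shows "\<Lambda> ((L ^^ Suc r) f) =
    (L ^^ Suc r) (\<Lambda> f) + (\<lambda>B. of_int ((int r + 1) * (n - k - int r)) * (L ^^ r) f B)"
proof (induction r)
  case 0
  show ?case using lower_raise_ext[OF f] by simp
next
  case (Suc r)
  let ?c = "(int r + 1) * (n - k - int r)" and ?g = "(L ^^ Suc r) f"
  have "\<Lambda> ((L ^^ Suc (Suc r)) f) = \<Lambda> (L ?g)" by simp
  also have "\<dots> = L (\<Lambda> ?g) + (\<lambda>B. of_int (n - (k + 2 * int (Suc r))) * ?g B)"
    by (rule lower_raise_ext[OF raise_pow_ext[OF f]])
  also have "L (\<Lambda> ?g) = L ((L ^^ Suc r) (\<Lambda> f)) + (\<lambda>B. of_int ?c * L ((L ^^ r) f) B)"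
    unfolding Suc raise_add raise_scale ..
  also have "L ((L ^^ Suc r) (\<Lambda> f)) + (\<lambda>B. of_int ?c * L ((L ^^ r) f) B) +
      (\<lambda>B. of_int (n - (k + 2 * int (Suc r))) * ?g B) =
      L ((L ^^ Suc r) (\<Lambda> f)) + (\<lambda>B. of_int (?c + (n - (k + 2 * int (Suc r)))) * ?g B)"
    by (simp add: fun_eq_iff algebra_simps)
  also have "?c + (n - (k + 2 * int (Suc r))) = (int (Suc r) + 1) * (n - k - int (Suc r))"
    by (simp add: algebra_simps)
  finally show ?case by simp
qed

text \<open>Induction on the order of nilpotency of \<open>\<Lambda>\<close> at g. The scalar c is
  positive as an integer for k at most n - 1, and the error \<open>h\<close> of c g against
  \<open>\<Lambda> (L g)\<close> is killed by one power less, so \<open>h\<close> is in the image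
  and c can be divided out.\<close>

lemma lower_surj:
  fixes g :: "'v set \<Rightarrow> 'k::field_char_0"
  assumes k: "k \<le> n - 1" and g: "g \<in> ext_power k"
  shows "\<exists>f \<in> ext_power (k + 2). \<Lambda> f = g"
proof -
  interpret \<Lambda>: Vector_Spaces.linear fscale fscale "\<Lambda> :: ('v set \<Rightarrow> 'k) \<Rightarrow> _" by (rule flinear_lower)
  have "\<exists>f \<in> ext_power (k + 2). \<Lambda> f = g" if "(\<Lambda> ^^ r) g = 0" "g \<in> ext_power k" for r and g :: "'v set \<Rightarrow> 'k"
    using that
  proof (induction r arbitrary: g)
    case 0
    hence "g = 0" by (simp only: funpow.simps id_apply)
    hence "\<Lambda> 0 = g" by simp
    thus ?case using fs.subspace_0[OF ext_power_subspace] by blast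
  next
    case (Suc r)
    interpret P: Vector_Spaces.linear fscale fscale "\<Lambda> ^^ r :: ('v set \<Rightarrow> 'k) \<Rightarrow> _"
      by (rule flinear_funpow[OF flinear_lower])
    define c :: 'k where "c = of_int ((int r + 1) * (n - k + int r))"
    have c: "c \<noteq> 0" unfolding c_def of_int_eq_0_iff using k by simp
    have Lg: "L g \<in> ext_power (k + 2)" using lower_ext_power(2)[OF card2 Suc.prems(2)] .
    define h where "h = \<Lambda> (L g) - (\<lambda>B. c * g B)"
    have "h \<in> ext_power k"
      unfolding h_def
    proof (rule fs.subspace_diff[OF ext_power_subspace])
      show "\<Lambda> (L g) \<in> ext_power k" using lower_ext_power(1)[OF card2 Lg] by simp
    qed (rule fs.subspace_scale[OF ext_power_subspace Suc.prems(2)])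
    moreover have "(\<Lambda> ^^ r) h = 0"
    proof -
      have "(\<Lambda> ^^ r) h = (\<Lambda> ^^ Suc r) (L g) - (\<lambda>B. c * (\<Lambda> ^^ r) g B)"
        unfolding h_def P.diff P.scale funpow_Suc_right o_apply ..
      also have "\<dots> = L ((\<Lambda> ^^ Suc r) g)"
        unfolding lower_pow_raise[OF Suc.prems(2)] c_def by simp
      finally show ?thesis unfolding Suc.prems(1) by simp
    qed
    ultimately obtain f where f: "f \<in> ext_power (k + 2)" "\<Lambda> f = h" using Suc.IH by blast
    define f' where "f' = (\<lambda>B. inverse c * (L g - f) B)"
    have "f' \<in> ext_power (k + 2)" unfolding f'_def
      by (rule fs.subspace_scale[OF ext_power_subspace fs.subspace_diff[OF ext_power_subspace Lg f(1)]])
    moreover have "\<Lambda> f' = g"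
    proof -
      have "\<Lambda> f' = (\<lambda>B. inverse c * (\<Lambda> (L g) - h) B)" unfolding f'_def \<Lambda>.scale \<Lambda>.diff f(2) ..
      also have "\<dots> = g" using c by (simp add: h_def fun_eq_iff)
      finally show ?thesis .
    qed
    ultimately show ?case by blast
  qed
  \<comment> \<open>The induction starts because so many contractions lead to negative exterior
    degree.\<close>
  moreover have "(\<Lambda> ^^ Suc (nat k)) g = 0"
    using ext_power_trivial[OF lower_pow_ext[OF g, of "Suc (nat k)"]] by (simp add: fun_eq_iff)
  ultimately show ?thesis using g by blast
qed

text \<open>If f is killed by \<open>\<Lambda>\<close>, then contracting the (r+1)-fold raise of f
  gives a multiple of the r-fold raise, with an integer factor that is negative for k at least n +
  1. Vanishing thus descends from a high power of \<open>L\<close>, which exceeds the top exterior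
  degree, to f itself.\<close>

lemma lower_inj:
  fixes f :: "'v set \<Rightarrow> 'k::field_char_0"
  assumes k: "k \<ge> n + 1" and f: "f \<in> ext_power k" and zero: "\<Lambda> f = 0"
  shows "f = 0"
proof -
  have L0: "(L ^^ r) 0 = (0 :: 'v set \<Rightarrow> 'k)" for r
    by (induction r) (simp_all only: funpow.simps id_apply o_apply raise_0)
  have "f = 0" if "(L ^^ r) f = 0" for r using that
  proof (induction r)
    case (Suc r)
    have "0 = \<Lambda> ((L ^^ Suc r) f)" unfolding Suc.prems by simp
    also have "\<dots> = (\<lambda>B. of_int ((int r + 1) * (n - k - int r)) * (L ^^ r) f B)"
      unfolding lower_raise_pow[OF f] zero L0 by simp
    finally have *: "of_int ((int r + 1) * (n - k - int r)) * (L ^^ r) f B = 0" for B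
      by (metis zero_fun_apply)
    have "(of_int ((int r + 1) * (n - k - int r)) :: 'k) \<noteq> 0"
      unfolding of_int_eq_0_iff using k by simp
    hence "(L ^^ r) f B = 0" for B using * by simp
    hence "(L ^^ r) f = 0" by (simp add: fun_eq_iff)
    thus ?case by (rule Suc.IH)
  qed simp
  moreover have "(L ^^ (2 * card Pr)) f = 0"
    using ext_power_trivial[OF raise_pow_ext[OF f, of "2 * card Pr"]] k card_UNIV by (simp add: fun_eq_iff)
  ultimately show ?thesis by blast
qed

text \<open>One map for both ranges: a section of \<open>\<Lambda>\<close> below the middle, a
  retraction above it, and a two-sided inverse at k = n - 1. Above the middle its kernel within
  degree k is a complement of the image of \<open>\<Lambda>\<close>, which represents the
  cokernel.\<close>

definition is_lefschetz_inverse :: "int \<Rightarrow> (('v set \<Rightarrow> 'k::field_char_0) \<Rightarrow> 'v set \<Rightarrow> 'k) \<Rightarrow> bool" where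
  "is_lefschetz_inverse k R \<longleftrightarrow> flinear R \<and> range R \<subseteq> ext_power (k + 2) \<and>
     (k \<le> n - 1 \<longrightarrow> (\<forall>f \<in> ext_power k. \<Lambda> (R f) = f)) \<and>
     (k \<ge> n - 1 \<longrightarrow> (\<forall>f \<in> ext_power (k + 2). R (\<Lambda> f) = f))"

definition lefschetz_inverse :: "int \<Rightarrow> ('v set \<Rightarrow> 'k::field_char_0) \<Rightarrow> 'v set \<Rightarrow> 'k" where
  "lefschetz_inverse k = (SOME R. is_lefschetz_inverse k R)"

lemma lefschetz_inverse:
  "is_lefschetz_inverse k (lefschetz_inverse k :: ('v set \<Rightarrow> 'k::field_char_0) \<Rightarrow> 'v set \<Rightarrow> 'k)"
proof -
  interpret \<Lambda>: Vector_Spaces.linear fscale fscale "\<Lambda> :: ('v set \<Rightarrow> 'k) \<Rightarrow> _" by (rule flinear_lower)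
  let ?E = "ext_power (k + 2) :: ('v set \<Rightarrow> 'k) set"
  have "\<exists>R. is_lefschetz_inverse k (R :: ('v set \<Rightarrow> 'k) \<Rightarrow> 'v set \<Rightarrow> 'k)"
  proof (cases "k \<ge> n - 1")
    case True
    have "inj_on (\<Lambda> :: ('v set \<Rightarrow> 'k) \<Rightarrow> _) ?E"
    proof (rule inj_onI)
      fix x y :: "'v set \<Rightarrow> 'k" assume xy: "x \<in> ?E" "y \<in> ?E" "\<Lambda> x = \<Lambda> y"
      have "x - y = 0"
        by (rule lower_inj[of "k + 2"])
          (use True xy fs.subspace_diff[OF ext_power_subspace xy(1,2)] \<Lambda>.diff[of x y] in auto)
      thus "x = y" by simp
    qed
    then obtain R where R: "range R \<subseteq> ?E" "flinear R" "\<forall>v\<in>?E. R (\<Lambda> v) = v"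
      using fsp.linear_exists_left_inverse_on[OF flinear_lower ext_power_subspace] by blast
    \<comment> \<open>This case arises only for k = n - 1, where surjectivity turns the left inverse
      into a right inverse.\<close>
    have "\<Lambda> (R f) = f" if "k \<le> n - 1" "f \<in> ext_power k" for f
    proof -
      obtain h where "h \<in> ?E" "\<Lambda> h = f" using lower_surj[OF \<open>k \<le> n - 1\<close> \<open>f \<in> ext_power k\<close>] by blast
      thus ?thesis using R(3) by auto
    qed
    thus ?thesis using R unfolding is_lefschetz_inverse_def by blast
  next
    case False
    obtain R where R: "range R \<subseteq> ?E" "flinear R" "\<forall>v\<in>\<Lambda> ` ?E. \<Lambda> (R v) = v"
      using fsp.linear_exists_right_inverse_on[OF flinear_lower ext_power_subspace] by blast
    have "\<Lambda> (R f) = f" if f: "f \<in> ext_power k" for f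
    proof -
      have "f \<in> \<Lambda> ` ?E" using lower_surj[OF _ f] False by fastforce
      thus ?thesis using R(3) by blast
    qed
    thus ?thesis using R False unfolding is_lefschetz_inverse_def by auto
  qed
  thus ?thesis unfolding lefschetz_inverse_def by (rule someI_ex)
qed

end

subsection \<open>The minimized mapping cone\<close>

context symplectic_basis
begin

definition R :: "int \<Rightarrow> ('v set \<Rightarrow> ('v, 'k::field_char_0) mpoly) \<Rightarrow> 'v set \<Rightarrow> ('v, 'k) mpoly" where
  "R k = extend_map UNIV (lefschetz_inverse k)"

lemma lefschetz_inverse_props:
  fixes f :: "'v set \<Rightarrow> 'k::field_char_0"
  shows "flinear (lefschetz_inverse k :: ('v set \<Rightarrow> 'k) \<Rightarrow> 'v set \<Rightarrow> 'k)"
    and "lefschetz_inverse k f \<in> ext_power (k + 2)"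
    and "k \<le> n - 1 \<Longrightarrow> f \<in> ext_power k \<Longrightarrow> \<Lambda> (lefschetz_inverse k f) = f"
    and "k \<ge> n - 1 \<Longrightarrow> f \<in> ext_power (k + 2) \<Longrightarrow> lefschetz_inverse k (\<Lambda> f) = f"
  using lefschetz_inverse[of k, where 'k = 'k] unfolding is_lefschetz_inverse_def by blast+

lemma slice_R: "slice m (R k f) = lefschetz_inverse k (slice m f)"
  unfolding R_def by (rule slice_extend_map[OF lefschetz_inverse_props(1)]) auto

lemma R_add: "R k (f + g) = R k f + R k g"
  and R_diff: "R k (f - g) = R k f - R k g"
  and R_sm: "R k (sm p f) = sm p (R k f)"
  and R_0 [simp]: "R k 0 = 0"
  by (simp_all only: R_def extend_map_add extend_map_diff extend_map_sm extend_map_0)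

lemma R_ext_power: "j = k + 2 \<Longrightarrow> R k f \<in> ext_power j"
  by (subst slice_ext_power) (simp add: slice_R lefschetz_inverse_props(2))

lemma lower_R: "f \<in> ext_power k \<Longrightarrow> k \<le> n - 1 \<Longrightarrow> \<Lambda> (R k f) = f"
  by (rule slice_eqI) (simp add: slice_lower slice_R lefschetz_inverse_props(3) slice_ext_power)

lemma R_lower: "f \<in> ext_power j \<Longrightarrow> j = k + 2 \<Longrightarrow> k \<ge> n - 1 \<Longrightarrow> R k (\<Lambda> f) = f"
  by (rule slice_eqI) (simp add: slice_lower slice_R lefschetz_inverse_props(4) slice_ext_power)

text \<open>On degree k with k at least n - 1 this projects onto the kernel of \<open>R k\<close>
  along the image of \<open>\<Lambda>\<close>; it picks the representative of a class in the
  cokernel.\<close>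

definition proj :: "int \<Rightarrow> ('v set \<Rightarrow> ('v, 'k::field_char_0) mpoly) \<Rightarrow> 'v set \<Rightarrow> ('v, 'k) mpoly" where
  "proj k f = f - \<Lambda> (R k f)"

lemma proj_add: "proj k (f + g) = proj k f + proj k g"
  and proj_diff: "proj k (f - g) = proj k f - proj k g"
  and proj_sm: "proj k (sm p f) = sm p (proj k f)"
  by (simp_all add: proj_def R_add R_diff R_sm lower_add lower_diff lower_sm)
    (simp_all add: fun_eq_iff algebra_simps)

lemma lower_ext:
  assumes "f \<in> ext_power k" "k = j + 2"
  shows "\<Lambda> f \<in> ext_power j"
  using lower_ext_power(1)[OF card2 assms(1)] assms(2) by simp

lemma koszul_ext: "f \<in> ext_power k \<Longrightarrow> k = j + 1 \<Longrightarrow> \<partial> f \<in> ext_power j"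
  by (rule koszul_ext_power) simp

lemma koszul_exact_ext:
  assumes "f \<in> ext_power k" "\<partial> f = 0" "k \<ge> 1" "j = k + 1"
  obtains g where "g \<in> ext_power j" "\<partial> g = f"
  using koszul_exact[OF idx assms(1,3,2)] assms(4) by auto

lemma ext_power_diff:
  fixes f g :: "'v set \<Rightarrow> 'b::group_add"
  assumes "f \<in> ext_power k" "g \<in> ext_power k"
  shows "f - g \<in> ext_power k"
  using assms unfolding ext_power_def by (auto, metis diff_zero)

lemma proj_ext: "f \<in> ext_power k \<Longrightarrow> proj k f \<in> ext_power k"
  unfolding proj_def by (intro ext_power_diff lower_ext[OF R_ext_power]) simp_all

lemma proj_lower: "f \<in> ext_power j \<Longrightarrow> j = k + 2 \<Longrightarrow> k \<ge> n - 1 \<Longrightarrow> proj k (\<Lambda> f) = 0"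
  by (simp add: proj_def R_lower)

lemma R_proj: "k \<ge> n - 1 \<Longrightarrow> R k (proj k f) = 0"
  by (simp add: proj_def R_diff R_lower[OF R_ext_power])

lemma proj_id: "R k f = 0 \<Longrightarrow> proj k f = f"
  by (simp add: proj_def)

text \<open>The differential is well defined on cokernels: changing a representative by an element
  of the image of \<open>\<Lambda>\<close> changes its boundary by one too, as
  \<open>\<Lambda>\<close> commutes with \<open>\<partial>\<close>.\<close>

lemma koszul_proj:
  assumes "k \<ge> n - 1" "j = k + 1"
  shows "proj k (\<partial> (proj j f)) = proj k (\<partial> f)"
proof -
  have "\<partial> (R j f) \<in> ext_power (j + 1)" by (rule koszul_ext[OF R_ext_power]) simp_all
  hence "proj k (\<partial> (\<Lambda> (R j f))) = 0"
    unfolding lower_koszul[symmetric] by (rule proj_lower) (use assms in simp_all)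
  thus ?thesis unfolding proj_def[of j] koszul_diff proj_diff by simp
qed

text \<open>The middle map is well defined on the cokernel: on \<open>\<Lambda> w\<close> the
  inverse cancels \<open>\<Lambda>\<close>, and
  \<open>\<partial> (\<partial> w) = 0\<close>.\<close>

lemma koszul_R_koszul_proj: "\<partial> (R (n - 1) (\<partial> (proj n f))) = \<partial> (R (n - 1) (\<partial> f))"
proof -
  have "\<partial> (R n f) \<in> ext_power (n + 1)" by (rule koszul_ext[OF R_ext_power]) simp_all
  hence "R (n - 1) (\<partial> (\<Lambda> (R n f))) = \<partial> (R n f)"
    unfolding lower_koszul[symmetric] by (rule R_lower) simp_all
  thus ?thesis unfolding proj_def koszul_diff R_diff by (simp add: koszul_koszul[OF idx])
qed

text \<open>The second branch is a copy of the cokernel of \<open>\<Lambda>\<close> in degree i. It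
  keeps all terms inside one function space, as \<open>module_of_subspaces\<close> requires.\<close>

definition syz_space :: "nat \<Rightarrow> ('v set \<Rightarrow> 'k::field_char_0) set" where
  "syz_space i = (if i < card Pr then {w \<in> ext_power (int i + 1). \<Lambda> w = 0}
     else {w \<in> ext_power (int i). lefschetz_inverse (int i) w = 0})"

text \<open>The index is that of the target. The middle map starts in exterior degree n, passes
  through n - 1 and n + 1 and ends in n, so its entries are quadratic.\<close>

definition syz_map :: "nat \<Rightarrow> ('v set \<Rightarrow> ('v, 'k::field_char_0) mpoly) \<Rightarrow> 'v set \<Rightarrow> ('v, 'k) mpoly" where
  "syz_map i f = (if Suc i < card Pr then \<partial> f
     else if Suc i = card Pr then \<partial> (R (int i) (\<partial> f))
     else proj (int i) (\<partial> f))"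

lemma extend_syz_space:
  fixes f :: "'v set \<Rightarrow> ('v, 'k::field_char_0) mpoly"
  shows "i < card Pr \<Longrightarrow> f \<in> extend_scalars (syz_space i) \<longleftrightarrow> f \<in> ext_power (int i + 1) \<and> \<Lambda> f = 0"
    and "i \<ge> card Pr \<Longrightarrow> f \<in> extend_scalars (syz_space i) \<longleftrightarrow> f \<in> ext_power (int i) \<and> R (int i) f = 0"
proof -
  have z: "g = 0 \<longleftrightarrow> (\<forall>m. slice m g = 0)" for g :: "'v set \<Rightarrow> ('v, 'k) mpoly"
    using slice_eqI[of g 0] by auto
  show "i < card Pr \<Longrightarrow> f \<in> extend_scalars (syz_space i) \<longleftrightarrow> f \<in> ext_power (int i + 1) \<and> \<Lambda> f = 0"
    unfolding z[of "\<Lambda> f"] slice_ext_power[of f] slice_lower by (auto simp: extend_scalars_def syz_space_def)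
  show "i \<ge> card Pr \<Longrightarrow> f \<in> extend_scalars (syz_space i) \<longleftrightarrow> f \<in> ext_power (int i) \<and> R (int i) f = 0"
    unfolding z[of "R (int i) f"] slice_ext_power[of f] slice_R by (auto simp: extend_scalars_def syz_space_def)
qed

lemma syz_map_maps:
  assumes f: "f \<in> extend_scalars (syz_space (Suc i))"
  shows "syz_map i f \<in> extend_scalars (syz_space i)"
proof -
  consider "Suc i < card Pr" | "Suc i = card Pr" | "i \<ge> card Pr" by linarith
  thus ?thesis
  proof cases
    case 1
    hence f': "f \<in> ext_power (int (Suc i) + 1)" "\<Lambda> f = 0" using f extend_syz_space(1)[of "Suc i" f] by auto
    have "\<partial> f \<in> ext_power (int i + 1)" by (rule koszul_ext[OF f'(1)]) simp
    moreover have "\<Lambda> (\<partial> f) = 0" by (simp add: lower_koszul f'(2))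
    ultimately show ?thesis using 1 extend_syz_space(1)[of i "\<partial> f"] by (simp add: syz_map_def)
  next
    case 2
    hence "f \<in> ext_power (int (Suc i))" using f extend_syz_space(2)[of "Suc i" f] by auto
    hence df: "\<partial> f \<in> ext_power (int i)" by (rule koszul_ext) simp
    let ?g = "\<partial> (R (int i) (\<partial> f))"
    have "?g \<in> ext_power (int i + 1)" by (rule koszul_ext[OF R_ext_power]) simp_all
    \<comment> \<open>\<open>\<Lambda>\<close> moves past the outer \<open>\<partial>\<close> and
      cancels its inverse, leaving the square of \<open>\<partial>\<close>.\<close>
    moreover have "\<Lambda> ?g = 0"
      using lower_R[OF df] 2 koszul_koszul[OF idx, of f] by (simp add: lower_koszul)
    ultimately show ?thesis using 2 extend_syz_space(1)[of i ?g] by (simp add: syz_map_def)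
  next
    case 3
    hence "f \<in> ext_power (int (Suc i))" using f extend_syz_space(2)[of "Suc i" f] by auto
    hence df: "\<partial> f \<in> ext_power (int i)" by (rule koszul_ext) simp
    show ?thesis using 3 extend_syz_space(2)[of i "proj (int i) (\<partial> f)"] proj_ext[OF df] R_proj[of "int i" "\<partial> f"]
      by (simp add: syz_map_def)
  qed
qed

lemma syz_map_comp: "syz_map i (syz_map (Suc i) f) = 0"
proof -
  note dd = koszul_koszul[OF idx]
  consider "Suc (Suc i) < card Pr" | "Suc (Suc i) = card Pr" | "Suc i = card Pr" | "i \<ge> card Pr" by linarith
  thus ?thesis
  proof cases
    case 3
    hence n1: "int i = n - 1" "int (Suc i) = n" by auto
    have "syz_map i (syz_map (Suc i) f) = \<partial> (R (int i) (\<partial> (proj (int (Suc i)) (\<partial> f))))"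
      using 3 by (simp add: syz_map_def)
    also have "\<dots> = \<partial> (R (n - 1) (\<partial> (proj n (\<partial> f))))" unfolding n1 ..
    finally show ?thesis by (simp add: koszul_R_koszul_proj dd)
  next
    case 4
    hence "syz_map i (syz_map (Suc i) f) = proj (int i) (\<partial> (proj (int (Suc i)) (\<partial> f)))"
      by (simp add: syz_map_def)
    also have "\<dots> = proj (int i) (\<partial> (\<partial> f))" by (rule koszul_proj) (use 4 in simp_all)
    finally show ?thesis by (simp add: dd proj_def)
  qed (simp_all add: syz_map_def dd)
qed

text \<open>Four positions of f: among the kernels, at the last kernel (target of the middle map),
  at the first cokernel (source of the middle map), and among the later cokernels. In each, a Koszul
  primitive is corrected by a second one found after applying \<open>\<Lambda>\<close> or its
  inverse.\<close>

lemma syz_map_exact: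
  fixes f :: "'v set \<Rightarrow> ('v, 'k::field_char_0) mpoly"
  assumes f: "f \<in> extend_scalars (syz_space (Suc i))" and z: "syz_map i f = 0"
  shows "\<exists>g \<in> extend_scalars (syz_space (Suc (Suc i))). syz_map (Suc i) g = f"
proof -
  note dd = koszul_koszul[OF idx]
  define k where "k = int (Suc i)"
  have k: "int i = k - 1" "int (Suc i) = k" "int (Suc (Suc i)) = k + 1" "k \<ge> 1" by (auto simp: k_def)
  consider "Suc (Suc i) < card Pr" | "Suc (Suc i) = card Pr" | "Suc i = card Pr" | "i \<ge> card Pr" by linarith
  thus ?thesis
  proof cases
    case 1
    hence kn: "k < n - 1" unfolding k_def by linarith
    have f': "f \<in> ext_power (k + 1)" "\<Lambda> f = 0"
      using f extend_syz_space(1)[of "Suc i" f] 1 unfolding k(2) by auto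
    have df: "\<partial> f = 0" using z 1 by (simp add: syz_map_def)
    obtain g where g: "g \<in> ext_power (k + 2)" "\<partial> g = f"
      by (rule koszul_exact_ext[OF f'(1) df, of "k + 2"]) (use k(4) in simp_all)
    have lg: "\<Lambda> g \<in> ext_power k" by (rule lower_ext[OF g(1)]) simp
    have dlg: "\<partial> (\<Lambda> g) = 0" using g(2) f'(2) lower_koszul[of g] by simp
    obtain u where u: "u \<in> ext_power (k + 1)" "\<partial> u = \<Lambda> g"
      by (rule koszul_exact_ext[OF lg dlg k(4), of "k + 1"]) simp_all
    \<comment> \<open>The primitive g of f need not be in the kernel of \<open>\<Lambda>\<close>.
      Here k + 1 is at most n - 1, so u lifts through \<open>\<Lambda>\<close> to v, and subtracting
      \<open>\<partial> v\<close> moves g into the kernel without changing its boundary.\<close>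
    define v where "v = R (k + 1) u"
    have "\<partial> v \<in> ext_power (k + 2)" unfolding v_def by (rule koszul_ext[OF R_ext_power]) simp_all
    hence e: "g - \<partial> v \<in> ext_power (k + 2)" by (rule ext_power_diff[OF g(1)])
    have kk: "k + 1 + 1 = k + 2" by simp
    have "\<Lambda> v = u" unfolding v_def by (rule lower_R[OF u(1)]) (use kn in simp)
    hence "\<Lambda> (g - \<partial> v) = 0" by (simp add: lower_diff lower_koszul u(2))
    hence "g - \<partial> v \<in> extend_scalars (syz_space (Suc (Suc i)))"
      using extend_syz_space(1)[of "Suc (Suc i)" "g - \<partial> v"] 1 e unfolding k(3) kk by blast
    moreover have "syz_map (Suc i) (g - \<partial> v) = f" using 1 by (simp add: syz_map_def koszul_diff dd g(2))
    ultimately show ?thesis by blast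
  next
    case 2
    hence kn: "k = n - 1" unfolding k_def by linarith
    have f': "f \<in> ext_power n" "\<Lambda> f = 0"
      using f extend_syz_space(1)[of "Suc i" f] 2 kn unfolding k(2) by auto
    have df: "\<partial> f = 0" using z 2 by (simp add: syz_map_def)
    obtain g where g: "g \<in> ext_power (n + 1)" "\<partial> g = f"
      by (rule koszul_exact_ext[OF f'(1) df, of "n + 1"]) (use k(4) kn in simp_all)
    have lg: "\<Lambda> g \<in> ext_power (n - 1)" by (rule lower_ext[OF g(1)]) simp
    have dlg: "\<partial> (\<Lambda> g) = 0" using g(2) f'(2) lower_koszul[of g] by simp
    obtain u where u: "u \<in> ext_power n" "\<partial> u = \<Lambda> g"
      by (rule koszul_exact_ext[OF lg dlg, of n]) (use k(4) kn in simp_all)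
    \<comment> \<open>In exterior degree n a lift of u through \<open>\<Lambda>\<close> is no longer
      guaranteed. Instead the class of u is the preimage: the inverse of \<open>\<Lambda>\<close>
      takes \<open>\<partial> u\<close> back to g.\<close>
    have "proj n u \<in> extend_scalars (syz_space (Suc (Suc i)))"
      using extend_syz_space(2)[of "Suc (Suc i)" "proj n u"] 2 proj_ext[OF u(1)] R_proj[of n u] by simp
    moreover have "\<partial> (R (n - 1) (\<partial> (proj n u))) = f"
      unfolding koszul_R_koszul_proj u(2) using R_lower[OF g(1), of "n - 1"] g(2) by simp
    hence "syz_map (Suc i) (proj n u) = f" using 2 unfolding syz_map_def k(2) kn by simp
    ultimately show ?thesis by blast
  next
    case 3
    hence kn: "k = n" unfolding k_def by linarith
    have f': "f \<in> ext_power n" "R n f = 0"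
      using f extend_syz_space(2)[of "Suc i" f] 3 by auto
    have df: "\<partial> f \<in> ext_power (n - 1)" by (rule koszul_ext[OF f'(1)]) simp
    have Rf: "R (n - 1) (\<partial> f) \<in> ext_power (n + 1)" by (rule R_ext_power) simp
    have dR: "\<partial> (R (n - 1) (\<partial> f)) = 0" using z 3 k(1) kn by (simp add: syz_map_def)
    \<comment> \<open>Applying \<open>\<Lambda>\<close> to a primitive h shows that
      \<open>\<Lambda> h\<close> and f have the same boundary. Their difference has a primitive, and
      \<open>proj\<close> later removes \<open>\<Lambda> h\<close>.\<close>
    obtain h where h: "h \<in> ext_power (n + 2)" "\<partial> h = R (n - 1) (\<partial> f)"
      by (rule koszul_exact_ext[OF Rf dR, of "n + 2"]) (use k(4) kn in simp_all)
    have lh: "\<Lambda> h \<in> ext_power n" by (rule lower_ext[OF h(1)]) simp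
    have "\<partial> (\<Lambda> h) = \<partial> f" using lower_koszul[of h] lower_R[OF df] h(2) by simp
    hence dz: "\<partial> (f - \<Lambda> h) = 0" by (simp add: koszul_diff)
    obtain g where g: "g \<in> ext_power (n + 1)" "\<partial> g = f - \<Lambda> h"
      by (rule koszul_exact_ext[OF ext_power_diff[OF f'(1) lh] dz, of "n + 1"]) (use k(4) kn in simp_all)
    have "proj n (\<partial> (proj (n + 1) g)) = proj n (\<partial> g)" by (rule koszul_proj) simp_all
    also have "\<dots> = f" unfolding g(2) proj_diff proj_id[OF f'(2)] using proj_lower[OF h(1), of n] by simp
    finally have "syz_map (Suc i) (proj (n + 1) g) = f" using 3 k(2) kn by (simp add: syz_map_def)
    moreover have "proj (n + 1) g \<in> extend_scalars (syz_space (Suc (Suc i)))"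
      using extend_syz_space(2)[of "Suc (Suc i)" "proj (n + 1) g"] 3 proj_ext[OF g(1)] R_proj[of "n + 1" g]
      unfolding k(3) kn by simp
    ultimately show ?thesis by blast
  next
    case 4
    hence kn: "k \<ge> n + 1" unfolding k_def by linarith
    have f': "f \<in> ext_power k" "R k f = 0"
      using f extend_syz_space(2)[of "Suc i" f] 4 unfolding k(2) by auto
    \<comment> \<open>The cycle condition in the cokernel says only that
      \<open>\<partial> f = \<Lambda> u\<close>. Injectivity of \<open>\<Lambda>\<close> on degree k
      at least n + 1 makes u a Koszul cycle, and its primitive v corrects f to a Koszul
      cycle.\<close>
    define u where "u = R (k - 1) (\<partial> f)"
    have u: "u \<in> ext_power (k + 1)" unfolding u_def by (rule R_ext_power) simp
    have fu: "\<partial> f = \<Lambda> u" using z 4 k(1) by (simp add: syz_map_def proj_def u_def)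
    have du: "\<partial> u \<in> ext_power k" by (rule koszul_ext[OF u]) simp
    have "\<Lambda> (\<partial> u) = 0" using dd[of f] fu by (simp add: lower_koszul)
    hence du0: "\<partial> u = 0" using R_lower[OF du, of "k - 2"] kn by simp
    obtain v where v: "v \<in> ext_power (k + 2)" "\<partial> v = u"
      by (rule koszul_exact_ext[OF u du0, of "k + 2"]) (use k(4) in simp_all)
    have lv: "\<Lambda> v \<in> ext_power k" by (rule lower_ext[OF v(1)]) simp
    have dz: "\<partial> (f - \<Lambda> v) = 0" using lower_koszul[of v] v(2) fu by (simp add: koszul_diff)
    obtain g where g: "g \<in> ext_power (k + 1)" "\<partial> g = f - \<Lambda> v"
      by (rule koszul_exact_ext[OF ext_power_diff[OF f'(1) lv] dz k(4), of "k + 1"]) simp_all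
    have "proj k (\<partial> (proj (k + 1) g)) = proj k (\<partial> g)" by (rule koszul_proj) (use kn in simp_all)
    also have "\<dots> = f" unfolding g(2) proj_diff proj_id[OF f'(2)] using proj_lower[OF v(1), of k] kn by simp
    finally have "syz_map (Suc i) (proj (k + 1) g) = f" using 4 k(2,3) by (simp add: syz_map_def)
    moreover have "proj (k + 1) g \<in> extend_scalars (syz_space (Suc (Suc i)))"
      using extend_syz_space(2)[of "Suc (Suc i)" "proj (k + 1) g"] 4 proj_ext[OF g(1)] R_proj[of "k + 1" g] kn
      unfolding k(3) by simp
    ultimately show ?thesis by blast
  qed
qed

text \<open>The degree jumps by 2 between positions n - 1 and n, where the middle map is
  quadratic.\<close>

definition syz_degree :: "nat \<Rightarrow> int" where
  "syz_degree i = (if i < card Pr then int i else int i + 1)"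

text \<open>Rank-nullity for \<open>\<Lambda>\<close> below position n and for its left inverse from
  n on. Both are onto: the first by hard Lefschetz, the second because every g is recovered from
  \<open>\<Lambda> g\<close>.\<close>

lemma dim_syz_space:
  "int (fs.dim (syz_space i :: ('v set \<Rightarrow> 'k::field_char_0) set)) =
     (if i < card Pr then binom (2 * card Pr) (int i + 1) - binom (2 * card Pr) (int i - 1)
      else binom (2 * card Pr) (int i) - binom (2 * card Pr) (int i + 2))"
proof (cases "i < card Pr")
  case True
  have im: "\<Lambda> ` ext_power (int i + 1) = (ext_power (int i - 1) :: ('v set \<Rightarrow> 'k) set)"
  proof
    show "\<Lambda> ` ext_power (int i + 1) \<subseteq> (ext_power (int i - 1) :: ('v set \<Rightarrow> 'k) set)"
      by (auto intro: lower_ext)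
    show "(ext_power (int i - 1) :: ('v set \<Rightarrow> 'k) set) \<subseteq> \<Lambda> ` ext_power (int i + 1)"
    proof
      fix g :: "'v set \<Rightarrow> 'k" assume "g \<in> ext_power (int i - 1)"
      then obtain f where "f \<in> ext_power (int i - 1 + 2)" "\<Lambda> f = g"
        using lower_surj[of "int i - 1" g] True by auto
      moreover have "int i - 1 + 2 = int i + 1" by simp
      ultimately show "g \<in> \<Lambda> ` ext_power (int i + 1)" by (auto simp only: image_iff)
    qed
  qed
  have "fs.dim {w \<in> ext_power (int i + 1). \<Lambda> w = (0 :: 'v set \<Rightarrow> 'k)} +
      fs.dim (\<Lambda> ` (ext_power (int i + 1) :: ('v set \<Rightarrow> 'k) set)) = fs.dim (ext_power (int i + 1) :: ('v set \<Rightarrow> 'k) set)"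
    by (rule dim_kernel_image[OF flinear_lower ext_power_subspace _ dim_ext_power(2)]) simp
  from arg_cong[OF this, of int] show ?thesis
    using True unfolding im of_nat_add dim_ext_power(1) syz_space_def card_UNIV by simp
next
  case False
  let ?R = "lefschetz_inverse (int i) :: ('v set \<Rightarrow> 'k) \<Rightarrow> _"
  have im: "?R ` ext_power (int i) = ext_power (int i + 2)"
  proof
    show "?R ` ext_power (int i) \<subseteq> ext_power (int i + 2)" using lefschetz_inverse_props(2) by auto
    show "ext_power (int i + 2) \<subseteq> ?R ` ext_power (int i)"
    proof
      fix g :: "'v set \<Rightarrow> 'k" assume g: "g \<in> ext_power (int i + 2)"
      have "g = ?R (\<Lambda> g)" using lefschetz_inverse_props(4)[OF _ g] False by simp
      moreover have "\<Lambda> g \<in> ext_power (int i)" by (rule lower_ext[OF g]) simp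
      ultimately show "g \<in> ?R ` ext_power (int i)" by blast
    qed
  qed
  have "fs.dim {w \<in> ext_power (int i). ?R w = 0} + fs.dim (?R ` ext_power (int i)) =
      fs.dim (ext_power (int i) :: ('v set \<Rightarrow> 'k) set)"
    by (rule dim_kernel_image[OF lefschetz_inverse_props(1) ext_power_subspace _ dim_ext_power(2)]) simp
  from arg_cong[OF this, of int] show ?thesis
    using False unfolding im of_nat_add dim_ext_power(1) syz_space_def card_UNIV by simp
qed

lemma syz_space_subspace: "fs.subspace (syz_space i :: ('v set \<Rightarrow> 'k::field_char_0) set)"
proof -
  have "fs.subspace {w \<in> E. T w = 0}" if "flinear T" "fs.subspace E" for T :: "('v set \<Rightarrow> 'k) \<Rightarrow> 'v set \<Rightarrow> 'k" and E
  proof -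
    interpret T: Vector_Spaces.linear fscale fscale T by fact
    show ?thesis using that(2) by (auto simp: fs.subspace_def T.zero T.add T.scale)
  qed
  from this[OF flinear_lower ext_power_subspace] this[OF lefschetz_inverse_props(1) ext_power_subspace]
  show ?thesis unfolding syz_space_def by simp
qed

lemma syz_map_homog:
  assumes "\<And>C. f C \<in> homog d"
  shows "syz_map i f B \<in> homog (d + syz_degree (Suc i) - syz_degree i)"
proof -
  have 1: "\<partial> f C \<in> homog (d + 1)" for C using koszul_homog[OF assms] .
  have 2: "R k (\<partial> f) C \<in> homog (d + 1)" for C k unfolding R_def by (rule extend_map_homog[OF 1])
  have 3: "\<partial> (R k (\<partial> f)) C \<in> homog (d + 1 + 1)" for C k by (rule koszul_homog[OF 2])
  have 4: "proj k (\<partial> f) C \<in> homog (d + 1)" for C k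
    unfolding proj_def using homog_diff[OF 1 lower_homog[OF 2]] by simp
  show ?thesis using 1 3 4 by (auto simp: syz_map_def syz_degree_def algebra_simps)
qed

lemma syz_map_cst_0: "coeff (syz_map i f B) 0 = 0"
proof -
  have "coeff (proj k (\<partial> f) B) 0 = 0" for k
    unfolding proj_def by (simp add: lookup_minus koszul_cst_0 lower_cst_0 R_def extend_map_cst_0)
  thus ?thesis by (simp add: syz_map_def koszul_cst_0)
qed

lemma syz_map_add: "syz_map i (f + g) = syz_map i f + syz_map i g"
  and syz_map_sm: "syz_map i (sm p f) = sm p (syz_map i f)"
  by (simp_all only: syz_map_def koszul_add koszul_sm R_add R_sm proj_add proj_sm split: if_split) auto

lemma module_exists:
  obtains M :: "(('v, 'k::field_char_0) mpoly, (nat \<Rightarrow> ('v, 'k) mpoly) set) gmodule" and F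
    where "graded_module M" "minimal_resolution M F"
      "shifts F = (\<lambda>i. replicate (fs.dim (syz_space i :: ('v set \<Rightarrow> 'k) set)) (syz_degree i))"
proof (rule module_of_subspaces[of "syz_space :: nat \<Rightarrow> ('v set \<Rightarrow> 'k) set" syz_map syz_degree])
  show "syz_map i f B \<in> homog (d + syz_degree (Suc i) - syz_degree i)"
    if "\<And>C. f C \<in> homog d" for i f d B using syz_map_homog[OF that] .
  show "\<exists>g \<in> extend_scalars (syz_space (Suc (Suc i))). syz_map (Suc i) g = f"
    if "f \<in> extend_scalars (syz_space (Suc i))" "syz_map i f = 0"
    for i and f :: "'v set \<Rightarrow> ('v, 'k) mpoly" using syz_map_exact[OF that] .
  show "fs.subspace (syz_space i :: ('v set \<Rightarrow> 'k) set)" for i by (rule syz_space_subspace)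
  show "syz_map i (f + g) = syz_map i f + syz_map i g" for i and f g :: "'v set \<Rightarrow> ('v, 'k) mpoly"
    by (rule syz_map_add)
  show "syz_map i (sm p f) = sm p (syz_map i f)" for i p and f :: "'v set \<Rightarrow> ('v, 'k) mpoly"
    by (rule syz_map_sm)
  show "syz_map i f \<in> extend_scalars (syz_space i)" if "f \<in> extend_scalars (syz_space (Suc i))"
    for i and f :: "'v set \<Rightarrow> ('v, 'k) mpoly" by (rule syz_map_maps[OF that])
  show "syz_map i (syz_map (Suc i) f) = 0" for i and f :: "'v set \<Rightarrow> ('v, 'k) mpoly" by (rule syz_map_comp)
  show "coeff (syz_map i f B) 0 = 0" for i B and f :: "'v set \<Rightarrow> ('v, 'k) mpoly"
    by (rule syz_map_cst_0)
qed (rule that)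

end

subsection \<open>The Betti numbers\<close>

lemma binom_of_nat: "binom m (int k) = int (m choose k)"
  by (simp add: binom_def)

lemma count_list_replicate: "count_list (replicate m x) y = (if y = x then m else 0)"
  by (induction m) auto

text \<open>The variables are numbered from 0 and those with numbers 2i and 2i + 1 form a pair. A
  pair lies entirely before or entirely after any other variable, so the count is 2 or 0.\<close>

lemma symplectic_basis_exists:
  assumes card: "card (UNIV :: 'v::finite set) = 2 * m"
  obtains idx :: "'v::finite \<Rightarrow> nat" and Pr where "symplectic_basis idx Pr"
proof -
  obtain idx :: "'v \<Rightarrow> nat" where bij: "bij_betw idx UNIV {0..<2 * m}"
    using ex_bij_betw_finite_nat[of "UNIV :: 'v set"] card by auto
  hence inj: "inj idx" and ran: "range idx = {0..<2 * m}" by (auto simp: bij_betw_def)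
  define P where "P i = {a. idx a div 2 = i}" for i
  have "symplectic_basis idx (P ` {..<m})"
  proof
    show "inj idx" by fact
    show "\<Union> (P ` {..<m}) = UNIV"
    proof (intro equalityI subsetI UNIV_I)
      fix a
      have "idx a < 2 * m" using ran by (metis atLeastLessThan_iff rangeI)
      hence "idx a div 2 < m" by linarith
      thus "a \<in> \<Union> (P ` {..<m})" by (auto simp: P_def)
    qed
    show "p \<inter> q = {}" if "p \<in> P ` {..<m}" "q \<in> P ` {..<m}" "p \<noteq> q" for p q
      using that by (auto simp: P_def)
    show c2: "card p = 2" if "p \<in> P ` {..<m}" for p
    proof -
      obtain i where i: "i < m" "p = P i" using \<open>p \<in> P ` {..<m}\<close> by auto
      have "idx ` p = {2 * i, 2 * i + 1}"
      proof (intro equalityI subsetI)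
        fix x assume "x \<in> idx ` p"
        hence "x div 2 = i" by (auto simp: i P_def)
        thus "x \<in> {2 * i, 2 * i + 1}" by auto
      next
        fix x assume x: "x \<in> {2 * i, 2 * i + 1}"
        hence "x \<in> range idx" unfolding ran using i by auto
        then obtain a where "x = idx a" by blast
        moreover have "x div 2 = i" using x by auto
        ultimately show "x \<in> idx ` p" by (auto simp: i P_def)
      qed
      moreover have "card (idx ` p) = card p" using inj by (intro card_image) (auto intro: inj_on_subset)
      ultimately show ?thesis by simp
    qed
    show "even (card {b \<in> p. idx b < idx a})" if p: "p \<in> P ` {..<m}" "a \<notin> p" for p a
    proof -
      obtain i where i: "p = P i" using p by auto
      hence ne: "idx a div 2 \<noteq> i" using p(2) by (simp add: P_def)
      show ?thesis
      proof (cases "idx a div 2 < i")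
        case True
        hence "\<not> idx b < idx a" if "b \<in> p" for b using that div_le_mono[of "idx b" "idx a" 2] by (auto simp: i P_def)
        hence "{b \<in> p. idx b < idx a} = {}" by blast
        thus ?thesis by (simp only: card.empty even_zero)
      next
        case False
        hence "idx b < idx a" if "b \<in> p" for b
          using that ne div_le_mono[of "idx a" "idx b" 2] by (auto simp: i P_def not_le[symmetric])
        hence "{b \<in> p. idx b < idx a} = p" by blast
        thus ?thesis using c2[OF p(1)] by (simp only: even_numeral)
      qed
    qed
  qed
  thus thesis using that by blast
qed

lemma regularity_eq:
  fixes M :: "(('v::finite, 'k::field) mpoly, 'm) gmodule" and r :: int
  assumes F: "graded_free_resolution M F"
    and le: "\<And>i j. betti M i j \<noteq> 0 \<Longrightarrow> j \<le> int i + r"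
    and ex: "betti M i (int i + r) \<noteq> 0"
  shows "regularity M = ereal (real_of_int r)"
  unfolding regularity_def
proof (rule antisym)
  show "Sup {ereal (real_of_int (j - int i)) | i j. tor_cycles M i j \<noteq> tor_boundaries M i j} \<le> ereal (real_of_int r)"
  proof (rule Sup_least)
    fix x assume "x \<in> {ereal (real_of_int (j - int i)) | i j. tor_cycles M i j \<noteq> tor_boundaries M i j}"
    then obtain i j where x: "x = ereal (real_of_int (j - int i))" "betti M i j \<noteq> 0"
      using tor_nonzero_iff[OF F] by auto
    show "x \<le> ereal (real_of_int r)" unfolding x(1) ereal_less_eq of_int_le_iff using le[OF x(2)] by linarith
  qed
  show "ereal (real_of_int r) \<le> Sup {ereal (real_of_int (j - int i)) | i j. tor_cycles M i j \<noteq> tor_boundaries M i j}"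
  proof (intro Sup_upper CollectI exI conjI)
    show "tor_cycles M i (int i + r) \<noteq> tor_boundaries M i (int i + r)"
      using tor_nonzero_iff[OF F] ex by blast
  qed simp
qed

text \<open>The tail of a minimal resolution is again minimal, so the Betti numbers of the syzygy
  module are those of M shifted by k. The single degree d occurring at position k is its initial
  degree.\<close>

lemma lin_betti_Syz:
  fixes M :: "(('v::finite, 'k::field) mpoly, 'm) gmodule"
  assumes M: "graded_module M" and F: "minimal_resolution M F" and k: "k > 0"
    and d: "betti M k d \<noteq> 0" "\<And>j. betti M k j \<noteq> 0 \<Longrightarrow> j = d"
  shows "lin_betti (Syz k M) i = betti M (k + i) (d + int i)"
proof -
  define G where "G = some_minimal_resolution M"
  define G' where "G' = \<lparr>shifts = (\<lambda>i. shifts G (k + i)), diff = (\<lambda>i. diff G (k + i)), aug = diff G (k - 1)\<rparr>"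
  note S = Syz_resolution[OF M F k, folded G_def, folded G'_def]
  have cnt: "count_list (shifts G i) j = betti M i j" for i j using betti_minimal[OF M S(1)] by simp
  have "initial_degree (Syz k M) = d"
  proof (rule initial_degree_eq[OF S(3,5)])
    show "grade (Syz k M) e \<subseteq> aug G' ` grade (gfree (shifts G' 0)) e" for e
      using S(2)[of e] by (simp add: G'_def)
    show "shifts G' 0 \<noteq> []" using cnt[of k d] d(1) by (auto simp: G'_def)
    show "e = d" if "e \<in> set (shifts G' 0)" for e
    proof -
      have "count_list (shifts G k) e \<noteq> 0" using that by (simp add: G'_def count_list_0_iff)
      thus ?thesis using d(2) cnt by simp
    qed
  qed
  thus ?thesis unfolding lin_betti_def betti_minimal[OF S(3,5)] by (simp add: G'_def cnt)
qed

theorem theorem3p2: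
  fixes n :: nat
  assumes "n > 0" and "card (UNIV :: 'v::finite set) = 2 * n"
  shows "\<exists>M :: (('v, 'k::field_char_0) mpoly, (nat \<Rightarrow> ('v, 'k) mpoly) set) gmodule.
    graded_module M \<and>
    (\<exists>X. finite X \<and> X \<subseteq> grade M 0 \<and> generates M X) \<and>
    regularity M = 1 \<and>
    (\<forall>(i::nat) (j::int). int (betti M i j) =
       (if j = int i \<and> i \<le> n
          then binom (2 * n) (int i + 1) - binom (2 * n) (int i - 1)
        else if j = int i + 1 \<and> n \<le> i \<and> i \<le> 2 * n
          then binom (2 * n) (int i) - binom (2 * n) (int i + 2)
        else 0)) \<and>
    (let N = Syz n M in
       (\<forall>i::nat. int (lin_betti N i) =
          binom (2 * n) (int n + int i) - binom (2 * n) (int n + int i + 2)) \<and>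
       graded_syzygy_module n N \<and>
       lin_strand_length N = n \<and>
       (\<forall>i::nat. int i \<le> int n - 2 \<longrightarrow>
          int (lin_betti N i) < binom (n + n) (int i + int n)))"
proof -
  obtain idx :: "'v \<Rightarrow> nat" and Pr where "symplectic_basis idx Pr"
    using symplectic_basis_exists[OF assms(2)] by blast
  then interpret S: symplectic_basis idx Pr .
  have Pr: "card Pr = n" using S.card_UNIV assms(2) by simp
  obtain M :: "(('v, 'k) mpoly, (nat \<Rightarrow> ('v, 'k) mpoly) set) gmodule" and F
    where M: "graded_module M" and F: "minimal_resolution M F"
      and sh: "shifts F = (\<lambda>i. replicate (fs.dim (S.syz_space i :: ('v set \<Rightarrow> 'k) set)) (S.syz_degree i))"
    by (rule S.module_exists)
  note FR = minimal_resolutionD(1)[OF F]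
  \<comment> \<open>Each position i has one generator degree \<open>deg i\<close> with rank
    \<open>D i\<close>; the two-row form of the statement is derived from this.\<close>
  define D where "D i = (if i < n then binom (2 * n) (int i + 1) - binom (2 * n) (int i - 1)
      else binom (2 * n) (int i) - binom (2 * n) (int i + 2))" for i
  define deg where "deg i = (if i < n then int i else int i + 1)" for i
  have b: "int (betti M i j) = (if j = deg i then D i else 0)" for i j
    unfolding betti_minimal[OF M F] sh count_list_replicate
    using S.dim_syz_space[of i, where 'k = 'k] by (simp add: S.syz_degree_def Pr D_def deg_def)
  have bn: "j = deg i" if "betti M i j \<noteq> 0" for i j using b[of i j] that by (auto split: if_splits)
  have binom0: "binom (2 * n) k = 0" if "k > 2 * int n" for k
    using that by (simp add: binom_def binomial_eq_0)
  have D2n: "D (2 * n) = 1"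
    using binom0[of "2 * int n + 2"] binom_of_nat[of "2 * n" "2 * n"] by (simp add: D_def)
  \<comment> \<open>A generator of N in degree n + 1 is needed to fix its initial degree. For n = 1
    the subtracted coefficient has index beyond 2n, hence the case distinction.\<close>
  have Dn: "D n > 0"
  proof (cases "n + 2 \<le> 2 * n")
    case True
    have "binom (2 * n) (int n + 2) = int (2 * n choose (n + 2))"
      using binom_of_nat[of "2 * n" "n + 2"] by (simp only: of_nat_add of_nat_numeral)
    moreover have "(2 * n choose (n + 2)) < (2 * n choose n)"
      using binomial_strict_antimono[of n "n + 2" "2 * n"] True by simp
    ultimately show ?thesis using binom_of_nat[of "2 * n" n] by (simp add: D_def)
  next
    case False
    thus ?thesis using binom0[of "int n + 2"] binom_of_nat[of "2 * n" n] by (simp add: D_def)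
  qed
  have reg: "regularity M = 1"
  proof -
    have "regularity M = ereal (real_of_int 1)"
    proof (rule regularity_eq[OF FR])
      show "j \<le> int i + 1" if "betti M i j \<noteq> 0" for i j using bn[OF that] by (simp add: deg_def split: if_splits)
      \<comment> \<open>The last Betti number, 1 in degree 2n + 1, attains the regularity.\<close>
      show "betti M (2 * n) (int (2 * n) + 1) \<noteq> 0" using b[of "2 * n" "int (2 * n) + 1"] D2n by (simp add: deg_def)
    qed
    thus ?thesis by (simp add: one_ereal_def)
  qed
  \<comment> \<open>At i = n the first row of the statement also applies, although position n has no
    generators of degree n; by this symmetry its value there is 0.\<close>
  have sym: "binom (2 * n) (int n + 1) = binom (2 * n) (int n - 1)"
  proof -
    have "int n + 1 = int (n + 1)" "int n - 1 = int (n - 1)" using assms(1) by auto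
    moreover have "(2 * n choose (n + 1)) = (2 * n choose (n - 1))"
      using binomial_symmetric[of "n + 1" "2 * n"] assms(1) by simp
    ultimately show ?thesis by (simp only: binom_of_nat)
  qed
  have betti: "int (betti M i j) =
       (if j = int i \<and> i \<le> n
          then binom (2 * n) (int i + 1) - binom (2 * n) (int i - 1)
        else if j = int i + 1 \<and> n \<le> i \<and> i \<le> 2 * n
          then binom (2 * n) (int i) - binom (2 * n) (int i + 2)
        else 0)" for i j
  proof -
    consider "i < n" | "i = n" | "n < i" "i \<le> 2 * n" | "i > 2 * n" by linarith
    thus ?thesis
    proof cases
      case 2
      thus ?thesis unfolding b deg_def D_def using sym by simp
    next
      case 4
      thus ?thesis unfolding b deg_def D_def using binom0[of "int i"] binom0[of "int i + 2"] by simp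
    qed (auto simp: b deg_def D_def)
  qed
  have gen: "\<exists>X. finite X \<and> X \<subseteq> grade M 0 \<and> generates M X"
  proof (intro exI conjI)
    let ?X = "aug F ` bas ` {..<length (shifts F 0)}"
    show "finite ?X" by simp
    show "generates M ?X" by (rule generates_bas[OF M resolutionD(1,3)[OF FR]])
    have "shifts F 0 ! k = 0" if "k < length (shifts F 0)" for k
      using that assms(1) by (simp add: sh S.syz_degree_def Pr)
    thus "?X \<subseteq> grade M 0"
      using graded_homD(4)[OF resolutionD(1)[OF FR] bas_grade] by fastforce
  qed
  have lin: "int (lin_betti (Syz n M) i) = binom (2 * n) (int n + int i) - binom (2 * n) (int n + int i + 2)" for i
  proof -
    have "lin_betti (Syz n M) i = betti M (n + i) (int n + 1 + int i)"
    proof (rule lin_betti_Syz[OF M F assms(1)])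
      show "betti M n (int n + 1) \<noteq> 0" using b[of n "int n + 1"] Dn by (auto simp: deg_def)
      show "j = int n + 1" if "betti M n j \<noteq> 0" for j using bn[OF that] by (simp add: deg_def)
    qed
    thus ?thesis using b[of "n + i" "int n + 1 + int i"] by (simp add: deg_def D_def)
  qed
  have len: "lin_strand_length (Syz n M) = n"
    unfolding lin_strand_length_def
  proof (rule Max_eqI)
    have out: "i \<le> n" if "lin_betti (Syz n M) i \<noteq> 0" for i
    proof (rule ccontr)
      assume "\<not> i \<le> n"
      hence "int (lin_betti (Syz n M) i) = 0"
        unfolding lin using binom0[of "int n + int i"] binom0[of "int n + int i + 2"] by simp
      thus False using that by simp
    qed
    hence "{i. lin_betti (Syz n M) i \<noteq> 0} \<subseteq> {..n}" by auto
    thus "finite {i. lin_betti (Syz n M) i \<noteq> 0}" using finite_subset by blast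
    show "i \<le> n" if "i \<in> {i. lin_betti (Syz n M) i \<noteq> 0}" for i using out that by simp
    \<comment> \<open>Position n of the strand of N is position 2n of M, the end of the
      resolution.\<close>
    have "int (lin_betti (Syz n M) n) = 1"
      unfolding lin using D2n by (simp add: D_def)
    thus "n \<in> {i. lin_betti (Syz n M) i \<noteq> 0}" by auto
  qed
  have less: "int (lin_betti (Syz n M) i) < binom (n + n) (int i + int n)" if "int i \<le> int n - 2" for i
  proof -
    have "int n + int i + 2 = int (n + i + 2)" by simp
    hence "binom (2 * n) (int n + int i + 2) = int (2 * n choose (n + i + 2))" by (simp only: binom_of_nat)
    \<comment> \<open>The bound on i says exactly that the index n + i + 2 is at most 2n, so a
      positive number is subtracted from the conjectured bound.\<close>
    moreover have "(2 * n choose (n + i + 2)) > 0" using that by (intro zero_less_binomial) linarith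
    ultimately have "binom (2 * n) (int n + int i + 2) > 0" by linarith
    thus ?thesis unfolding lin by (simp add: add.commute mult_2)
  qed
  show ?thesis unfolding Let_def
    using M gen reg betti lin Syz_resolution(4)[OF M F assms(1)] len less by blast
qed

end
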